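(* Let $s,t$ be positive integers. There exists a deterministic pushdown automaton over the finite alphabet $\{\sigma[1],\dots,\sigma[s],\tau[1],\dots,\tau[t]\}$ whose accepted language consists only of reduced well-formed operation sequences and contains exactly one sequence from each equivalence class of well-formed operation sequences all of whose pushes have size at most $s$ and all of whose pops have size at most $t$.
   Context: Operation sequences: $\sigma[a]$ ($a\ge1$) denotes pushing the top $a$ elements of the input stack, as a block with relative order unchanged, onto the top of a working stack; $\tau[b]$ ($b\ge1$) denotes moving the top $b$ elements of the working stack, as a block with relative order unchanged, onto the top of an output stack; $\sigma=\sigma[1]$, $\tau=\tau[1]$. A well-formed operation sequence is a word $\alpha=\alpha_1\cdots\alpha_m$ in these symbols such that in every prefix the total push size is at least the total pop size, with equality for the whole word; its size $n$ is the total push size. Acting on an input stack containing $1,\dots,n$ with $1$ on top, it produces the permutation read from the final output stack top to bottom. Two well-formed sequences are equivalent if they have the same size and produce the same permutation. $\alpha$ is reduced if every consecutive pair $\alpha_i\alpha_{i+1}$ with $\alpha_i$ a push and $\alpha_{i+1}$ a pop equals $\sigma[1]\tau[1]$. *)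

theory Defs
  imports Main
begin

datatype op = Push nat | Pop nat

fun op_size :: "op \<Rightarrow> nat" where
  "op_size (Push a) = a" | "op_size (Pop b) = b"

fun is_push :: "op \<Rightarrow> bool" where
  "is_push (Push _) = True" | "is_push (Pop _) = False"

fun is_pop :: "op \<Rightarrow> bool" where
  "is_pop (Push _) = False" | "is_pop (Pop _) = True"

definition push_total :: "op list \<Rightarrow> nat" where
  "push_total xs = sum_list (map (\<lambda>x. case x of Push a \<Rightarrow> a | Pop _ \<Rightarrow> 0) xs)"

definition pop_total :: "op list \<Rightarrow> nat" where
  "pop_total xs = sum_list (map (\<lambda>x. case x of Pop b \<Rightarrow> b | Push _ \<Rightarrow> 0) xs)"

definition well_formed :: "op list \<Rightarrow> bool" where
  "well_formed xs \<longleftrightarrow>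
     (\<forall>x\<in>set xs. 1 \<le> op_size x) \<and>
     (\<forall>k\<le>length xs. pop_total (take k xs) \<le> push_total (take k xs)) \<and>
     push_total xs = pop_total xs"

abbreviation seq_size :: "op list \<Rightarrow> nat" where
  "seq_size xs \<equiv> push_total xs"

text \<open>Configuration: (input stack, working stack, output stack), each as a list
  with the top element first.\<close>
fun exec_op :: "op \<Rightarrow> nat list \<times> nat list \<times> nat list \<Rightarrow> nat list \<times> nat list \<times> nat list" where
  "exec_op (Push a) (inp, wk, out) = (drop a inp, take a inp @ wk, out)"
| "exec_op (Pop b) (inp, wk, out) = (inp, drop b wk, take b wk @ out)"

text \<open>Permutation produced: the final output stack read top to bottom, starting
  from input stack 1..n with 1 on top.\<close>
definition produced_perm :: "op list \<Rightarrow> nat list" where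
  "produced_perm xs = (case fold exec_op xs ([1..<seq_size xs + 1], [], []) of (_, _, out) \<Rightarrow> out)"

definition equivalent :: "op list \<Rightarrow> op list \<Rightarrow> bool" where
  "equivalent xs ys \<longleftrightarrow> seq_size xs = seq_size ys \<and> produced_perm xs = produced_perm ys"

definition reduced :: "op list \<Rightarrow> bool" where
  "reduced xs \<longleftrightarrow>
     (\<forall>i. Suc i < length xs \<longrightarrow> is_push (xs ! i) \<longrightarrow> is_pop (xs ! Suc i) \<longrightarrow>
          xs ! i = Push 1 \<and> xs ! Suc i = Pop 1)"

definition op_alphabet :: "nat \<Rightarrow> nat \<Rightarrow> op set" where
  "op_alphabet s t = {Push a | a. 1 \<le> a \<and> a \<le> s} \<union> {Pop b | b. 1 \<le> b \<and> b \<le> t}"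

text \<open>States and stack symbols are encoded as natural numbers drawn from
  finite sets; delta q None Z is an epsilon move.\<close>
record 'a dpda =
  states :: "nat set"
  stack_syms :: "nat set"
  init_state :: nat
  init_stack :: nat
  final_states :: "nat set"
  delta :: "nat \<Rightarrow> 'a option \<Rightarrow> nat \<Rightarrow> (nat \<times> nat list) option"

definition is_dpda :: "'a set \<Rightarrow> 'a dpda \<Rightarrow> bool" where
  "is_dpda A M \<longleftrightarrow>
     finite A \<and> finite (states M) \<and> finite (stack_syms M) \<and>
     init_state M \<in> states M \<and> init_stack M \<in> stack_syms M \<and>
     final_states M \<subseteq> states M \<and>
     (\<forall>q x Z p \<gamma>. delta M q x Z = Some (p, \<gamma>) \<longrightarrow>
        q \<in> states M \<and> Z \<in> stack_syms M \<and> p \<in> states M \<and> set \<gamma> \<subseteq> stack_syms M \<and>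
        (\<forall>a. x = Some a \<longrightarrow> a \<in> A)) \<and>
     (\<forall>q Z. delta M q None Z \<noteq> None \<longrightarrow> (\<forall>a. delta M q (Some a) Z = None))"

inductive dpda_step :: "'a dpda \<Rightarrow> nat \<times> 'a list \<times> nat list \<Rightarrow> nat \<times> 'a list \<times> nat list \<Rightarrow> bool"
  for M where
  read: "delta M q (Some a) Z = Some (p, \<beta>) \<Longrightarrow> dpda_step M (q, a # w, Z # \<gamma>) (p, w, \<beta> @ \<gamma>)"
| eps: "delta M q None Z = Some (p, \<beta>) \<Longrightarrow> dpda_step M (q, w, Z # \<gamma>) (p, w, \<beta> @ \<gamma>)"

definition dpda_lang :: "'a dpda \<Rightarrow> 'a list set" where
  "dpda_lang M = {w. \<exists>q \<gamma>. (dpda_step M)\<^sup>*\<^sup>* (init_state M, w, [init_stack M]) (q, [], \<gamma>)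
                          \<and> q \<in> final_states M}"

end

theory Submission
  imports Defs "HOL-Library.Countable"
begin

text \<open>
  Blocks pushed or popped together reverse intervals of the working stack, so a word consists of a
  shape (the Dyck path of its unit steps) decorated by two compositions, one of the pushes and one of
  the pops.  For reduced words the shape can be read off the permutation, because its left-to-right
  maxima are the peaks.  Hence two equivalent reduced words differ only in their decorations, and they
  can differ only on chains of nodes that are pushed in one run and popped in one run.  On such a chain
  the permutation is a product of two layered involutions, and two different factorisations of the same
  product into layered involutions without a shared cut force the chain to be short: its length is at
  most \<open>2 * max s t\<close>.

  A word is therefore the canonical representative of its class iff it contains no factor
  \<open>map Push A @ v @ map Pop B\<close> with \<open>v\<close> nonempty and well formed and with \<open>(A, B)\<close> in a certain
  finite set, namely the pairs that can be replaced by a pair with a smaller first push.  A pushdown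
  automaton detects these factors by storing with each stacked element the last few pushes made up to
  the moment it was pushed.
\<close>

text \<open>The bound comes from comparing initial blocks. On such a chain let \<open>A\<close>,
  \<open>A'\<close> be the push involutions of the two words and \<open>B\<close>, \<open>B'\<close>
  their pop involutions, read against the order of popping; equal permutations mean
  \<open>A' (A j) = B' (B j)\<close>. If this product moves 0, some involution has its first or
  second block ending where its partner in the same word has a cut too. At most two blocks are
  passed, which is the origin of \<open>2 * max s t\<close>. Transferring that cut to the other word
  needs a condition: within the chain, no interval of length at least 2 is a block of both the
  pushes and the pops of one word. Such an interval passes through the stack in its original order,
  and cutting it into units is itself one of the listed replacements, so irreducible words have
  none. Existence of a representative is extremal twice over: resolving a wrong peak lengthens the
  word, and a replacement lowers it lexicographically when only push sizes are compared. Both stay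
  in the finite set of words of the given size over the alphabet.\<close>

section \<open>Push and pop sizes of a word, and the height of the working stack\<close>

fun pushes :: "op list \<Rightarrow> nat list" where
  "pushes [] = []"
| "pushes (Push a # w) = a # pushes w"
| "pushes (Pop b # w) = pushes w"

fun pops :: "op list \<Rightarrow> nat list" where
  "pops [] = []"
| "pops (Push a # w) = pops w"
| "pops (Pop b # w) = b # pops w"

lemma pushes_append [simp]: "pushes (x @ y) = pushes x @ pushes y"
  by (induction x rule: pushes.induct) auto

lemma pops_append [simp]: "pops (x @ y) = pops x @ pops y"
  by (induction x rule: pops.induct) auto

lemma pushes_map_Push [simp]: "pushes (map Push A) = A"
  by (induction A) auto

lemma pushes_map_Pop [simp]: "pushes (map Pop A) = []"
  by (induction A) auto

lemma pops_map_Push [simp]: "pops (map Push A) = []"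
  by (induction A) auto

lemma pops_map_Pop [simp]: "pops (map Pop A) = A"
  by (induction A) auto

lemma push_total_eq: "push_total w = sum_list (pushes w)"
  unfolding push_total_def by (induction w rule: pushes.induct) auto

lemma pop_total_eq: "pop_total w = sum_list (pops w)"
  unfolding pop_total_def by (induction w rule: pops.induct) auto

text \<open>Height of the working stack, \<open>None\<close> on underflow or an operation of size 0.\<close>
fun ht :: "nat \<Rightarrow> op list \<Rightarrow> nat option" where
  "ht l [] = Some l"
| "ht l (Push a # w) = (if 1 \<le> a then ht (l + a) w else None)"
| "ht l (Pop b # w) = (if 1 \<le> b \<and> b \<le> l then ht (l - b) w else None)"

lemma ht_append: "ht l (x @ y) = Option.bind (ht l x) (\<lambda>l'. ht l' y)"
  by (induction l x rule: ht.induct) auto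

lemma ht_append_Some:
  "ht l (x @ y) = Some l' \<longleftrightarrow> (\<exists>m. ht l x = Some m \<and> ht m y = Some l')"
  by (auto simp: ht_append Option.bind_eq_Some_conv)

lemma ht_shift: "ht l w = Some l' \<Longrightarrow> ht (l + m) w = Some (l' + m)"
  by (induction l w rule: ht.induct) (auto split: if_splits simp: algebra_simps)

lemma ht_total: "ht l w = Some l' \<Longrightarrow> l' + sum_list (pops w) = l + sum_list (pushes w)"
  by (induction l w rule: ht.induct) (auto split: if_splits)

lemma ht_ops_pos: "ht l w = Some l' \<Longrightarrow> x \<in> set w \<Longrightarrow> 1 \<le> op_size x"
  by (induction l w rule: ht.induct) (auto split: if_splits)

lemma ht_map_Push:
  "\<forall>a\<in>set A. 1 \<le> a \<Longrightarrow> ht l (map Push A) = Some (l + sum_list A)"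
  by (induction A arbitrary: l) (auto simp: algebra_simps)

lemma ht_map_Pop:
  "\<forall>a\<in>set A. 1 \<le> a \<Longrightarrow> sum_list A \<le> l \<Longrightarrow> ht l (map Pop A) = Some (l - sum_list A)"
  by (induction A arbitrary: l) (auto simp: algebra_simps)

text \<open>Bridge from the recursive height to the prefix inequalities of
  \<open>well_formed\<close>; the starting height is arbitrary because the induction changes
  it.\<close>

lemma ht_Some_iff:
  "ht l w \<noteq> None \<longleftrightarrow> (\<forall>x\<in>set w. 1 \<le> op_size x) \<and>
     (\<forall>k\<le>length w. sum_list (pops (take k w)) \<le> l + sum_list (pushes (take k w)))"
proof (induction l w rule: ht.induct)
  case (1 l)
  then show ?case by auto
next
  case (2 l a w)
  have "(\<forall>k\<le>length (Push a # w). sum_list (pops (take k (Push a # w))) \<le> l + sum_list (pushes (take k (Push a # w))))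
    \<longleftrightarrow> (\<forall>k\<le>length w. sum_list (pops (take k w)) \<le> l + a + sum_list (pushes (take k w)))" (is "?L \<longleftrightarrow> ?R")
  proof
    assume L: ?L
    show ?R
    proof (intro allI impI)
      fix k assume "k \<le> length w"
      then show "sum_list (pops (take k w)) \<le> l + a + sum_list (pushes (take k w))"
        using L[rule_format, of "Suc k"] by (simp add: algebra_simps)
    qed
  next
    assume R: ?R
    show ?L
    proof (intro allI impI)
      fix k assume "k \<le> length (Push a # w)"
      then show "sum_list (pops (take k (Push a # w))) \<le> l + sum_list (pushes (take k (Push a # w)))"
        using R by (cases k) (auto simp: algebra_simps)
    qed
  qed
  then show ?case using 2 by auto
next
  case (3 l b w)
  have "(\<forall>k\<le>length (Pop b # w). sum_list (pops (take k (Pop b # w))) \<le> l + sum_list (pushes (take k (Pop b # w))))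
    \<longleftrightarrow> b \<le> l \<and> (\<forall>k\<le>length w. sum_list (pops (take k w)) \<le> l - b + sum_list (pushes (take k w)))" (is "?L \<longleftrightarrow> ?R")
  proof
    assume L: ?L
    have b: "b \<le> l" using L[rule_format, of 1] by simp
    show ?R
    proof (intro conjI allI impI)
      fix k assume "k \<le> length w"
      then show "sum_list (pops (take k w)) \<le> l - b + sum_list (pushes (take k w))"
        using L[rule_format, of "Suc k"] b by (simp add: algebra_simps)
    qed (rule b)
  next
    assume R: ?R
    show ?L
    proof (intro allI impI)
      fix k assume k: "k \<le> length (Pop b # w)"
      show "sum_list (pops (take k (Pop b # w))) \<le> l + sum_list (pushes (take k (Pop b # w)))"
      proof (cases k)
        case (Suc k')
        then have "sum_list (pops (take k' w)) \<le> l - b + sum_list (pushes (take k' w))"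
          using R k by auto
        then show ?thesis using Suc R by auto
      qed auto
    qed
  qed
  then show ?case using 3 by auto
qed

lemma well_formed_ht: "well_formed w \<longleftrightarrow> ht 0 w = Some 0"
proof -
  have "well_formed w \<longleftrightarrow> ht 0 w \<noteq> None \<and> sum_list (pushes w) = sum_list (pops w)"
    unfolding well_formed_def push_total_eq pop_total_eq ht_Some_iff by auto
  also have "\<dots> \<longleftrightarrow> ht 0 w = Some 0"
    using ht_total[of 0 w] by (cases "ht 0 w") auto
  finally show ?thesis .
qed

lemma well_formed_first: "well_formed v \<Longrightarrow> v \<noteq> [] \<Longrightarrow> \<exists>a v'. v = Push a # v'"
  unfolding well_formed_ht by (cases v rule: pushes.cases) (auto split: if_splits)

lemma well_formed_last: "well_formed v \<Longrightarrow> v \<noteq> [] \<Longrightarrow> \<exists>b v'. v = v' @ [Pop b]"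
  unfolding well_formed_ht
proof (cases v rule: rev_cases)
  case (snoc v' x)
  assume "ht 0 v = Some 0"
  then show ?thesis using snoc by (cases x) (auto simp: ht_append_Some split: if_splits)
qed auto

section \<open>Block reversal\<close>

text \<open>\<open>blk A xs\<close> is the effect of moving the stack \<open>xs\<close>, top first, in blocks of the sizes \<open>A\<close>,
  be it from input to working stack or from working stack to output.\<close>
fun blk :: "nat list \<Rightarrow> 'a list \<Rightarrow> 'a list" where
  "blk [] xs = []"
| "blk (a # A) xs = blk A (drop a xs) @ take a xs"

text \<open>The layered involution of the composition \<open>A\<close>: consecutive intervals of the
  given lengths are reversed in place. Past \<open>sum_list A\<close> it is the identity, so it acts
  on all natural numbers.\<close>

fun lay :: "nat list \<Rightarrow> nat \<Rightarrow> nat" where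
  "lay [] i = i"
| "lay (a # A) i = (if i < a then a - 1 - i else a + lay A (i - a))"

lemma blk_map: "blk A (map f xs) = map f (blk A xs)"
  by (induction A arbitrary: xs) (auto simp: drop_map take_map)

lemma length_blk: "length xs = sum_list A \<Longrightarrow> length (blk A xs) = sum_list A"
  by (induction A arbitrary: xs) auto

lemma blk_ones: "length xs = k \<Longrightarrow> blk (replicate k 1) xs = rev xs"
proof (induction k arbitrary: xs)
  case (Suc k)
  then obtain y ys where "xs = y # ys" by (cases xs) auto
  then show ?case using Suc by simp
qed auto

lemma lay_less: "i < sum_list A \<Longrightarrow> lay A i < sum_list A"
  by (induction A arbitrary: i) auto

text \<open>The block moved first ends at the bottom of the target, hence the \<open>rev\<close>:
  counted from the bottom, the blocks keep their order and each is reversed.\<close>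

lemma nth_rev_blk:
  "length xs = sum_list A \<Longrightarrow> i < sum_list A \<Longrightarrow> rev (blk A xs) ! i = xs ! lay A i"
proof (induction A arbitrary: xs i)
  case (Cons a A)
  then have l: "length (drop a xs) = sum_list A" "a \<le> length xs" by auto
  show ?case
  proof (cases "i < a")
    case True
    then show ?thesis using l by (simp add: nth_append rev_nth)
  next
    case False
    then have "rev (blk A (drop a xs)) ! (i - a) = drop a xs ! lay A (i - a)"
      using Cons l by auto
    then show ?thesis using False l Cons.prems lay_less[of "i - a" A] by (simp add: nth_append)
  qed
qed auto

lemma lay_append:
  "lay (A @ B) i = (if i < sum_list A then lay A i else sum_list A + lay B (i - sum_list A))"
  by (induction A arbitrary: i) auto

text \<open>The value at 0 is the first part minus 1, so the parts can be read off one after the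
  other; parts of size 0 would leave no trace.\<close>

lemma lay_inject:
  "\<forall>a\<in>set A. 1 \<le> a \<Longrightarrow> \<forall>a\<in>set B. 1 \<le> a \<Longrightarrow> sum_list A = sum_list B \<Longrightarrow>
   \<forall>i<sum_list A. lay A i = lay B i \<Longrightarrow> A = B"
proof (induction A arbitrary: B)
  case Nil
  then show ?case by (cases B) auto
next
  case (Cons a A)
  then obtain b B' where B: "B = b # B'" by (cases B) auto
  have ab: "a = b" using Cons.prems B by (auto dest: spec[of _ 0])
  have "lay A i = lay B' i" if "i < sum_list A" for i
    using Cons.prems(4)[rule_format, of "a + i"] that B ab by auto
  then show ?case using Cons B ab by auto
qed

section \<open>Execution\<close>

lemma exec_map_Push:
  "sum_list A \<le> length inp \<Longrightarrow>
   fold exec_op (map Push A) (inp, wk, out) = (drop (sum_list A) inp, blk A (take (sum_list A) inp) @ wk, out)"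
proof (induction A arbitrary: inp wk)
  case (Cons a A)
  then show ?case
    by (simp add: add.commute take_drop[symmetric] drop_take min_def)
qed auto

lemma exec_map_Pop:
  "sum_list B \<le> length wk \<Longrightarrow>
   fold exec_op (map Pop B) (inp, wk, out) = (inp, drop (sum_list B) wk, blk B (take (sum_list B) wk) @ out)"
proof (induction B arbitrary: wk out)
  case (Cons a A)
  then show ?case
    by (simp add: add.commute take_drop[symmetric] drop_take min_def)
qed auto

lemma exec_input: "\<exists>wk' out'. fold exec_op w (inp, wk, out) = (drop (push_total w) inp, wk', out')"
proof (induction w arbitrary: inp wk out rule: pushes.induct)
  case (2 a w)
  from 2[of "drop a inp" "take a inp @ wk" out] show ?case by (simp add: push_total_eq add.commute)
qed (auto simp: push_total_eq)

text \<open>A word that never reaches below the top \<open>l\<close> elements behaves the same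
  whatever lies below them and whatever is already in the output.\<close>

lemma exec_above:
  "ht l v = Some l' \<Longrightarrow> push_total v \<le> length inp \<Longrightarrow> length xs = l \<Longrightarrow>
   \<exists>inp' xs' ys. length xs' = l' \<and> (\<forall>wk out. fold exec_op v (inp, xs @ wk, out) = (inp', xs' @ wk, ys @ out))"
proof (induction l v arbitrary: inp xs rule: ht.induct)
  case (2 l a w)
  from 2 have "1 \<le> a" "ht (l + a) w = Some l'" by (auto split: if_splits)
  moreover have "push_total w \<le> length (drop a inp)" "length (take a inp @ xs) = l + a"
    using 2(3,4) by (auto simp: push_total_eq)
  ultimately obtain inp' xs' ys where "length xs' = l'"
    "\<forall>wk out. fold exec_op w (drop a inp, (take a inp @ xs) @ wk, out) = (inp', xs' @ wk, ys @ out)"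
    using 2(1)[of "drop a inp" "take a inp @ xs"] by blast
  then show ?case by auto
next
  case (3 l b w)
  from 3 have b: "1 \<le> b" "b \<le> l" "ht (l - b) w = Some l'" by (auto split: if_splits)
  moreover have "push_total w \<le> length inp" "length (drop b xs) = l - b"
    using 3(3,4) by (auto simp: push_total_eq)
  ultimately obtain inp' xs' ys where "length xs' = l'"
    "\<forall>wk out. fold exec_op w (inp, drop b xs @ wk, out) = (inp', xs' @ wk, ys @ out)"
    using 3(1)[of inp "drop b xs"] by blast
  then show ?case using b 3(4) by (intro exI[of _ inp'] exI[of _ xs'] exI[of _ "ys @ take b xs"]) auto
qed auto

definition same_effect :: "op list \<Rightarrow> op list \<Rightarrow> bool" where
  "same_effect x y \<longleftrightarrow> push_total x = push_total y \<and>
     (\<forall>inp wk out. push_total x \<le> length inp \<longrightarrow> pop_total x \<le> push_total x + length wk \<longrightarrow>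
        fold exec_op x (inp, wk, out) = fold exec_op y (inp, wk, out))"

lemma exec_lengths:
  "ht l w = Some l' \<Longrightarrow> length wk = l \<Longrightarrow> push_total w \<le> length inp \<Longrightarrow>
   \<exists>wk' out'. fold exec_op w (inp, wk, out) = (drop (push_total w) inp, wk', out') \<and> length wk' = l'"
proof -
  assume "ht l w = Some l'" "length wk = l" "push_total w \<le> length inp"
  then obtain inp' xs' ys where "length xs' = l'"
    "fold exec_op w (inp, wk @ [], out) = (inp', xs' @ [], ys @ out)"
    using exec_above[of l w l' inp wk] by blast
  then show ?thesis using exec_input[of w inp wk out] by auto
qed

text \<open>The prefix \<open>u\<close> leaves enough on the input and working stacks to meet the
  guards of \<open>same_effect\<close>, so \<open>z\<close> starts from the same configuration in
  both runs.\<close>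

lemma equivalent_context:
  assumes wf: "well_formed (u @ x @ z)" and eq: "same_effect x y"
  shows "equivalent (u @ x @ z) (u @ y @ z)"
proof -
  have n: "push_total (u @ y @ z) = push_total (u @ x @ z)"
    using eq by (simp add: same_effect_def push_total_eq)
  let ?n = "push_total (u @ x @ z)"
  let ?inp = "[1..<?n + 1]"
  obtain l where l: "ht 0 u = Some l" and "ht l (x @ z) = Some 0"
    using wf unfolding well_formed_ht ht_append_Some by blast
  then obtain l2 where l2: "ht l x = Some l2"
    unfolding ht_append_Some by blast
  obtain wk' out' where u: "fold exec_op u (?inp, [], []) = (drop (push_total u) ?inp, wk', out')"
    and lw: "length wk' = l"
    using exec_lengths[OF l, of "[]" ?inp "[]"] by (auto simp del: upt_Suc simp: push_total_eq)
  have "pop_total x \<le> push_total x + length wk'"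
    using ht_total[OF l2] lw by (simp add: push_total_eq pop_total_eq)
  moreover have "push_total x \<le> length (drop (push_total u) ?inp)"
    by (simp add: push_total_eq del: upt_Suc)
  ultimately have "fold exec_op x (drop (push_total u) ?inp, wk', out') = fold exec_op y (drop (push_total u) ?inp, wk', out')"
    using eq unfolding same_effect_def by blast
  then show ?thesis
    unfolding equivalent_def produced_perm_def n using u by (simp del: upt_Suc)
qed

section \<open>Existence of reduced representatives\<close>

text \<open>A peak of the wrong shape can be traded for a longer word.\<close>
definition unpeak :: "nat \<Rightarrow> nat \<Rightarrow> op list" where
  "unpeak a b = (let c = min a b in
     (if a < b then [Pop (b - a)] else []) @ map Push (replicate c 1) @ map Pop (replicate c 1) @
     (if b < a then [Push (a - b)] else []))"

text \<open>Unit pushes and then unit pops reverse the block twice, so it arrives in its original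
  order.\<close>

lemma exec_ones:
  "c \<le> length inp \<Longrightarrow>
   fold exec_op (map Push (replicate c 1) @ map Pop (replicate c 1)) (inp, wk, out) = (drop c inp, wk, take c inp @ out)"
proof -
  assume c: "c \<le> length inp"
  have 1: "fold exec_op (map Push (replicate c 1)) (inp, wk, out) = (drop c inp, rev (take c inp) @ wk, out)"
    using exec_map_Push[of "replicate c 1" inp wk out] c blk_ones[of "take c inp" c]
    by (simp add: sum_list_replicate)
  have 2: "fold exec_op (map Pop (replicate c 1)) (drop c inp, rev (take c inp) @ wk, out) = (drop c inp, wk, take c inp @ out)"
    using exec_map_Pop[of "replicate c 1" "rev (take c inp) @ wk" "drop c inp" out] c
      blk_ones[of "rev (take c inp)" c]
    by (simp add: sum_list_replicate)
  show ?thesis using 1 2 by (simp del: map_replicate)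
qed

text \<open>A block pushed and popped at once keeps its order. If the pop is larger, its surplus
  comes from the old stack and has to be output first; if the push is larger, its surplus stays
  behind and can be pushed last.\<close>

lemma same_effect_unpeak:
  "same_effect [Push a, Pop b] (unpeak a b)"
proof -
  have P: "push_total (unpeak a b) = a"
    unfolding unpeak_def by (auto simp: push_total_eq Let_def sum_list_replicate simp del: map_replicate)
  have "fold exec_op [Push a, Pop b] (inp, wk, out) = fold exec_op (unpeak a b) (inp, wk, out)"
    if "a \<le> length inp" for inp wk out
  proof (cases "a < b")
    case True
    then have "fold exec_op (unpeak a b) (inp, wk, out) = (drop a inp, drop (b - a) wk, take a inp @ take (b - a) wk @ out)"
      using exec_ones[of a inp "drop (b - a) wk" "take (b - a) wk @ out"] that
      unfolding unpeak_def Let_def by (simp add: min_def del: map_replicate)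
    then show ?thesis using True that by simp
  next
    case False
    then have "fold exec_op (unpeak a b) (inp, wk, out) =
        fold exec_op (if b < a then [Push (a - b)] else []) (drop b inp, wk, take b inp @ out)"
      using exec_ones[of b inp "wk" "out"] that
      unfolding unpeak_def Let_def by (cases "a = b") (simp_all add: min_def del: map_replicate)
    also have "\<dots> = (drop a inp, drop b (take a inp) @ wk, take b inp @ out)"
      using False that by (auto simp: drop_take)
    finally show ?thesis using False that by (simp add: min_def)
  qed
  then show ?thesis unfolding same_effect_def P by (simp add: push_total_eq)
qed

lemma ht_unpeak: "1 \<le> a \<Longrightarrow> 1 \<le> b \<Longrightarrow> b \<le> l + a \<Longrightarrow> ht l (unpeak a b) = Some (l + a - b)"
  using ht_map_Push[of "replicate (min a b) 1" "l - (b - a)"]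
    ht_map_Pop[of "replicate (min a b) 1" "l - (b - a) + min a b"]
  unfolding unpeak_def Let_def
  by (auto simp: ht_append sum_list_replicate min_def simp del: map_replicate split: if_splits)

lemma length_unpeak: "1 \<le> a \<Longrightarrow> 1 \<le> b \<Longrightarrow> \<not> (a = 1 \<and> b = 1) \<Longrightarrow> 2 < length (unpeak a b)"
  unfolding unpeak_def Let_def by (auto simp: min_def)

lemma set_unpeak:
  "1 \<le> a \<Longrightarrow> a \<le> s \<Longrightarrow> 1 \<le> b \<Longrightarrow> b \<le> t \<Longrightarrow> set (unpeak a b) \<subseteq> op_alphabet s t"
  unfolding unpeak_def op_alphabet_def Let_def by (auto simp: min_def)

lemma ht_length: "ht l w = Some l' \<Longrightarrow> length w \<le> sum_list (pushes w) + sum_list (pops w)"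
  by (induction l w rule: ht.induct) (auto split: if_splits)

text \<open>Every operation moves at least one element and every element moves twice, hence the
  length bound \<open>2 * n\<close>.\<close>

lemma finite_class:
  "finite {w. well_formed w \<and> set w \<subseteq> op_alphabet s t \<and> push_total w = n}" (is "finite ?S")
proof (rule finite_subset)
  have "{Push a |a. 1 \<le> a \<and> a \<le> s} = Push ` {1..s}" "{Pop a |a. 1 \<le> a \<and> a \<le> t} = Pop ` {1..t}"
    by auto
  then have "finite (op_alphabet s t)" unfolding op_alphabet_def by auto
  then show "finite {w. set w \<subseteq> op_alphabet s t \<and> length w \<le> 2 * n}"
    by (rule finite_lists_length_le)
  show "?S \<subseteq> {w. set w \<subseteq> op_alphabet s t \<and> length w \<le> 2 * n}"
  proof
    fix w assume "w \<in> ?S"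
    then have "ht 0 w = Some 0" "set w \<subseteq> op_alphabet s t" "sum_list (pushes w) = n"
      by (auto simp: well_formed_ht push_total_eq)
    then show "w \<in> {w. set w \<subseteq> op_alphabet s t \<and> length w \<le> 2 * n}"
      using ht_length[of 0 w 0] ht_total[of 0 w 0] by auto
  qed
qed

lemma reduced_split:
  "reduced w \<longleftrightarrow> (\<forall>u a b z. w = u @ Push a # Pop b # z \<longrightarrow> a = 1 \<and> b = 1)"
proof
  assume r: "reduced w"
  show "\<forall>u a b z. w = u @ Push a # Pop b # z \<longrightarrow> a = 1 \<and> b = 1"
  proof (intro allI impI)
    fix u a b z assume "w = u @ Push a # Pop b # z"
    then have "w ! length u = Push a" "w ! Suc (length u) = Pop b" "Suc (length u) < length w"
      by (auto simp: nth_append)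
    then show "a = 1 \<and> b = 1" using r[unfolded reduced_def, rule_format, of "length u"] by auto
  qed
next
  assume r: "\<forall>u a b z. w = u @ Push a # Pop b # z \<longrightarrow> a = 1 \<and> b = 1"
  show "reduced w"
    unfolding reduced_def
  proof (intro allI impI)
    fix i assume i: "Suc i < length w" "is_push (w ! i)" "is_pop (w ! Suc i)"
    then obtain a b where ab: "w ! i = Push a" "w ! Suc i = Pop b"
      by (cases "w ! i"; cases "w ! Suc i") auto
    have "w = take i w @ w ! i # w ! Suc i # drop (Suc (Suc i)) w"
      using i(1) by (metis Cons_nth_drop_Suc Suc_lessD append_take_drop_id)
    then show "w ! i = Push 1 \<and> w ! Suc i = Pop 1" using r ab by metis
  qed
qed

text \<open>A longest word of the class is reduced: \<open>unpeak\<close> keeps alphabet and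
  permutation and lengthens every word with a wrong peak.\<close>

lemma exists_reduced:
  assumes "well_formed \<alpha>" "set \<alpha> \<subseteq> op_alphabet s t"
  shows "\<exists>\<beta>. well_formed \<beta> \<and> set \<beta> \<subseteq> op_alphabet s t \<and> reduced \<beta> \<and> equivalent \<beta> \<alpha>"
proof -
  let ?S = "{w. well_formed w \<and> set w \<subseteq> op_alphabet s t \<and> equivalent w \<alpha>}"
  have fin: "finite ?S"
    by (rule finite_subset[OF _ finite_class[of s t "push_total \<alpha>"]]) (auto simp: equivalent_def)
  have ne: "\<alpha> \<in> ?S" using assms by (auto simp: equivalent_def)
  obtain \<beta> where b: "\<beta> \<in> ?S" "\<And>w. w \<in> ?S \<Longrightarrow> length w \<le> length \<beta>"
  proof -
    have "Max (length ` ?S) \<in> length ` ?S" using fin ne by (intro Max_in) auto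
    then obtain \<beta> where "\<beta> \<in> ?S" "length \<beta> = Max (length ` ?S)" by auto
    moreover have "length w \<le> Max (length ` ?S)" if "w \<in> ?S" for w
      using fin that by (intro Max_ge) auto
    ultimately show thesis using that by auto
  qed
  have "reduced \<beta>"
    unfolding reduced_split
  proof (intro allI impI, rule ccontr)
    fix u a c z assume w: "\<beta> = u @ Push a # Pop c # z" and ac: "\<not> (a = 1 \<and> c = 1)"
    let ?w = "u @ unpeak a c @ z"
    have ht: "ht 0 (u @ [Push a, Pop c] @ z) = Some 0" using b(1) w by (simp add: well_formed_ht)
    then obtain l where l: "ht 0 u = Some l" "1 \<le> a" "1 \<le> c" "c \<le> l + a" "ht (l + a - c) z = Some 0"
      unfolding ht_append_Some by (auto split: if_splits)
    have wf: "well_formed ?w"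
      unfolding well_formed_ht ht_append_Some using l ht_unpeak[of a c l] by auto
    have al: "set (u @ unpeak a c @ z) \<subseteq> op_alphabet s t"
      using b(1) w set_unpeak[of a s c t] by (auto simp: op_alphabet_def)
    have "equivalent \<beta> ?w"
      using equivalent_context[OF _ same_effect_unpeak, of u a c z] ht w by (simp add: well_formed_ht)
    then have "?w \<in> ?S" using wf al b(1) by (auto simp: equivalent_def)
    from b(2)[OF this] show False using w length_unpeak[OF l(2,3) ac] by simp
  qed
  then show ?thesis using b(1) by auto
qed

section \<open>Forbidden nested factors and irreducible representatives\<close>

text \<open>The bound on \<open>sum_list A\<close> leaves finitely many pairs, on which the
  automaton depends. The smaller first part makes every replacement a lexicographic descent.\<close>

definition bad :: "nat \<Rightarrow> nat \<Rightarrow> nat list \<Rightarrow> nat list \<Rightarrow> bool" where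
  "bad s t A B \<longleftrightarrow> A \<noteq> [] \<and> (\<forall>a\<in>set A. 1 \<le> a) \<and> (\<forall>b\<in>set B. 1 \<le> b) \<and>
     sum_list B = sum_list A \<and> sum_list A \<le> 2 * max s t \<and>
     (\<exists>A' B'. A' \<noteq> [] \<and> set A' \<subseteq> {1..s} \<and> set B' \<subseteq> {1..t} \<and> hd A' < hd A \<and>
        sum_list A' = sum_list A \<and> sum_list B' = sum_list A \<and>
        blk B (blk A [0..<sum_list A]) = blk B' (blk A' [0..<sum_list A]))"

text \<open>A nonempty \<open>v\<close> keeps the pushes \<open>A\<close> and the pops
  \<open>B\<close> from meeting in a peak, so replacing them leaves all peaks alone.\<close>

definition irreducible_word :: "nat \<Rightarrow> nat \<Rightarrow> op list \<Rightarrow> bool" where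
  "irreducible_word s t w \<longleftrightarrow>
     \<not> (\<exists>u A v B z. w = u @ map Push A @ v @ map Pop B @ z \<and> v \<noteq> [] \<and> well_formed v \<and> bad s t A B)"

text \<open>As \<open>v\<close> returns to its initial height, the \<open>k\<close> elements rest
  untouched between the two runs, and the runs act on them by a permutation of positions that does
  not depend on the elements.\<close>

lemma exec_nested:
  assumes v: "well_formed v" and k: "sum_list A = k" "sum_list B = k"
    and i: "k + push_total v \<le> length inp"
  shows "fold exec_op (map Push A @ v @ map Pop B) (inp, wk, out) =
    (case fold exec_op v (drop k inp, [], []) of (inp', _, ys) \<Rightarrow>
      (inp', wk, map (nth inp) (blk B (blk A [0..<k])) @ ys @ out))"
proof -
  obtain inp' ys where ex: "\<forall>wk out. fold exec_op v (drop k inp, wk, out) = (inp', wk, ys @ out)"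
  proof -
    have "ht 0 v = Some 0" "push_total v \<le> length (drop k inp)" using v i by (auto simp: well_formed_ht)
    then show thesis using exec_above[of 0 v 0 "drop k inp" "[]"] that by auto
  qed
  have tk: "take k inp = map (nth inp) [0..<k]"
    using i by (auto intro: nth_equalityI)
  have lb: "length (blk A (take k inp)) = k"
    using length_blk[of "take k inp" A] i k by simp
  have "blk B (blk A (take k inp)) = map (nth inp) (blk B (blk A [0..<k]))"
    unfolding tk blk_map ..
  then show ?thesis
    using exec_map_Push[of A inp wk out] exec_map_Pop[of B "blk A (take k inp) @ wk" inp' "ys @ out"] k i ex lb
    by simp
qed

lemma same_effect_nested:
  assumes v: "well_formed v" and k: "sum_list A = k" "sum_list B = k" "sum_list A' = k" "sum_list B' = k"
    and eq: "blk B (blk A [0..<k]) = blk B' (blk A' [0..<k])"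
  shows "same_effect (map Push A @ v @ map Pop B) (map Push A' @ v @ map Pop B')"
  unfolding same_effect_def
proof (intro conjI allI impI)
  fix inp wk out :: "nat list"
  assume "push_total (map Push A @ v @ map Pop B) \<le> length inp"
  then have i: "k + push_total v \<le> length inp" using k by (simp add: push_total_eq)
  show "fold exec_op (map Push A @ v @ map Pop B) (inp, wk, out) =
        fold exec_op (map Push A' @ v @ map Pop B') (inp, wk, out)"
    unfolding exec_nested[OF v k(1,2) i] exec_nested[OF v k(3,4) i] eq ..
qed (simp add: push_total_eq k)

lemma append_eq_snoc_Cons_cases:
  assumes "x @ y = u @ p # q # z"
  shows "(\<exists>z'. x = u @ p # q # z' \<and> z = z' @ y) \<or> (x = u @ [p] \<and> y = q # z) \<or>
     (\<exists>u'. y = u' @ p # q # z \<and> u = x @ u')"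
proof -
  consider us where "x = u @ us" "us @ y = p # q # z" | us where "u = x @ us" "y = us @ p # q # z"
    using assms unfolding append_eq_append_conv2 by metis
  then show ?thesis
  proof cases
    case 1
    then show ?thesis by (cases us; cases "tl us") auto
  qed auto
qed

lemma reduced_append:
  "reduced (x @ y) \<longleftrightarrow> reduced x \<and> reduced y \<and>
     (\<forall>x' a b y'. x = x' @ [Push a] \<longrightarrow> y = Pop b # y' \<longrightarrow> a = 1 \<and> b = 1)"
proof
  assume r: "reduced (x @ y)"
  have "reduced x"
    unfolding reduced_split
  proof (intro allI impI)
    fix u a b z assume "x = u @ Push a # Pop b # z"
    then have "x @ y = u @ Push a # Pop b # (z @ y)" by simp
    then show "a = 1 \<and> b = 1" using r unfolding reduced_split by blast
  qed
  moreover have "reduced y"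
    unfolding reduced_split
  proof (intro allI impI)
    fix u a b z assume "y = u @ Push a # Pop b # z"
    then have "x @ y = (x @ u) @ Push a # Pop b # z" by simp
    then show "a = 1 \<and> b = 1" using r unfolding reduced_split by blast
  qed
  moreover have "\<forall>x' a b y'. x = x' @ [Push a] \<longrightarrow> y = Pop b # y' \<longrightarrow> a = 1 \<and> b = 1"
  proof (intro allI impI)
    fix x' a b y' assume "x = x' @ [Push a]" "y = Pop b # y'"
    then have "x @ y = x' @ Push a # Pop b # y'" by simp
    then show "a = 1 \<and> b = 1" using r unfolding reduced_split by blast
  qed
  ultimately show "reduced x \<and> reduced y \<and>
     (\<forall>x' a b y'. x = x' @ [Push a] \<longrightarrow> y = Pop b # y' \<longrightarrow> a = 1 \<and> b = 1)" by blast
next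
  assume r: "reduced x \<and> reduced y \<and>
     (\<forall>x' a b y'. x = x' @ [Push a] \<longrightarrow> y = Pop b # y' \<longrightarrow> a = 1 \<and> b = 1)"
  show "reduced (x @ y)"
    unfolding reduced_split
  proof (intro allI impI)
    fix u a b z assume "x @ y = u @ Push a # Pop b # z"
    from append_eq_snoc_Cons_cases[OF this] show "a = 1 \<and> b = 1"
      using r unfolding reduced_split by blast
  qed
qed

lemma reduced_map_Push [simp]: "reduced (map Push A)"
  by (auto simp: reduced_split map_eq_append_conv)

lemma reduced_map_Pop [simp]: "reduced (map Pop A)"
  by (auto simp: reduced_split map_eq_append_conv)

text \<open>As \<open>v\<close> begins with a push and ends with a pop, every push followed by a pop
  lies inside \<open>u\<close>, \<open>v\<close> or \<open>z\<close>, which the replacement does not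
  touch.\<close>

lemma reduced_nested:
  assumes "reduced (u @ map Push A @ v @ map Pop B @ z)" "well_formed v" "v \<noteq> []" "A' \<noteq> []" "B' \<noteq> []"
  shows "reduced (u @ map Push A' @ v @ map Pop B' @ z)"
proof -
  obtain a v1 where f: "v = Push a # v1" using well_formed_first assms by blast
  obtain b v2 where l: "v = v2 @ [Pop b]" using well_formed_last assms by blast
  have "reduced u" "reduced v" "reduced z" using assms(1) by (auto simp: reduced_append)
  moreover have "reduced (map Pop B' @ z)"
    using \<open>reduced z\<close> unfolding reduced_append by (auto simp: map_eq_append_conv)
  moreover from this have "reduced (v @ map Pop B' @ z)"
    using \<open>reduced v\<close> unfolding reduced_append[of v] using l by auto
  moreover from this have "reduced (map Push A' @ v @ map Pop B' @ z)"
    unfolding reduced_append[of "map Push A'"] using f by auto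
  ultimately show ?thesis
    unfolding reduced_append[of u] using assms(4) by (cases A') auto
qed

lemma finite_minimal:
  assumes "finite S" "S \<noteq> {}" "trans r" "irrefl r"
  shows "\<exists>x\<in>S. \<forall>y\<in>S. (y, x) \<notin> r"
proof -
  have "acyclic (r \<inter> S \<times> S)"
  proof -
    have "trans (r \<inter> S \<times> S)" using assms(3) unfolding trans_def by blast
    then have "(r \<inter> S \<times> S)\<^sup>+ = r \<inter> S \<times> S" by simp
    then show ?thesis using assms(4) unfolding acyclic_def irrefl_def by auto
  qed
  then have "wf (r \<inter> S \<times> S)" using assms(1) by (intro finite_acyclic_wf) auto
  then obtain x where "x \<in> S" "\<And>y. (y, x) \<in> r \<inter> S \<times> S \<Longrightarrow> y \<notin> S"
    using assms(2) unfolding wf_eq_minimal by blast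
  then show ?thesis by blast
qed

lemma exists_irreducible:
  assumes "well_formed \<alpha>" "set \<alpha> \<subseteq> op_alphabet s t"
  shows "\<exists>\<beta>. well_formed \<beta> \<and> set \<beta> \<subseteq> op_alphabet s t \<and> reduced \<beta> \<and> irreducible_word s t \<beta> \<and> equivalent \<beta> \<alpha>"
proof -
  let ?S = "{w. well_formed w \<and> set w \<subseteq> op_alphabet s t \<and> reduced w \<and> equivalent w \<alpha>}"
  \<comment> \<open>Only pushes are comparable. A replacement first differs from the old word at
    \<open>hd A\<close>, where it is smaller.\<close>
  let ?r = "{(Push a, Push b) | a b. a < b}"
  have fin: "finite ?S"
    by (rule finite_subset[OF _ finite_class[of s t "push_total \<alpha>"]]) (auto simp: equivalent_def)
  have ne: "?S \<noteq> {}" using exists_reduced[OF assms] by auto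
  have "trans (lexord ?r)" by (rule lexord_transI) (auto simp: trans_def)
  moreover have "irrefl (lexord ?r)" by (rule lexord_irrefl) (auto simp: irrefl_def)
  ultimately obtain \<beta> where b: "\<beta> \<in> ?S" "\<And>w. w \<in> ?S \<Longrightarrow> (w, \<beta>) \<notin> lexord ?r"
    using finite_minimal[OF fin ne] by blast
  have "irreducible_word s t \<beta>"
    unfolding irreducible_word_def
  proof (rule notI, elim exE conjE)
    fix u A v B z
    assume w: "\<beta> = u @ map Push A @ v @ map Pop B @ z" and v: "v \<noteq> []" "well_formed v" and bad: "bad s t A B"
    let ?k = "sum_list A"
    obtain A' B' where A': "A' \<noteq> []" "set A' \<subseteq> {1..s}" "set B' \<subseteq> {1..t}" "hd A' < hd A"
      "sum_list A' = ?k" "sum_list B' = ?k" "blk B (blk A [0..<?k]) = blk B' (blk A' [0..<?k])"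
      and A: "A \<noteq> []" "\<forall>a\<in>set A. 1 \<le> a" "\<forall>b\<in>set B. 1 \<le> b" "sum_list B = ?k"
      using bad unfolding bad_def by blast
    have kpos: "0 < ?k" using A(1,2) by (cases A) auto
    then have B': "B' \<noteq> []" using A'(6) by (metis less_irrefl sum_list.Nil)
    let ?w = "u @ map Push A' @ v @ map Pop B' @ z"
    have se: "same_effect (map Push A @ v @ map Pop B) (map Push A' @ v @ map Pop B')"
      by (rule same_effect_nested) (use A A' v in auto)
    have ht: "ht 0 (u @ map Push A @ v @ map Pop B @ z) = Some 0" using b(1) w by (simp add: well_formed_ht)
    obtain l where l: "ht 0 u = Some l" using ht unfolding ht_append_Some by blast
    have v0: "ht (l + ?k) v = Some (l + ?k)"
      using ht_shift[of 0 v 0 "l + ?k"] v(2) by (simp add: well_formed_ht)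
    have z: "ht l z = Some 0"
      using ht l v0 ht_map_Push[OF A(2), of l] ht_map_Pop[OF A(3), of "l + ?k"] A(4)
      unfolding ht_append_Some by auto
    have "ht l (map Push A') = Some (l + ?k)"
      using ht_map_Push[of A' l] A'(2,5) by fastforce
    moreover have "ht (l + ?k) (map Pop B') = Some l"
      using ht_map_Pop[of B' "l + ?k"] A'(3,6) by fastforce
    ultimately have wf: "well_formed ?w"
      unfolding well_formed_ht ht_append_Some using l v0 z by blast
    have al: "set ?w \<subseteq> op_alphabet s t"
      using b(1) w A'(2,3) by (auto simp: op_alphabet_def)
    have red: "reduced ?w"
      using reduced_nested[of u A v B z] b(1) w v A'(1) B' by auto
    have "equivalent \<beta> ?w"
      using equivalent_context[OF _ se, of u z] b(1) w by simp
    then have "?w \<in> ?S" using wf al red b(1) by (auto simp: equivalent_def)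
    moreover have "(?w, \<beta>) \<in> lexord ?r"
    proof -
      obtain a A0 where "A = a # A0" using A(1) by (cases A) auto
      moreover obtain a' A0' where "A' = a' # A0'" using A'(1) by (cases A') auto
      ultimately show ?thesis unfolding w using A'(4) by (auto intro!: lexord_append_leftI)
    qed
    ultimately show False using b(2) by blast
  qed
  then show ?thesis using b(1) by auto
qed

section \<open>Layered involutions\<close>

definition is_cut :: "(nat \<Rightarrow> nat) \<Rightarrow> nat \<Rightarrow> bool" where
  "is_cut L c \<longleftrightarrow> (\<forall>i. L i < c \<longleftrightarrow> i < c)"

definition block :: "(nat \<Rightarrow> nat) \<Rightarrow> nat \<Rightarrow> nat \<Rightarrow> bool" where
  "block L x y \<longleftrightarrow> x < y \<and> is_cut L x \<and> is_cut L y \<and> (\<forall>j. x \<le> j \<longrightarrow> j < y \<longrightarrow> L j = x + y - 1 - j)"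

definition layered :: "(nat \<Rightarrow> nat) \<Rightarrow> bool" where
  "layered L \<longleftrightarrow> (\<forall>i. \<exists>x y. x \<le> i \<and> i < y \<and> block L x y)"

lemma cut_0 [simp]: "is_cut L 0"
  by (simp add: is_cut_def)

lemma cut_less: "is_cut L c \<Longrightarrow> i < c \<Longrightarrow> L i < c"
  by (simp add: is_cut_def)

lemma cut_ge: "is_cut L c \<Longrightarrow> c \<le> i \<Longrightarrow> c \<le> L i"
  by (metis is_cut_def not_le)

lemma blockD:
  assumes "block L x y"
  shows "x < y" "is_cut L x" "is_cut L y" "\<And>j. x \<le> j \<Longrightarrow> j < y \<Longrightarrow> L j = x + y - 1 - j"
  using assms by (auto simp: block_def)

lemma layered_block:
  assumes "layered L" obtains x y where "x \<le> i" "i < y" "block L x y"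
  using assms unfolding layered_def by blast

lemma layered_invol: "layered L \<Longrightarrow> L (L i) = i"
proof -
  assume "layered L"
  then obtain x y where b: "x \<le> i" "i < y" "block L x y" by (rule layered_block)
  have "L i = x + y - 1 - i" using b blockD(4)[OF b(3)] by auto
  moreover have "L (x + y - 1 - i) = x + y - 1 - (x + y - 1 - i)"
    using b by (intro blockD(4)[OF b(3)]) auto
  ultimately show ?thesis using b by auto
qed

lemma block_cut: "block L x y \<Longrightarrow> is_cut L c \<Longrightarrow> c \<le> x \<or> y \<le> c"
proof (rule ccontr)
  assume b: "block L x y" and c: "is_cut L c" and n: "\<not> (c \<le> x \<or> y \<le> c)"
  then have "L x = y - 1" using blockD(1)[OF b] blockD(4)[OF b, of x] by auto
  then show False using cut_less[OF c, of x] n by auto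
qed

lemma block_unique:
  assumes "block L x y" "block L x' y'" "x \<le> i" "i < y" "x' \<le> i" "i < y'"
  shows "x = x'" "y = y'"
  using block_cut[OF assms(1) blockD(2)[OF assms(2)]] block_cut[OF assms(1) blockD(3)[OF assms(2)]]
    block_cut[OF assms(2) blockD(2)[OF assms(1)]] block_cut[OF assms(2) blockD(3)[OF assms(1)]] assms(3-)
  by auto

lemma layered_not_cut:
  assumes "layered L" "\<not> is_cut L c" obtains x y where "x < c" "c < y" "block L x y"
proof -
  obtain x y where b: "x \<le> c" "c < y" "block L x y" using assms(1) by (rule layered_block)
  then have "x \<noteq> c" using assms(2) blockD(2) by blast
  then show thesis using b that[of x y] by auto
qed

lemma block_from_cut:
  assumes "layered L" "is_cut L c" obtains y where "c < y" "block L c y"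
proof -
  obtain x y where b: "x \<le> c" "c < y" "block L x y" using assms(1) by (rule layered_block)
  then have "x = c" using block_cut[OF b(3) assms(2)] by auto
  then show thesis using b that by auto
qed

text \<open>The image of \<open>{..<c}\<close> determines a block \<open>{x..<y}\<close> across
  \<open>c\<close>: its largest element is \<open>y - 1\<close>, and \<open>x\<close> is the least
  number missing from it.\<close>

lemma block_image_crossing:
  assumes L: "layered L" "layered L'" and im: "L ` {..<c} = L' ` {..<c}"
    and b: "block L x y" "x < c" "c < y"
  shows "block L' x y"
proof -
  have Lx: "L x = y - 1" using blockD(4)[OF b(1), of x] blockD(1)[OF b(1)] by auto
  have "\<not> is_cut L' c"
  proof
    assume "is_cut L' c"
    then have "L' ` {..<c} \<subseteq> {..<c}" by (auto simp: cut_less)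
    moreover have "y - 1 \<in> L ` {..<c}" using Lx b(2) by (metis imageI lessThan_iff)
    ultimately show False using im b(3) by auto
  qed
  then obtain x' y' where b': "block L' x' y'" "x' < c" "c < y'"
    using layered_not_cut[OF L(2)] by metis
  \<comment> \<open>Stated for arbitrary maps so that it applies in both directions; antisymmetry
    then gives equality of the blocks.\<close>
  have main: "q \<le> q' \<and> p \<le> p'"
    if M: "layered M" "layered M'" "M ` {..<c} = M' ` {..<c}" "block M p q" "p < c" "c < q"
      "block M' p' q'" "p' < c" "c < q'" for M M' :: "nat \<Rightarrow> nat" and p q p' q'
  proof
    have Mp: "M p = q - 1" using blockD(4)[OF M(4), of p] blockD(1)[OF M(4)] by auto
    then have "q - 1 \<in> M' ` {..<c}" using M(3,5) by (metis imageI lessThan_iff)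
    then obtain j where "j < c" "q - 1 = M' j" by auto
    then have "q - 1 < q'" using cut_less[OF blockD(3)[OF M(7)], of j] M(9) by auto
    then show "q \<le> q'" by auto
    show "p \<le> p'"
    proof (rule ccontr)
      assume "\<not> p \<le> p'"
      then have "M p' < p" by (simp add: cut_less[OF blockD(2)[OF M(4)]])
      then have "p' \<in> M ` {..<c}" using layered_invol[OF M(1), of p'] M(5)
        by (metis imageI lessThan_iff less_trans)
      then obtain j where "j < c" "p' = M' j" using M(3) by auto
      then have "M' p' < c" using layered_invol[OF M(2)] by metis
      moreover have "M' p' = q' - 1" using blockD(4)[OF M(7), of p'] blockD(1)[OF M(7)] by auto
      ultimately show False using M(9) by auto
    qed
  qed
  have "x = x'" "y = y'"
    using main[OF L im b b'] main[OF L(2,1) im[symmetric] b' b] by auto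
  then show ?thesis using b' by simp
qed

text \<open>One inclusion follows from \<open>L j = L' (L' (L j))\<close>, the other from equal
  cardinality.\<close>

lemma same_image_if_stable:
  assumes L: "layered L" "layered L'" and st: "\<And>j. j < c \<Longrightarrow> L' (L j) < c"
  shows "L ` {..<c} = L' ` {..<c}"
proof -
  have inj: "inj M" if "layered M" for M
    using layered_invol[OF that] by (metis injI)
  have "L ` {..<c} \<subseteq> L' ` {..<c}"
  proof
    fix z assume "z \<in> L ` {..<c}"
    then obtain j where j: "j < c" "z = L j" by auto
    then have "z = L' (L' (L j))" using layered_invol[OF L(2)] by simp
    then show "z \<in> L' ` {..<c}" using st j by auto
  qed
  moreover have "card (L ` {..<c}) = card (L' ` {..<c})"
    using card_image[OF inj_on_subset[OF inj[OF L(1)]], of "{..<c}"]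
      card_image[OF inj_on_subset[OF inj[OF L(2)]], of "{..<c}"] by simp
  ultimately show ?thesis by (intro card_subset_eq) auto
qed

lemma block_crossing:
  assumes L: "layered L" "layered L'" and st: "\<And>j. j < c \<Longrightarrow> L' (L j) < c" and "x < c" "c < y"
  shows "block L x y \<longleftrightarrow> block L' x y"
  using block_image_crossing[OF L same_image_if_stable[OF L st]]
    block_image_crossing[OF L(2,1) same_image_if_stable[OF L st, symmetric]] assms(4,5) by blast

lemma block_agree:
  assumes L: "layered L" "layered L'" and "block L x y" "block L' x y" "x \<le> j" "j < y"
  shows "L' (L j) = j"
proof -
  have "L j = L' j" using blockD(4)[OF assms(3,5,6)] blockD(4)[OF assms(4,5,6)] by simp
  then show ?thesis using layered_invol[OF L(2)] by simp
qed

text \<open>A block of \<open>L\<close> across \<open>i\<close> starts at some \<open>x < i\<close>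
  and is determined by its value there. Agreement up to \<open>i\<close> forces the same block on
  \<open>L'\<close>, hence agreement at \<open>i\<close>.\<close>

lemma first_disagreement_cut:
  assumes L: "layered L" "layered L'" and ag: "\<And>j. j < i \<Longrightarrow> L j = L' j" and ne: "L i \<noteq> L' i"
  shows "is_cut L i"
proof (rule ccontr)
  assume "\<not> is_cut L i"
  then obtain x y where b: "x < i" "i < y" "block L x y" by (rule layered_not_cut[OF L(1)])
  have "is_cut L' x"
  proof (rule ccontr)
    assume "\<not> is_cut L' x"
    then obtain p q where p: "p < x" "x < q" "block L' p q" by (rule layered_not_cut[OF L(2)])
    then have "L' p = q - 1" using blockD(4)[OF p(3), of p] by auto
    moreover have "L p < x" using blockD(2)[OF b(3)] p by (simp add: cut_less)
    ultimately show False using ag[of p] p b by auto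
  qed
  then obtain y' where y': "x < y'" "block L' x y'" by (rule block_from_cut[OF L(2)])
  have "L x = y - 1" "L' x = y' - 1"
    using blockD(4)[OF b(3), of x] blockD(4)[OF y'(2), of x] b y' by auto
  then have "y = y'" using ag[of x] b y' by auto
  then have "L i = L' i" using blockD(4)[OF b(3), of i] blockD(4)[OF y'(2), of i] b y' by auto
  then show False using ne by simp
qed

section \<open>Two factorisations of the same permutation into layered involutions\<close>

text \<open>\<open>A\<close> and \<open>B\<close> come from the pushes and pops of one word,
  \<open>A'\<close> and \<open>B'\<close> from another, on a common chain of \<open>m\<close> nodes.
  As all four are involutions, the equation says that both words permute the chain alike.\<close>

locale lines =
  fixes A A' B B' :: "nat \<Rightarrow> nat" and m :: nat
  assumes lay: "layered A" "layered A'" "layered B" "layered B'"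
    and stable: "j < m \<Longrightarrow> A' (A j) < m"
    and eq: "j < m \<Longrightarrow> A' (A j) = B' (B j)"
    and nocommon: "block A x y \<Longrightarrow> block B x y \<Longrightarrow> y \<le> m \<Longrightarrow> y \<le> Suc x"
    and nocommon': "block A' x y \<Longrightarrow> block B' x y \<Longrightarrow> y \<le> m \<Longrightarrow> y \<le> Suc x"
begin

lemma lines_BA: "lines B B' A A' m"
  by unfold_locales (use lay stable eq nocommon nocommon' in auto)

text \<open>Exchanging the words inverts the product, so it must first be seen to permute
  \<open>{..<m}\<close>; being injective on a finite set it does.\<close>

lemma lines_prime: "lines A' A B' B m"
proof -
  have inv: "A' (A' j) = j" "A (A j) = j" "B' (B' j) = j" "B (B j) = j" for j
    using lay layered_invol by auto
  have "inj_on (\<lambda>j. A' (A j)) {..<m}" by (rule inj_onI) (metis inv)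
  moreover have "(\<lambda>j. A' (A j)) ` {..<m} \<subseteq> {..<m}" using stable by auto
  ultimately have im: "(\<lambda>j. A' (A j)) ` {..<m} = {..<m}" by (simp add: endo_inj_surj)
  have "A (A' j) < m \<and> A (A' j) = B (B' j)" if j: "j < m" for j
  proof -
    have "j \<in> (\<lambda>j. A' (A j)) ` {..<m}" using im j by simp
    then obtain i where "i < m" "j = A' (A i)" by auto
    then show ?thesis using eq[of i] inv by metis
  qed
  then have "A (A' j) < m" "A (A' j) = B (B' j)" if "j < m" for j using that by blast+
  then show ?thesis by (intro lines.intro lay nocommon nocommon')
qed

text \<open>\<open>A\<close> and \<open>B\<close> permute \<open>{..<c}\<close>, so
  \<open>A'\<close> and \<open>B'\<close> have the same image on it and share any block across
  \<open>c\<close>; \<open>nocommon'\<close> excludes such a block.\<close>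

lemma shared_cut:
  assumes c: "c \<le> m" "is_cut A c" "is_cut B c"
  shows "is_cut A' c"
proof (rule ccontr)
  assume nc: "\<not> is_cut A' c"
  then obtain x y where b: "x < c" "c < y" "block A' x y" by (rule layered_not_cut[OF lay(2)])
  have "B' ` {..<c} = A' ` {..<c}"
  proof
    show "A' ` {..<c} \<subseteq> B' ` {..<c}"
    proof
      fix z assume "z \<in> A' ` {..<c}"
      then obtain j where j: "j < c" "z = A' j" by auto
      have "A' j = B' (B (A j))"
        using eq[of "A j"] j c cut_less[OF c(2) j(1)] layered_invol[OF lay(1), of j] by simp
      then show "z \<in> B' ` {..<c}" using j cut_less[OF c(3)] cut_less[OF c(2)] by auto
    qed
    show "B' ` {..<c} \<subseteq> A' ` {..<c}"
    proof
      fix z assume "z \<in> B' ` {..<c}"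
      then obtain j where j: "j < c" "z = B' j" by auto
      have "B' j = A' (A (B j))"
        using eq[of "B j"] j c cut_less[OF c(3) j(1)] layered_invol[OF lay(3), of j] by simp
      then show "z \<in> A' ` {..<c}" using j cut_less[OF c(3)] cut_less[OF c(2)] by auto
    qed
  qed
  then have bB: "block B' x y" using block_image_crossing[OF lay(2,4) _ b(3,1,2)] by simp
  \<comment> \<open>A block reaching past \<open>m\<close> would be shared by \<open>A\<close> and
    \<open>A'\<close>, since their product preserves \<open>{..<m}\<close>; but \<open>c\<close> is
    a cut of \<open>A\<close>.\<close>
  have "y \<le> m"
  proof (rule ccontr)
    assume "\<not> y \<le> m"
    then have "block A x y" using block_crossing[OF lay(1,2) stable, of x y] b c by auto
    then show False using block_cut[OF _ c(2)] b by fastforce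
  qed
  then show False using nocommon'[OF b(3) bB] b by auto
qed

text \<open>By stability a first block reaching past \<open>m\<close> would be the first block of
  both maps.\<close>

lemma first_block_le:
  assumes "block A 0 a" "block A' 0 a'" "a \<noteq> a'" "0 < m"
  shows "a \<le> m"
proof (rule ccontr)
  assume "\<not> a \<le> m"
  then have "block A' 0 a" using block_crossing[OF lay(1,2) stable, of 0 a] assms by auto
  then show False using block_unique[OF _ assms(2), of 0 a 0] blockD(1) assms by fastforce
qed

text \<open>The image of 0 gives \<open>a' - a = b' - b\<close>. Since \<open>a < b\<close>, the
  start \<open>a\<close> of the second block of \<open>A\<close> lies in the first block of
  \<open>B\<close>; evaluating the products there shows that the second blocks of \<open>A\<close>
  and \<open>A'\<close> have the same end \<open>a2\<close>. This is the cut, and two blocks give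
  \<open>2 * S\<close>.\<close>

lemma same_direction:
  assumes a: "block A 0 a" "block A' 0 a'" "a < a'" and b: "block B 0 b" "block B' 0 b'" "b < b'"
    and ab: "a < b" and m: "0 < m" and bd: "\<And>x y. block A x y \<Longrightarrow> y \<le> x + S"
  shows "\<exists>k. 0 < k \<and> k \<le> m \<and> k \<le> 2 * S \<and> is_cut A k \<and> is_cut B k"
proof -
  interpret sw: lines B B' A A' m by (rule lines_BA)
  have pos: "0 < a" using a blockD(1) by auto
  have bm: "b \<le> m" using sw.first_block_le[OF b(1,2)] b(3) m by auto
  have ev: "A j = a - 1 - j" if "j < a" for j using blockD(4)[OF a(1), of j] that by simp
  have ev': "A' j = a' - 1 - j" if "j < a'" for j using blockD(4)[OF a(2), of j] that by simp
  have evb: "B j = b - 1 - j" if "j < b" for j using blockD(4)[OF b(1), of j] that by simp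
  have evb': "B' j = b' - 1 - j" if "j < b'" for j using blockD(4)[OF b(2), of j] that by simp
  obtain a2 where a2: "a < a2" "block A a a2" using block_from_cut[OF lay(1) blockD(3)[OF a(1)]] .
  obtain a3 where a3: "a' < a3" "block A' a' a3" using block_from_cut[OF lay(2) blockD(3)[OF a(2)]] .
  have d: "a' - a = b' - b"
    using eq[of 0] m pos a(3) b(3) ab ev[of 0] ev'[of "a - 1"] evb[of 0] evb'[of "b - 1"] by auto
  have Aa: "A a = a2 - 1" using blockD(4)[OF a2(2), of a] a2 by simp
  have "A' (a2 - 1) = a'"
    using eq[of a] ab bm evb[of a] evb'[of "b - 1 - a"] d a(3) b(3) Aa by auto
  then have "A' a' = a2 - 1" using layered_invol[OF lay(2)] by metis
  moreover have "A' a' = a3 - 1" using blockD(4)[OF a3(2), of a'] a3 by simp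
  ultimately have a23: "a2 = a3" using a2(1) a3(1) by auto
  have a2m: "a2 \<le> m"
  proof (rule ccontr)
    assume "\<not> a2 \<le> m"
    then have "block A' a a2"
      using block_crossing[OF lay(1,2) stable, of a a2] ab bm a2(2) by auto
    then show False using block_unique(1)[OF _ a(2), of a a2 a] a2(1) a(3) pos by auto
  qed
  have cA: "is_cut A a2" "is_cut A' a2" using blockD(3)[OF a2(2)] blockD(3)[OF a3(2)] a23 by auto
  \<comment> \<open>A block of \<open>B\<close> across \<open>a2\<close> would be shared with
    \<open>B'\<close>, so the product would fix \<open>a2 - 1\<close>; computed through
    \<open>A\<close> and \<open>A'\<close> it does not.\<close>
  have "is_cut B a2"
  proof (rule ccontr)
    assume "\<not> is_cut B a2"
    then obtain x y where xy: "x < a2" "a2 < y" "block B x y" by (rule layered_not_cut[OF lay(3)])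
    have "B' (B j) < a2" if "j < a2" for j
    proof -
      have "A' (A j) < a2" using cut_less[OF cA(2) cut_less[OF cA(1) that]] .
      then show ?thesis using eq[of j] that a2m by linarith
    qed
    then have "block B' x y" using block_crossing[OF lay(3,4), of a2 x y] xy by auto
    then have "B' (B (a2 - 1)) = a2 - 1" using block_agree[OF lay(3,4) xy(3)] xy by auto
    moreover have "A (a2 - 1) = a" using Aa layered_invol[OF lay(1)] by metis
    ultimately have "A' a = a2 - 1" using eq[of "a2 - 1"] a2m a2(1) by auto
    then show False using ev'[of a] a(3) a3(1) a23 by auto
  qed
  moreover have "a2 \<le> 2 * S" using bd[OF a(1)] bd[OF a2(2)] by auto
  ultimately show ?thesis using cA a2m a2(1) by (intro exI[of _ a2]) auto
qed

text \<open>If the end \<open>a'\<close> of the first block of \<open>A'\<close> is not a cut of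
  \<open>B'\<close>, then \<open>A\<close> has a block across \<open>a'\<close> as well. The inverse
  product at 0 determines \<open>A\<close> there, and this makes the second blocks of
  \<open>A'\<close> and \<open>B'\<close> end together.\<close>

lemma opposite_direction:
  assumes a: "block A 0 a" "block A' 0 a'" "a < a'" and b: "block B 0 b" "block B' 0 b'" "b' < b"
    and ab: "b \<le> a'" and m: "0 < m" and bd: "\<And>x y. block A' x y \<Longrightarrow> y \<le> x + S"
  shows "\<exists>k. 0 < k \<and> k \<le> m \<and> k \<le> 2 * S \<and> is_cut A' k \<and> is_cut B' k"
proof (cases "is_cut B' a'")
  case True
  interpret pr: lines A' A B' B m by (rule lines_prime)
  show ?thesis
    using True pr.first_block_le[OF a(2,1)] a(3) m blockD(3)[OF a(2)] bd[OF a(2)] by (intro exI[of _ a']) auto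
next
  case False
  interpret pr: lines A' A B' B m by (rule lines_prime)
  have pos: "0 < a" "0 < b'" using a(1) b(2) blockD(1) by auto
  have am: "a' \<le> m" using pr.first_block_le[OF a(2,1)] a(3) m by auto
  have ev: "A j = a - 1 - j" if "j < a" for j using blockD(4)[OF a(1), of j] that by simp
  have ev': "A' j = a' - 1 - j" if "j < a'" for j using blockD(4)[OF a(2), of j] that by simp
  have evb: "B j = b - 1 - j" if "j < b" for j using blockD(4)[OF b(1), of j] that by simp
  have evb': "B' j = b' - 1 - j" if "j < b'" for j using blockD(4)[OF b(2), of j] that by simp
  obtain x y where xy: "x < a'" "a' < y" "block B' x y" using False by (rule layered_not_cut[OF lay(4)])
  \<comment> \<open>Otherwise the block of \<open>B'\<close> across \<open>a'\<close> is also one of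
    \<open>B\<close>, and the product fixes \<open>a' - 1\<close>; but it sends \<open>a - 1\<close>
    there, and it is injective.\<close>
  have nstable: "\<not> (\<forall>j<a'. A' (A j) < a')"
  proof
    assume st: "\<forall>j<a'. A' (A j) < a'"
    have "B' (B j) < a'" if "j < a'" for j
      using st eq[of j] am that by auto
    then have "block B x y" using block_crossing[OF lay(3,4), of a' x y] xy by auto
    then have "B' (B (a' - 1)) = a' - 1" using block_agree[OF lay(3,4) _ xy(3)] xy by auto
    then have "A' (A (a' - 1)) = a' - 1" using eq[of "a' - 1"] am a(3) by auto
    moreover have "A' (A (a - 1)) = a' - 1" using ev[of "a - 1"] ev'[of 0] pos a(3) by auto
    ultimately have "a' - 1 = a - 1" using layered_invol[OF lay(1)] layered_invol[OF lay(2)] by metis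
    then show False using a(3) pos by auto
  qed
  have "\<not> is_cut A a'"
    using nstable cut_less[of A a'] cut_less[OF blockD(3)[OF a(2)]] by blast
  then obtain u v where uv: "u < a'" "a' < v" "block A u v" by (rule layered_not_cut[OF lay(1)])
  \<comment> \<open>Chosen so that \<open>A ?z = a'\<close> and \<open>B ?z = b'\<close>, the starts
    of the second blocks of \<open>A'\<close> and \<open>B'\<close>.\<close>
  let ?z = "b - b' - 1"
  have "A (a' - 1) = b - b'"
    using pr.eq[of 0] m ev'[of 0] evb'[of 0] evb[of "b' - 1"] a(3) b(3) pos by auto
  then have "A a' = ?z"
    using blockD(4)[OF uv(3), of "a' - 1"] blockD(4)[OF uv(3), of a'] uv by auto
  then have Az: "A ?z = a'" using layered_invol[OF lay(1)] by metis
  have zm: "?z < m" using ab am b(3) pos by auto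
  obtain a2 where a2: "a' < a2" "block A' a' a2" using block_from_cut[OF lay(2) blockD(3)[OF a(2)]] .
  obtain b2 where b2: "b' < b2" "block B' b' b2" using block_from_cut[OF lay(4) blockD(3)[OF b(2)]] .
  have A2: "A' a' = a2 - 1" using blockD(4)[OF a2(2), of a'] a2 by simp
  have B2: "B' b' = b2 - 1" using blockD(4)[OF b2(2), of b'] b2 by simp
  have "B ?z = b'" using evb[of ?z] b(3) pos by auto
  then have "a2 - 1 = b2 - 1" using eq[OF zm] Az A2 B2 by simp
  then have "a2 = b2" using a2(1) b2(1) by auto
  moreover have "a2 \<le> m" using stable[OF zm] Az A2 by auto
  moreover have "a2 \<le> 2 * S" using bd[OF a(2)] bd[OF a2(2)] by auto
  ultimately show ?thesis using a2 b2 blockD(3) by (intro exI[of _ a2]) auto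
qed

text \<open>Moving 0 means that the first blocks differ in both pairs. Up to exchanging the words
  and exchanging pushes with pops, only the two preceding configurations occur.\<close>

theorem common_cut:
  assumes m: "0 < m" and ne: "A' (A 0) \<noteq> 0"
    and bd: "\<And>x y. block A x y \<Longrightarrow> y \<le> x + S" "\<And>x y. block A' x y \<Longrightarrow> y \<le> x + S"
      "\<And>x y. block B x y \<Longrightarrow> y \<le> x + S" "\<And>x y. block B' x y \<Longrightarrow> y \<le> x + S"
  obtains k where "0 < k" "k \<le> m" "k \<le> 2 * S" "is_cut A k" "is_cut A' k" "is_cut B k" "is_cut B' k"
    "\<And>c. 0 < c \<Longrightarrow> c < k \<Longrightarrow> \<not> (is_cut A c \<and> is_cut B c)"
    "\<And>c. 0 < c \<Longrightarrow> c < k \<Longrightarrow> \<not> (is_cut A' c \<and> is_cut B' c)"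
proof -
  interpret sw: lines B B' A A' m by (rule lines_BA)
  interpret pr: lines A' A B' B m by (rule lines_prime)
  interpret psw: lines B' B A' A m by (rule pr.lines_BA)
  have iff: "is_cut A c \<and> is_cut B c \<longleftrightarrow> is_cut A' c \<and> is_cut B' c" if "c \<le> m" for c
    using shared_cut[OF that] sw.shared_cut[OF that] pr.shared_cut[OF that] psw.shared_cut[OF that] by blast
  obtain a where a: "0 < a" "block A 0 a" using block_from_cut[OF lay(1) cut_0] .
  obtain a' where a': "0 < a'" "block A' 0 a'" using block_from_cut[OF lay(2) cut_0] .
  obtain b where b: "0 < b" "block B 0 b" using block_from_cut[OF lay(3) cut_0] .
  obtain b' where b': "0 < b'" "block B' 0 b'" using block_from_cut[OF lay(4) cut_0] .
  have "a \<noteq> a'" using block_agree[OF lay(1,2) a(2), of 0] a a' ne by auto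
  moreover have "b \<noteq> b'" using block_agree[OF lay(3,4) b(2), of 0] b b' ne eq[OF m] by auto
  \<comment> \<open>For \<open>a = b\<close> this would be a common cut of \<open>A\<close> and
    \<open>B\<close>, hence a cut of \<open>A'\<close> inside its first block.\<close>
  moreover have "a < a' \<longrightarrow> a \<noteq> b"
    using block_cut[OF a'(2), of a] iff[of a] first_block_le[OF a(2) a'(2)] blockD(3)[OF a(2)] blockD(3)[OF b(2)] m a
    by auto
  moreover have "a' < a \<longrightarrow> a' \<noteq> b'"
    using block_cut[OF a(2), of a'] iff[of a'] pr.first_block_le[OF a'(2) a(2)] blockD(3)[OF a'(2)] blockD(3)[OF b'(2)] m a'
    by auto
  ultimately consider "a < a'" "b < b'" "a < b" | "a < a'" "b < b'" "b < a"
    | "a' < a" "b' < b" "a' < b'" | "a' < a" "b' < b" "b' < a'"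
    | "a < a'" "b' < b" "b \<le> a'" | "a < a'" "b' < b" "a' \<le> b"
    | "a' < a" "b < b'" "b' \<le> a" | "a' < a" "b < b'" "a \<le> b'"
    by (metis linorder_neqE_nat nat_le_linear)
  then have "\<exists>k. 0 < k \<and> k \<le> m \<and> k \<le> 2 * S \<and> is_cut A k \<and> is_cut B k"
  proof cases
    case 1 show ?thesis using same_direction[OF a(2) a'(2) 1(1) b(2) b'(2) 1(2,3) m bd(1)] by blast
  next
    case 2 show ?thesis using sw.same_direction[OF b(2) b'(2) 2(2) a(2) a'(2) 2(1,3) m bd(3)] by blast
  next
    case 3 show ?thesis using pr.same_direction[OF a'(2) a(2) 3(1) b'(2) b(2) 3(2,3) m bd(2)] iff by blast
  next
    case 4 show ?thesis using psw.same_direction[OF b'(2) b(2) 4(2) a'(2) a(2) 4(1,3) m bd(4)] iff by blast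
  next
    case 5 show ?thesis using opposite_direction[OF a(2) a'(2) 5(1) b(2) b'(2) 5(2,3) m bd(2)] iff by blast
  next
    case 6 show ?thesis using psw.opposite_direction[OF b'(2) b(2) 6(2) a'(2) a(2) 6(1,3) m bd(3)] by blast
  next
    case 7 show ?thesis using pr.opposite_direction[OF a'(2) a(2) 7(1) b'(2) b(2) 7(2,3) m bd(1)] by blast
  next
    case 8 show ?thesis using sw.opposite_direction[OF b(2) b'(2) 8(2) a(2) a'(2) 8(1,3) m bd(4)] iff by blast
  qed
  then obtain k0 where k0: "0 < k0" "k0 \<le> m" "k0 \<le> 2 * S" "is_cut A k0" "is_cut B k0" by blast
  \<comment> \<open>The least common cut is taken because a nested factor of length \<open>k\<close>
    will require that \<open>k - 1\<close> is not a common cut.\<close>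
  define k where "k = (LEAST c. 0 < c \<and> is_cut A c \<and> is_cut B c)"
  have k: "0 < k" "is_cut A k" "is_cut B k"
    using LeastI[of "\<lambda>c. 0 < c \<and> is_cut A c \<and> is_cut B c" k0] k0 unfolding k_def by auto
  have "k \<le> k0" unfolding k_def by (rule Least_le) (use k0 in auto)
  then have km: "k \<le> m" "k \<le> 2 * S" using k0 by auto
  have low: "\<not> (is_cut A c \<and> is_cut B c)" if "0 < c" "c < k" for c
    using not_less_Least[of c "\<lambda>c. 0 < c \<and> is_cut A c \<and> is_cut B c"] that unfolding k_def by auto
  show thesis
    by (rule that[of k]) (use k km iff low in \<open>auto dest: less_imp_le\<close>)
qed

end

section \<open>Blocks and cuts of the involution of a composition\<close>

text \<open>The alternative \<open>y = Suc x\<close> covers the identity beyond the sum of the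
  parts.\<close>

lemma lay_block:
  "\<exists>x y. x \<le> i \<and> i < y \<and> block (lay A) x y \<and> (y - x \<in> set A \<or> y = Suc x)"
proof (induction A arbitrary: i)
  case Nil
  have "block (lay []) i (Suc i)" by (auto simp: block_def is_cut_def)
  then show ?case by (metis lessI order_refl)
next
  case (Cons a A)
  have c: "is_cut (lay (a # A)) (a + c)" if "is_cut (lay A) c" for c
    unfolding is_cut_def
  proof
    fix j
    show "lay (a # A) j < a + c \<longleftrightarrow> j < a + c"
      using that[unfolded is_cut_def, rule_format, of "j - a"] by auto
  qed
  show ?case
  proof (cases "i < a")
    case True
    then have "block (lay (a # A)) 0 a"
      using c[of 0] unfolding block_def by auto
    then have "0 \<le> i \<and> i < a \<and> block (lay (a # A)) 0 a \<and> (a - 0 \<in> set (a # A) \<or> a = Suc 0)"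
      using True by simp
    then show ?thesis by blast
  next
    case False
    obtain x y where xy: "x \<le> i - a" "i - a < y" "block (lay A) x y" "y - x \<in> set A \<or> y = Suc x"
      using Cons.IH by blast
    have "block (lay (a # A)) (a + x) (a + y)"
      using c blockD(1-3)[OF xy(3)] blockD(4)[OF xy(3)] unfolding block_def by auto
    moreover have "a + x \<le> i" "i < a + y" "a + y - (a + x) \<in> set (a # A) \<or> a + y = Suc (a + x)"
      using xy False by auto
    ultimately show ?thesis by blast
  qed
qed

lemma layered_lay [simp]: "layered (lay A)"
  unfolding layered_def using lay_block by blast

lemma lay_block_size:
  assumes "block (lay A) x y" "\<forall>a\<in>set A. a \<le> S" "1 \<le> S"
  shows "y \<le> x + S"
proof -
  obtain x' y' where xy: "x' \<le> x" "x < y'" "block (lay A) x' y'" "y' - x' \<in> set A \<or> y' = Suc x'"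
    using lay_block by blast
  have "x = x'" "y = y'" using block_unique[OF assms(1) xy(3), of x] blockD(1)[OF assms(1)] xy by auto
  then show ?thesis using xy(4) assms(2,3) by auto
qed

lemma lay_cut: "is_cut (lay (A @ B)) (sum_list A)"
  unfolding is_cut_def by (auto simp: lay_append lay_less)

text \<open>No cut lies inside a part, so a cut is a partial sum of the composition.\<close>

lemma lay_cut_split:
  "is_cut (lay A) c \<Longrightarrow> c \<le> sum_list A \<Longrightarrow> \<exists>A1 A2. A = A1 @ A2 \<and> sum_list A1 = c"
proof (induction A arbitrary: c)
  case (Cons a A)
  show ?case
  proof (cases "c = 0")
    case False
    have ac: "a \<le> c"
      using cut_less[OF Cons.prems(1), of 0] False by (cases "a = 0") auto
    have "is_cut (lay A) (c - a)"
      unfolding is_cut_def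
    proof
      fix i
      show "lay A i < c - a \<longleftrightarrow> i < c - a"
        using Cons.prems(1)[unfolded is_cut_def, rule_format, of "a + i"] ac by auto
    qed
    moreover have "c - a \<le> sum_list A" using Cons.prems(2) by simp
    ultimately obtain A1 A2 where "A = A1 @ A2" "sum_list A1 = c - a"
      using Cons.IH by blast
    then show ?thesis using ac by (intro exI[of _ "a # A1"] exI[of _ A2]) auto
  qed (auto intro: exI[of _ "[]"])
qed auto

section \<open>Shapes\<close>

text \<open>Nodes are the elements numbered in the order of their unit pushes.  If \<open>h q\<close> unit pushes precede
  the unit pop \<open>q\<close>, then \<open>st h q\<close> is the stack of nodes just before this pop and \<open>pn h q\<close> is the node
  popped.\<close>
primrec st :: "(nat \<Rightarrow> nat) \<Rightarrow> nat \<Rightarrow> nat list" where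
  "st h 0 = rev [0..<h 0]"
| "st h (Suc q) = rev [h q..<h (Suc q)] @ tl (st h q)"

abbreviation pn :: "(nat \<Rightarrow> nat) \<Rightarrow> nat \<Rightarrow> nat" where
  "pn h q \<equiv> hd (st h q)"

text \<open>A Dyck path, given by the number of up-steps before each down-step;
  \<open>q < h q\<close> says that the stack is not empty when pop \<open>q\<close> occurs.\<close>

locale shape =
  fixes h :: "nat \<Rightarrow> nat" and n :: nat
  assumes mono: "q \<le> q' \<Longrightarrow> q' < n \<Longrightarrow> h q \<le> h q'"
    and above: "q < n \<Longrightarrow> q < h q"
    and below: "q < n \<Longrightarrow> h q \<le> n"
begin

lemma length_st: "q < n \<Longrightarrow> length (st h q) = h q - q"
proof (induction q)
  case (Suc q)
  then show ?case using mono[of q "Suc q"] above[of "Suc q"] above[of q] by simp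
qed simp

lemma st_nonempty: "q < n \<Longrightarrow> st h q \<noteq> []"
  using length_st above by fastforce

lemma st_less: "q < n \<Longrightarrow> i \<in> set (st h q) \<Longrightarrow> i < h q"
proof (induction q)
  case (Suc q)
  then have "i \<in> set [h q..<h (Suc q)] \<or> i \<in> set (st h q)"
    using st_nonempty[of q] list.set_sel(2)[of "st h q" i] by auto
  then show ?case using Suc mono[of q "Suc q"] by auto
qed auto

lemma st_sorted: "q < n \<Longrightarrow> sorted_wrt (>) (st h q)"
proof (induction q)
  case 0
  show ?case by (simp add: sorted_wrt_rev)
next
  case (Suc q)
  have "sorted_wrt (>) (tl (st h q))" using Suc by (cases "st h q") auto
  moreover have "i < h q" if "i \<in> set (tl (st h q))" for i
    using that st_less[of q i] Suc.prems by (cases "st h q") auto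
  ultimately show ?case by (force simp: sorted_wrt_append sorted_wrt_rev)
qed

lemma st_nth_inj:
  assumes "q < n" "i < length (st h q)" "j < length (st h q)" "st h q ! i = st h q ! j"
  shows "i = j"
  using sorted_wrt_nth_less[OF st_sorted[OF assms(1)]] assms(2-) by (metis less_irrefl nat_neq_iff)

lemma pn_less: "q < n \<Longrightarrow> pn h q < h q"
  using st_less[of q] st_nonempty[of q] by simp

lemma pn_less_n: "q < n \<Longrightarrow> pn h q < n"
  using pn_less below by (meson less_le_trans)

lemma st_run: "q + j < n \<Longrightarrow> h (q + j) = h q \<Longrightarrow> st h (q + j) = drop j (st h q)"
proof (induction j)
  case (Suc j)
  then have "h (q + j) = h q" using mono[of q "q + j"] mono[of "q + j" "q + Suc j"] by auto
  then show ?case using Suc by (simp add: drop_Suc tl_drop)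
qed simp

lemma pn_run: "q + j < n \<Longrightarrow> h (q + j) = h q \<Longrightarrow> pn h (q + j) = st h q ! j \<and> j < length (st h q)"
  using st_run[of q j] st_nonempty[of "q + j"] by (simp add: hd_drop_conv_nth)

lemma pn_decreasing:
  assumes "q < q'" "q' < n" "h q = h q'"
  shows "pn h q' < pn h q"
proof -
  have "pn h (q + (q' - q)) = st h q ! (q' - q) \<and> q' - q < length (st h q)"
    using pn_run[of q "q' - q"] assms by auto
  moreover have "pn h q = st h q ! 0" using st_nonempty[of q] assms by (simp add: hd_conv_nth)
  ultimately show ?thesis
    using sorted_wrt_nth_less[OF st_sorted[of q], of 0 "q' - q"] assms by auto
qed

text \<open>A popped node never returns, because everything pushed later has a larger
  number.\<close>

lemma pn_distinct:
  assumes "q < q'" "q' < n" shows "pn h q \<noteq> pn h q'"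
proof -
  have "Suc q + j < n \<Longrightarrow> pn h q \<notin> set (st h (Suc q + j))" for j
  proof (induction j)
    case 0
    have "pn h q \<notin> set (tl (st h q))"
      using st_sorted[of q] st_nonempty[of q] 0 by (cases "st h q") auto
    then show ?case using pn_less[of q] 0 by auto
  next
    case (Suc j)
    then have "pn h q \<notin> set (tl (st h (Suc q + j)))"
      by (metis add_Suc_right Suc_lessD list.sel(2) list.set_sel(2))
    then show ?case using pn_less[of q] mono[of q "Suc q + j"] Suc.prems by auto
  qed
  from this[of "q' - Suc q"] show ?thesis using assms st_nonempty[of q'] by auto
qed

lemma pn_inj: "q < n \<Longrightarrow> q' < n \<Longrightarrow> pn h q = pn h q' \<Longrightarrow> q = q'"
  using pn_distinct by (metis nat_neq_iff)

lemma pn_surj: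
  assumes "i < n" shows "\<exists>q<n. pn h q = i"
proof -
  have "inj_on (pn h) {..<n}" by (rule inj_onI) (simp add: pn_inj)
  moreover have "pn h ` {..<n} \<subseteq> {..<n}" using pn_less_n by auto
  ultimately have "pn h ` {..<n} = {..<n}" by (simp add: endo_inj_surj)
  then have "i \<in> pn h ` {..<n}" using assms by simp
  then show ?thesis by auto
qed

text \<open>No pop falls between the unit pushes of \<open>i\<close> and \<open>Suc i\<close>. They
  are therefore neighbours when pushed, and remain so while \<open>Suc i\<close> is present because
  the stack changes only at its top.\<close>

lemma st_adjacent:
  assumes no: "\<forall>q<n. h q \<noteq> Suc i"
  shows "q < n \<Longrightarrow> j < length (st h q) \<Longrightarrow> st h q ! j = Suc i \<Longrightarrow>
    Suc j < length (st h q) \<and> st h q ! Suc j = i"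
proof (induction q arbitrary: j)
  case 0
  then show ?case by (auto simp: rev_nth)
next
  case (Suc q)
  let ?d = "h (Suc q) - h q"
  show ?case
  proof (cases "j < ?d")
    case True
    then have v: "Suc i = h (Suc q) - Suc j" using Suc.prems by (simp add: nth_append rev_nth)
    \<comment> \<open>The lowest node of the new run of pushes is \<open>h q\<close>; as
      \<open>Suc i\<close> is not that node, \<open>i\<close> belongs to the same run.\<close>
    have "Suc i \<noteq> h q" using no[rule_format, of q] Suc.prems(1) by auto
    then have "Suc j < ?d" using v True by auto
    then show ?thesis using v by (simp add: nth_append rev_nth) linarith
  next
    case False
    define k where "k = j - ?d"
    have j: "j = ?d + k" using False k_def by simp
    have "st h q \<noteq> []" using st_nonempty[of q] Suc.prems by simp
    then obtain y ys where y: "st h q = y # ys" by (cases "st h q") auto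
    have "Suc k < length (st h q)" "st h q ! Suc k = Suc i"
      using Suc.prems(2,3) y by (auto simp: nth_append j)
    then have "Suc (Suc k) < length (st h q) \<and> st h q ! Suc (Suc k) = i"
      using Suc.IH[of "Suc k"] Suc.prems(1) by simp
    then show ?thesis using y by (auto simp: nth_append j)
  qed
qed

text \<open>The absence of pop heights above \<open>i\<close> and up to \<open>i'\<close> says that
  these nodes are pushed in one run, so they stay contiguous on the stack.\<close>

lemma st_chain:
  assumes no: "\<forall>q<n. \<not> (i < h q \<and> h q \<le> i')" and "i \<le> i'" "q < n" "pn h q = i'"
  shows "l \<le> i' - i \<Longrightarrow> l < length (st h q) \<and> st h q ! l = i' - l"
proof (induction l)
  case 0
  then show ?case using st_nonempty[of q] assms by (auto simp: hd_conv_nth)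
next
  case (Suc l)
  then have l: "l < length (st h q)" "st h q ! l = Suc (i' - Suc l)" by auto
  have "\<forall>q<n. h q \<noteq> Suc (i' - Suc l)"
  proof (intro allI impI notI)
    fix q assume "q < n" "h q = Suc (i' - Suc l)"
    then show False using no[rule_format, of q] Suc.prems by auto
  qed
  from st_adjacent[OF this assms(3) l] show ?case by simp
qed

text \<open>A run of pops reads the stack downwards, and the chain lies on it without gaps, so node
  numbers and pop times run oppositely at the same pace. This is why pop involutions are flipped
  later.\<close>

lemma pn_chain:
  assumes no: "\<forall>q<n. \<not> (i < h q \<and> h q \<le> i')" and i: "i \<le> i'"
    and q: "q < n" "pn h q = i" "q' < n" "pn h q' = i'" "h q = h q'"
  shows "q = q' + (i' - i)"
proof (cases "q' \<le> q")
  case True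
  then obtain j where j: "q = q' + j" using le_Suc_ex by blast
  have "st h q' ! j = i" "j < length (st h q')"
    using pn_run[of q' j] j q by auto
  moreover have "i' - i < length (st h q') \<and> st h q' ! (i' - i) = i' - (i' - i)"
    using st_chain[OF no i q(3,4)] by simp
  ultimately have "j = i' - i" using st_nth_inj[OF q(3)] i by auto
  then show ?thesis using j by simp
next
  case False
  then show ?thesis using pn_decreasing[of q q'] q i by auto
qed

end

section \<open>The shape of a word\<close>

text \<open>For every unit pop, the number of elements pushed before it.\<close>
fun hp :: "nat \<Rightarrow> op list \<Rightarrow> nat list" where
  "hp c [] = []"
| "hp c (Push a # w) = hp (c + a) w"
| "hp c (Pop b # w) = replicate b c @ hp c w"

lemma length_hp [simp]: "length (hp c w) = sum_list (pops w)"
  by (induction c w rule: hp.induct) auto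

lemma hp_append: "hp c (x @ y) = hp c x @ hp (c + sum_list (pushes x)) y"
  by (induction c x rule: hp.induct) (auto simp: algebra_simps)

lemma hp_bounds: "x \<in> set (hp c w) \<Longrightarrow> c \<le> x \<and> x \<le> c + sum_list (pushes w)"
  by (induction c w rule: hp.induct) (auto split: if_splits)

lemma hp_sorted: "sorted (hp c w)"
proof (induction c w rule: hp.induct)
  case (3 c b w)
  then show ?case using hp_bounds[of _ c w] by (auto simp: sorted_append)
qed auto

lemma hp_above:
  "ht l w \<noteq> None \<Longrightarrow> q < sum_list (pops w) \<Longrightarrow> c + q < hp c w ! q + l"
proof (induction c w arbitrary: l q rule: hp.induct)
  case (2 c a w)
  from 2(1)[of "l + a" q] 2(2,3) show ?case by (auto split: if_splits)
next
  case (3 c b w)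
  show ?case
  proof (cases "q < b")
    case True
    then show ?thesis using 3 by (auto simp: nth_append split: if_splits)
  next
    case False
    have l: "b \<le> l" "ht (l - b) w \<noteq> None" using 3(2) by (auto split: if_splits)
    have "q - b < sum_list (pops w)" using 3(3) False by simp
    from 3(1)[OF l(2) this] show ?thesis using False l(1) by (simp add: nth_append)
  qed
qed auto

lemma shape_word:
  assumes "well_formed w"
  shows "shape (nth (hp 0 w)) (push_total w)"
proof -
  have n: "push_total w = sum_list (pops w)" "ht 0 w = Some 0"
    using assms ht_total[of 0 w 0] by (auto simp: well_formed_ht push_total_eq)
  show ?thesis
  proof
    fix q q' assume "q \<le> q'" "q' < push_total w"
    then show "hp 0 w ! q \<le> hp 0 w ! q'" using n by (simp add: sorted_nth_mono[OF hp_sorted])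
  next
    fix q assume "q < push_total w"
    then show "q < hp 0 w ! q" using hp_above[of 0 w q 0] n by simp
  next
    fix q assume "q < push_total w"
    then show "hp 0 w ! q \<le> push_total w"
      using hp_bounds[of "hp 0 w ! q" 0 w] n by (auto simp: push_total_eq)
  qed
qed

lemma hp_split:
  "q < sum_list (pops w) \<Longrightarrow> \<exists>y b z. w = y @ Pop b # z \<and> sum_list (pops y) \<le> q \<and>
     q < sum_list (pops y) + b \<and> hp c w ! q = c + sum_list (pushes y)"
proof (induction c w arbitrary: q rule: hp.induct)
  case (2 c a w)
  then have "q < sum_list (pops w)" by simp
  from 2(1)[OF this] obtain y b z where "w = y @ Pop b # z" "sum_list (pops y) \<le> q"
     "q < sum_list (pops y) + b" "hp (c + a) w ! q = c + a + sum_list (pushes y)" by blast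
  then have "Push a # w = (Push a # y) @ Pop b # z \<and> sum_list (pops (Push a # y)) \<le> q \<and>
     q < sum_list (pops (Push a # y)) + b \<and> hp c (Push a # w) ! q = c + sum_list (pushes (Push a # y))" by simp
  then show ?case by blast
next
  case (3 c b w)
  show ?case
  proof (cases "q < b")
    case True
    then have "Pop b # w = [] @ Pop b # w \<and> sum_list (pops []) \<le> q \<and>
       q < sum_list (pops []) + b \<and> hp c (Pop b # w) ! q = c + sum_list (pushes [])"
      by (simp add: nth_append)
    then show ?thesis by blast
  next
    case False
    then have "q - b < sum_list (pops w)" using 3(2) by simp
    from 3(1)[OF this] obtain y b' z where "w = y @ Pop b' # z" "sum_list (pops y) \<le> q - b"
     "q - b < sum_list (pops y) + b'" "hp c w ! (q - b) = c + sum_list (pushes y)" by blast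
    then have "Pop b # w = (Pop b # y) @ Pop b' # z \<and> sum_list (pops (Pop b # y)) \<le> q \<and>
       q < sum_list (pops (Pop b # y)) + b' \<and> hp c (Pop b # w) ! q = c + sum_list (pushes (Pop b # y))"
      using False by (simp add: nth_append) linarith
    then show ?thesis by blast
  qed
qed auto

lemma hp_nth_block:
  "sum_list (pops y) \<le> q \<Longrightarrow> q < sum_list (pops y) + b \<Longrightarrow> hp c (y @ Pop b # z) ! q = c + sum_list (pushes y)"
  by (auto simp: hp_append nth_append)

text \<open>A pop happens between push operations, never inside one.\<close>

lemma cut_hp:
  assumes "q < sum_list (pops w)"
  shows "is_cut (lay (pushes w)) (hp 0 w ! q)"
proof -
  obtain y b z where "w = y @ Pop b # z" "hp 0 w ! q = 0 + sum_list (pushes y)"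
    using hp_split[OF assms] by blast
  then show ?thesis using lay_cut[of "pushes y" "pushes z"] by simp
qed

text \<open>The involution moves a unit pop only within its own operation, during which nothing is
  pushed.\<close>

lemma hp_lay_pops:
  assumes "q < sum_list (pops w)"
  shows "hp 0 w ! lay (pops w) q = hp 0 w ! q"
proof -
  obtain y b z where y: "w = y @ Pop b # z" "sum_list (pops y) \<le> q"
     "q < sum_list (pops y) + b" "hp 0 w ! q = 0 + sum_list (pushes y)"
    using hp_split[OF assms] by blast
  have "lay (pops w) q = sum_list (pops y) + (b - 1 - (q - sum_list (pops y)))"
    using y(2,3) unfolding y(1) by (auto simp: lay_append)
  then show ?thesis using y hp_nth_block[of y "lay (pops w) q" b 0 z] by simp
qed

text \<open>The first unit pop of a run directly follows a push, and reducedness gives both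
  operations size 1, so each is a part of its own.\<close>

lemma peak:
  assumes wf: "well_formed w" and red: "reduced w" and q: "q < sum_list (pops w)"
    and pk: "q = 0 \<or> hp 0 w ! (q - 1) < hp 0 w ! q"
  shows "is_cut (lay (pushes w)) (hp 0 w ! q - 1)" "lay (pushes w) (hp 0 w ! q - 1) = hp 0 w ! q - 1"
    "is_cut (lay (pops w)) q" "is_cut (lay (pops w)) (Suc q)" "lay (pops w) q = q"
proof -
  obtain y b z where y: "w = y @ Pop b # z" "sum_list (pops y) \<le> q"
     "q < sum_list (pops y) + b" "hp 0 w ! q = 0 + sum_list (pushes y)"
    using hp_split[OF q] by blast
  have qy: "q = sum_list (pops y)"
  proof (rule ccontr)
    assume "q \<noteq> sum_list (pops y)"
    then have "hp 0 w ! (q - 1) = 0 + sum_list (pushes y)" "q \<noteq> 0"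
      using y hp_nth_block[of y "q - 1" b 0 z] by auto
    then show False using pk y(4) by simp
  qed
  have hy: "ht 0 (y @ Pop b # z) = Some 0" using wf y(1) by (simp add: well_formed_ht)
  have "\<exists>a y'. y = y' @ [Push a]"
  proof (cases y rule: rev_cases)
    case Nil
    then show ?thesis using hy by (auto split: if_splits)
  next
    case (snoc y' x)
    show ?thesis
    proof (cases x)
      case (Pop b')
      have b': "1 \<le> b'" using ht_ops_pos[OF hy, of "Pop b'"] snoc Pop by auto
      have "w = y' @ Pop b' # (Pop b # z)" using y(1) snoc Pop by simp
      moreover have "hp 0 (y' @ Pop b' # (Pop b # z)) ! (q - 1) = 0 + sum_list (pushes y')"
        by (rule hp_nth_block) (use qy snoc Pop b' in auto)
      ultimately show ?thesis using pk y(4) snoc Pop b' qy by auto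
    qed (use snoc in auto)
  qed
  then obtain a y' where y': "y = y' @ [Push a]" by blast
  then have "w = y' @ Push a # Pop b # z" using y(1) by simp
  then have ab: "a = 1" "b = 1" using red unfolding reduced_split by blast+
  have P: "pushes w = pushes y' @ 1 # pushes z" and Q: "pops w = pops y @ 1 # pops z"
    and h: "hp 0 w ! q - 1 = sum_list (pushes y')"
    using y y' ab by auto
  show "is_cut (lay (pushes w)) (hp 0 w ! q - 1)" "lay (pushes w) (hp 0 w ! q - 1) = hp 0 w ! q - 1"
    unfolding P h by (rule lay_cut) (simp add: lay_append)
  show "is_cut (lay (pops w)) q" "lay (pops w) q = q"
    unfolding Q qy by (rule lay_cut) (simp add: lay_append)
  show "is_cut (lay (pops w)) (Suc q)"
    using lay_cut[of "pops y @ [1]" "pops z"] unfolding Q qy by simp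
qed

section \<open>Running a word on node numbers\<close>

text \<open>A block is treated as a series of unit pushes, which reverse it on the stack. The two
  layered involutions in \<open>exec_npo\<close> make up for the difference from the true
  run.\<close>

fun nrun :: "nat \<Rightarrow> nat list \<Rightarrow> op list \<Rightarrow> nat list" where
  "nrun c ns [] = ns"
| "nrun c ns (Push a # w) = nrun (c + a) (rev [c..<c + a] @ ns) w"
| "nrun c ns (Pop b # w) = nrun c (drop b ns) w"

fun npo :: "nat \<Rightarrow> nat list \<Rightarrow> op list \<Rightarrow> nat list" where
  "npo c ns [] = []"
| "npo c ns (Push a # w) = npo (c + a) (rev [c..<c + a] @ ns) w"
| "npo c ns (Pop b # w) = take b ns @ npo c (drop b ns) w"

lemma nrun_append: "nrun c ns (x @ y) = nrun (c + sum_list (pushes x)) (nrun c ns x) y"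
  by (induction c ns x rule: nrun.induct) (auto simp: algebra_simps)

lemma npo_append: "npo c ns (x @ y) = npo c ns x @ npo (c + sum_list (pushes x)) (nrun c ns x) y"
  by (induction c ns x rule: nrun.induct) (auto simp: algebra_simps)

lemma length_nrun: "ht (length ns) w = Some l \<Longrightarrow> length (nrun c ns w) = l"
  by (induction c ns w rule: nrun.induct) (auto split: if_splits simp: add.commute)

lemma length_npo: "ht (length ns) w = Some l \<Longrightarrow> length (npo c ns w) = sum_list (pops w)"
  by (induction c ns w rule: nrun.induct) (auto split: if_splits simp: add.commute)

lemma nrun_map_Push: "nrun c ns (map Push A) = rev [c..<c + sum_list A] @ ns"
proof (induction A arbitrary: c ns)
  case (Cons a A)
  have "[c..<c + (a + sum_list A)] = [c..<c + a] @ [c + a..<c + a + sum_list A]"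
    using upt_add_eq_append[of c "c + a" "sum_list A"] by (simp add: add.assoc)
  then show ?case using Cons[of "c + a" "rev [c..<c + a] @ ns"] by simp
qed simp

lemma nrun_subset: "set (nrun c ns w) \<subseteq> set ns \<union> {c..<c + sum_list (pushes w)}"
proof (induction c ns w rule: nrun.induct)
  case (2 c ns a w)
  then show ?case by fastforce
next
  case (3 c ns b w)
  then show ?case using set_drop_subset[of b ns] by fastforce
qed auto

text \<open>An element below the top can be uncovered only by a word that returns to its height,
  and once popped it never reappears.\<close>
lemma nrun_uncover:
  "ht (length X + Suc (length rest)) v = Some l \<Longrightarrow> i \<notin> set X \<Longrightarrow> i \<notin> set rest \<Longrightarrow> i < c \<Longrightarrow>
   nrun c (X @ i # rest) v \<noteq> [] \<Longrightarrow> hd (nrun c (X @ i # rest) v) = i \<Longrightarrow> ht (length X) v = Some 0"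
proof (induction v arbitrary: X c rule: pushes.induct)
  case 1
  then show ?case by (cases X) auto
next
  case (2 a w)
  have "ht (length (rev [c..<c + a] @ X)) w = Some 0"
  proof (rule 2(1)[where c = "c + a"])
    have "1 \<le> a" "ht (length X + Suc (length rest) + a) w = Some l" using 2(2) by (auto split: if_splits)
    then show "ht (length (rev [c..<c + a] @ X) + Suc (length rest)) w = Some l"
      by (simp add: add.commute add.left_commute)
  qed (use 2(3-) in auto)
  then show ?case using 2(2) by (simp add: add.commute split: if_splits)
next
  case (3 b w)
  show ?case
  proof (cases "b \<le> length X")
    case True
    have "ht (length (drop b X)) w = Some 0"
    proof (rule 3(1)[where c = c])
      show "i \<notin> set (drop b X)" using 3(3) by (meson in_set_dropD)
      have "ht (length X + Suc (length rest) - b) w = Some l" using 3(2) by (auto split: if_splits)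
      moreover have "length X + Suc (length rest) - b = length (drop b X) + Suc (length rest)"
        using True by simp
      ultimately show "ht (length (drop b X) + Suc (length rest)) w = Some l" by simp
    qed (use 3(4-) True in auto)
    then show ?thesis using 3(2) True by (auto split: if_splits)
  next
    case False
    then have "b - length X = Suc (b - Suc (length X))" by simp
    then have "nrun c (X @ i # rest) (Pop b # w) = nrun c (drop (b - Suc (length X)) rest) w"
      using False by (simp add: drop_append)
    then have "i \<in> set (nrun c (drop (b - Suc (length X)) rest) w)"
      using 3(6,7) by (metis list.set_sel(1))
    then have "i \<in> set (drop (b - Suc (length X)) rest)"
      using nrun_subset[of c "drop (b - Suc (length X)) rest" w] 3(5) by auto
    then show ?thesis using 3(4) by (meson in_set_dropD)
  qed
qed

text \<open>A form of \<open>st\<close> with an arbitrary starting stack, so that it can follow the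
  recursion of \<open>hp\<close> along the word.\<close>

fun sts :: "nat \<Rightarrow> nat list \<Rightarrow> nat list \<Rightarrow> nat list list" where
  "sts c ns [] = []"
| "sts c ns (x # xs) = (rev [c..<x] @ ns) # sts x (tl (rev [c..<x] @ ns)) xs"

text \<open>The nodes missing at the next pop are supplied then in any case, so pushing some of them
  earlier changes nothing.\<close>

lemma sts_push: "xs = [] \<or> c + a \<le> hd xs \<Longrightarrow> sts (c + a) (rev [c..<c + a] @ ns) xs = sts c ns xs"
proof (cases xs)
  case (Cons x ys)
  assume "xs = [] \<or> c + a \<le> hd xs"
  then have "[c..<x] = [c..<c + a] @ [c + a..<x]"
    using Cons upt_add_eq_append[of c "c + a" "x - (c + a)"] by simp
  then show ?thesis using Cons by simp
qed simp

lemma sts_pop: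
  "b \<le> length ns \<Longrightarrow> map hd (sts c ns (replicate b c @ xs)) = take b ns @ map hd (sts c (drop b ns) xs)"
proof (induction b arbitrary: ns)
  case (Suc b)
  then obtain y ys where "ns = y # ys" by (cases ns) auto
  then show ?case using Suc by simp
qed simp

lemma npo_sts: "ht (length ns) w \<noteq> None \<Longrightarrow> npo c ns w = map hd (sts c ns (hp c w))"
proof (induction c ns w rule: npo.induct)
  case (2 c ns a w)
  have "hp (c + a) w = [] \<or> c + a \<le> hd (hp (c + a) w)"
    using hp_bounds[of "hd (hp (c + a) w)" "c + a" w] by (cases "hp (c + a) w") auto
  then show ?case using 2 sts_push[of "hp (c + a) w" c a ns] by (auto split: if_splits simp: add.commute)
next
  case (3 c ns b w)
  then show ?case by (auto split: if_splits simp: sts_pop)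
qed auto

lemma sts_nth:
  "Suc q < length xs \<Longrightarrow> sts c ns xs ! Suc q = rev [xs ! q..<xs ! Suc q] @ tl (sts c ns xs ! q)"
proof (induction q arbitrary: c ns xs)
  case 0
  then obtain x y ys where "xs = x # y # ys" by (cases xs; cases "tl xs") auto
  then show ?case by simp
next
  case (Suc q)
  then obtain x ys where "xs = x # ys" by (cases xs) auto
  then show ?case using Suc by simp
qed

lemma length_sts [simp]: "length (sts c ns xs) = length xs"
  by (induction c ns xs rule: sts.induct) auto

lemma sts_st: "q < length xs \<Longrightarrow> sts 0 [] xs ! q = st (nth xs) q"
proof (induction q)
  case 0
  then show ?case by (cases xs) auto
next
  case (Suc q)
  then show ?case by (simp add: sts_nth)
qed

lemma npo_pn:
  assumes "well_formed w"
  shows "npo 0 [] w = map (pn (nth (hp 0 w))) [0..<push_total w]"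
proof -
  have n: "push_total w = sum_list (pops w)" "ht 0 w = Some 0"
    using assms ht_total[of 0 w 0] by (auto simp: well_formed_ht push_total_eq)
  then show ?thesis using npo_sts[of "[]" w 0] by (auto intro!: nth_equalityI simp: sts_st)
qed

text \<open>Node i carries the input element at position \<open>lay (pushes w) i\<close>.\<close>
lemma exec_npo:
  "ht (length ns) w \<noteq> None \<Longrightarrow> sum_list (pushes w) \<le> length inp \<Longrightarrow>
   \<forall>i<sum_list (pushes w). f (c + i) = inp ! lay (pushes w) i \<Longrightarrow>
   fold exec_op w (inp, map f ns, out) =
     (drop (sum_list (pushes w)) inp, map f (nrun c ns w), blk (pops w) (map f (npo c ns w)) @ out)"
proof (induction c ns w arbitrary: inp out rule: npo.induct)
  case (2 c ns a w)
  have tk: "take a inp = map f (rev [c..<c + a])"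
  proof (rule nth_equalityI)
    fix j assume j: "j < length (take a inp)"
    then have "f (c + (a - 1 - j)) = inp ! (a - 1 - (a - 1 - j))"
      using 2(4)[rule_format, of "a - 1 - j"] by auto
    then show "take a inp ! j = map f (rev [c..<c + a]) ! j"
      using j by (simp add: rev_nth)
  qed (use 2(3) in simp)
  have "f (c + a + i) = drop a inp ! lay (pushes w) i" if "i < sum_list (pushes w)" for i
    using 2(4)[rule_format, of "a + i"] that 2(3) by (simp add: add.assoc)
  then show ?case using 2 tk by (auto simp: add.commute split: if_splits)
next
  case (3 c ns b w)
  then have b: "b \<le> length ns" "ht (length ns - b) w \<noteq> None" by (auto split: if_splits)
  have IH: "fold exec_op w (inp, map f (drop b ns), take b (map f ns) @ out) =
      (drop (sum_list (pushes w)) inp, map f (nrun c (drop b ns) w),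
        blk (pops w) (map f (npo c (drop b ns) w)) @ take b (map f ns) @ out)"
    using 3(1)[of inp "take b (map f ns) @ out"] b 3(3,4) by auto
  have "blk (b # pops w) (map f (take b ns) @ map f (npo c (drop b ns) w)) =
      blk (pops w) (map f (npo c (drop b ns) w)) @ map f (take b ns)"
    using b by simp
  then show ?case using IH by (simp add: drop_map take_map)
qed auto

text \<open>The permutation is that of the unit steps with one layered involution on either side;
  comparisons of words go through this formula.\<close>

lemma produced_perm_nth:
  assumes wf: "well_formed w" and q: "q < push_total w"
  shows "rev (produced_perm w) ! lay (pops w) q = Suc (lay (pushes w) (pn (nth (hp 0 w)) q))"
    and "length (produced_perm w) = push_total w"
proof -
  let ?n = "push_total w" and ?f = "\<lambda>i. Suc (lay (pushes w) i)"
  have n: "?n = sum_list (pops w)" "?n = sum_list (pushes w)" "ht 0 w = Some 0"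
    using wf ht_total[of 0 w 0] by (auto simp: well_formed_ht push_total_eq)
  have "fold exec_op w ([1..<?n + 1], map ?f [], []) =
     (drop (sum_list (pushes w)) [1..<?n + 1], map ?f (nrun 0 [] w), blk (pops w) (map ?f (npo 0 [] w)) @ [])"
    by (rule exec_npo) (use n lay_less[of _ "pushes w"] in \<open>auto simp del: upt_Suc\<close>)
  then have P: "produced_perm w = blk (pops w) (map ?f (npo 0 [] w))"
    unfolding produced_perm_def by (simp del: upt_Suc)
  have l: "length (map ?f (npo 0 [] w)) = sum_list (pops w)"
    using length_npo[of "[]" w 0] n by simp
  show "length (produced_perm w) = ?n" unfolding P using length_blk[OF l] n by simp
  have "lay (pops w) q < sum_list (pops w)" using lay_less q n by simp
  from nth_rev_blk[OF l this]
  show "rev (produced_perm w) ! lay (pops w) q = Suc (lay (pushes w) (pn (nth (hp 0 w)) q))"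
    unfolding P using layered_invol[of "lay (pops w)" q] q npo_pn[OF wf] by simp
qed

section \<open>From cuts to nested factors of a word\<close>

lemma pops_split:
  "pops w = B1 @ b # B2 \<Longrightarrow> \<exists>y z. w = y @ Pop b # z \<and> pops y = B1 \<and> pops z = B2"
proof (induction w arbitrary: B1 rule: pops.induct)
  case (2 a w)
  then obtain y z where "w = y @ Pop b # z" "pops y = B1" "pops z = B2" by fastforce
  then have "Push a # w = (Push a # y) @ Pop b # z \<and> pops (Push a # y) = B1 \<and> pops z = B2" by simp
  then show ?case by blast
next
  case (3 b' w)
  show ?case
  proof (cases B1)
    case Nil
    then have "Pop b' # w = [] @ Pop b # w \<and> pops [] = B1 \<and> pops w = B2" using 3(2) by simp
    then show ?thesis by blast
  next
    case (Cons x B1')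
    then have "pops w = B1' @ b # B2" using 3(2) by simp
    from 3(1)[OF this] obtain y z where "w = y @ Pop b # z" "pops y = B1'" "pops z = B2" by blast
    then have "Pop b' # w = (Pop b' # y) @ Pop b # z \<and> pops (Pop b' # y) = B1 \<and> pops z = B2"
      using Cons 3(2) by simp
    then show ?thesis by blast
  qed
qed simp

lemma pushes_split:
  "pushes w = B1 @ b # B2 \<Longrightarrow> \<exists>y z. w = y @ Push b # z \<and> pushes y = B1 \<and> pushes z = B2"
proof (induction w arbitrary: B1 rule: pushes.induct)
  case (3 a w)
  then obtain y z where "w = y @ Push b # z" "pushes y = B1" "pushes z = B2" by fastforce
  then have "Pop a # w = (Pop a # y) @ Push b # z \<and> pushes (Pop a # y) = B1 \<and> pushes z = B2" by simp
  then show ?case by blast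
next
  case (2 b' w)
  show ?case
  proof (cases B1)
    case Nil
    then have "Push b' # w = [] @ Push b # w \<and> pushes [] = B1 \<and> pushes w = B2" using 2(2) by simp
    then show ?thesis by blast
  next
    case (Cons x B1')
    then have "pushes w = B1' @ b # B2" using 2(2) by simp
    from 2(1)[OF this] obtain y z where "w = y @ Push b # z" "pushes y = B1'" "pushes z = B2" by blast
    then have "Push b' # w = (Push b' # y) @ Push b # z \<and> pushes (Push b' # y) = B1 \<and> pushes z = B2"
      using Cons 2(2) by simp
    then show ?thesis by blast
  qed
qed simp

lemma lay_cut_append: "is_cut (lay (A @ B)) (sum_list A + k) \<Longrightarrow> is_cut (lay B) k"
  unfolding is_cut_def
proof
  fix i assume "\<forall>i. (lay (A @ B) i < sum_list A + k) = (i < sum_list A + k)"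
  from this[rule_format, of "sum_list A + i"] show "(lay B i < k) = (i < k)"
    by (simp add: lay_append)
qed

text \<open>The cut keeps \<open>k\<close> from splitting a pop, and the constant height keeps
  pushes out.\<close>

lemma leading_pops:
  "is_cut (lay (pops r)) k \<Longrightarrow> k \<le> sum_list (pops r) \<Longrightarrow> \<forall>x\<in>set r. 1 \<le> op_size x \<Longrightarrow>
   \<forall>j<k. hp c r ! j = c \<Longrightarrow> \<exists>B z. r = map Pop B @ z \<and> sum_list B = k"
proof (induction r arbitrary: k rule: pops.induct)
  case 1
  then show ?case by simp
next
  case (2 a w)
  show ?case
  proof (cases "k = 0")
    case False
    then have "hp (c + a) w ! 0 \<in> set (hp (c + a) w)" using 2(3) by (intro nth_mem) simp
    then have "c + a \<le> hp (c + a) w ! 0" using hp_bounds by blast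
    then show ?thesis using 2(4,5) False by (auto dest: spec[of _ 0])
  qed (auto intro: exI[of _ "[]"])
next
  case (3 b w)
  show ?case
  proof (cases "k = 0")
    case False
    have bk: "b \<le> k" using cut_less[OF 3(2), of 0] False by (cases "b = 0") auto
    have "is_cut (lay (pops w)) (k - b)" using lay_cut_append[of "[b]" "pops w" "k - b"] 3(2) bk by (simp del: lay.simps)
    moreover have "k - b \<le> sum_list (pops w)" using 3(3) by simp
    moreover have "\<forall>x\<in>set w. 1 \<le> op_size x" using 3(4) by simp
    moreover have "\<forall>j<k - b. hp c w ! j = c"
    proof (intro allI impI)
      fix j assume "j < k - b"
      then show "hp c w ! j = c" using 3(5)[rule_format, of "b + j"] by (simp add: nth_append)
    qed
    ultimately have "\<exists>B z. w = map Pop B @ z \<and> sum_list B = k - b" by (rule 3(1))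
    then obtain B z where "w = map Pop B @ z" "sum_list B = k - b" by blast
    then have "Pop b # w = map Pop (b # B) @ z \<and> sum_list (b # B) = k" using bk by simp
    then show ?thesis by blast
  qed (auto intro: exI[of _ "[]"])
qed

text \<open>The cut keeps \<open>k\<close> from splitting a push, and the absence of heights
  strictly between \<open>c\<close> and \<open>c + k\<close> keeps pops out. A pop at height
  \<open>c\<close> itself is ruled out by starting with a push.\<close>

lemma leading_pushes:
  "is_cut (lay (pushes r)) k \<Longrightarrow> k \<le> sum_list (pushes r) \<Longrightarrow> \<forall>x\<in>set r. 1 \<le> op_size x \<Longrightarrow>
   \<forall>x\<in>set (hp c r). \<not> (c < x \<and> x < c + k) \<Longrightarrow> r = Push a # r' \<Longrightarrow>
   \<exists>A z. r = map Push A @ z \<and> sum_list A = k"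
proof (induction r arbitrary: k c a r')
  case Nil
  then show ?case by simp
next
  case (Cons x r)
  show ?case
  proof (cases "k = 0")
    case False
    have x: "x = Push a" "r = r'" using Cons.prems(5) by auto
    have ak: "a \<le> k" using cut_less[OF Cons.prems(1), of 0] False x by (cases "a = 0") auto
    show ?thesis
    proof (cases "a = k")
      case True
      then have "x # r = map Push [a] @ r \<and> sum_list [a] = k" using x by simp
      then show ?thesis by blast
    next
      case ne: False
      have a1: "1 \<le> a" using Cons.prems(3) x by auto
      have r: "is_cut (lay (pushes r)) (k - a)"
        using lay_cut_append[of "[a]" "pushes r" "k - a"] Cons.prems(1) ak x by (simp del: lay.simps)
      have rk: "k - a \<le> sum_list (pushes r)" using Cons.prems(2) x by simp
      have hr: "\<forall>y\<in>set (hp (c + a) r). \<not> (c < y \<and> y < c + k)" using Cons.prems(4) x by simp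
      have "\<exists>a' r''. r = Push a' # r''"
      proof (cases r)
        case Nil
        then show ?thesis using rk ne ak by simp
      next
        case (Cons y r'')
        then show ?thesis
        proof (cases y)
          case (Pop b)
          then have "1 \<le> b" using Cons.prems(3) Cons by auto
          then have "c + a \<in> set (hp (c + a) r)" using Cons Pop by simp
          then show ?thesis using hr a1 ne ak by auto
        qed auto
      qed
      then obtain a' r'' where r'': "r = Push a' # r''" by blast
      have "\<exists>A z. r = map Push A @ z \<and> sum_list A = k - a"
        by (rule Cons.IH[OF r rk _ _ r'', of "c + a"]) (use Cons.prems(3) hr ak in auto)
      then obtain A z where "r = map Push A @ z" "sum_list A = k - a" by blast
      then have "x # r = map Push (a # A) @ z \<and> sum_list (a # A) = k" using x ak by simp
      then show ?thesis by blast
    qed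
  qed (auto intro: exI[of _ "[]"])
qed

text \<open>The four cuts allow whole operations to be separated. By \<open>top\<close> the highest
  of the \<open>k\<close> nodes is exposed again when pop \<open>q\<close> starts, so everything in
  between has returned to its height; by \<open>inner\<close> something was pushed in
  between.\<close>

lemma nested_factor:
  fixes w :: "op list"
  defines "h \<equiv> nth (hp 0 w)"
  assumes wf: "well_formed w" and k: "0 < k"
    and q: "is_cut (lay (pops w)) q" "is_cut (lay (pops w)) (q + k)" "q + k \<le> push_total w"
      "\<And>j. j < k \<Longrightarrow> h (q + j) = h q"
    and i: "is_cut (lay (pushes w)) i" "is_cut (lay (pushes w)) (i + k)"
      "\<And>q. q < push_total w \<Longrightarrow> \<not> (i < h q \<and> h q < i + k)"
    and top: "pn h q = i + k - 1" and inner: "h q \<noteq> i + k"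
  shows "\<exists>u A v B z. w = u @ map Push A @ v @ map Pop B @ z \<and> v \<noteq> [] \<and> well_formed v \<and>
    sum_list A = k \<and> sum_list B = k \<and> sum_list (pushes u) = i \<and> sum_list (pops (u @ map Push A @ v)) = q"
proof -
  interpret shape h "push_total w" unfolding h_def by (rule shape_word[OF wf])
  have n: "push_total w = sum_list (pops w)" "push_total w = sum_list (pushes w)" and ht: "ht 0 w = Some 0"
    using wf ht_total[of 0 w 0] by (auto simp: well_formed_ht push_total_eq)
  have pos: "\<forall>x\<in>set w. 1 \<le> op_size x" using ht_ops_pos[OF ht] by blast
  have qn: "q < push_total w" using q(3) k by simp
  have ik: "i + k \<le> h q" using pn_less[OF qn] top k by auto
  obtain B1 B2 where B12: "pops w = B1 @ B2" "sum_list B1 = q"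
    using lay_cut_split[OF q(1)] qn n by auto
  then obtain b B2' where "B2 = b # B2'" using qn n by (cases B2) auto
  then obtain y z0 where y: "w = y @ Pop b # z0" "pops y = B1"
    using pops_split[of w B1 b B2'] B12 by auto
  let ?r = "Pop b # z0"
  have py: "sum_list (pops y) = q" using y B12 by simp
  have b1: "1 \<le> b" using pos y by auto
  have hq: "h q = sum_list (pushes y)"
    using hp_nth_block[of y q b 0 z0] y(1) py b1 unfolding h_def by simp
  have "\<exists>B z. ?r = map Pop B @ z \<and> sum_list B = k"
  proof (rule leading_pops[where c = "h q"])
    show "is_cut (lay (pops ?r)) k"
      by (rule lay_cut_append[of "pops y"]) (use q(2) y(1) py in simp)
    show "k \<le> sum_list (pops ?r)" using q(3) n py y(1) by simp
    show "\<forall>x\<in>set ?r. 1 \<le> op_size x" using pos y(1) by auto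
    show "\<forall>j<k. hp (h q) ?r ! j = h q"
    proof (intro allI impI)
      fix j assume "j < k"
      have "hp 0 w = hp 0 y @ hp (h q) ?r" using y(1) hq by (simp add: hp_append)
      then have "hp 0 w ! (q + j) = hp (h q) ?r ! j" using py by (simp add: nth_append)
      then show "hp (h q) ?r ! j = h q" using q(4)[OF \<open>j < k\<close>] unfolding h_def by simp
    qed
  qed
  then obtain B z where B: "?r = map Pop B @ z" "sum_list B = k" by blast
  obtain A1 A2 where A12: "pushes w = A1 @ A2" "sum_list A1 = i"
    using lay_cut_split[OF i(1)] ik below[OF qn] n by auto
  then obtain a A2' where "A2 = a # A2'" using ik k below[OF qn] n by (cases A2) auto
  then obtain u x where u: "w = u @ Push a # x" "pushes u = A1"
    using pushes_split[of w A1 a A2'] A12 by auto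
  let ?R = "Push a # x"
  have pu: "sum_list (pushes u) = i" using u A12 by simp
  have "\<exists>A v0. ?R = map Push A @ v0 \<and> sum_list A = k"
  proof (rule leading_pushes[where c = i])
    show "is_cut (lay (pushes ?R)) k"
      by (rule lay_cut_append[of "pushes u"]) (use i(2) u(1) pu in simp)
    show "k \<le> sum_list (pushes ?R)" using ik below[OF qn] n pu u(1) by simp
    show "\<forall>x\<in>set ?R. 1 \<le> op_size x" using pos u(1) by auto
    have "hp 0 w = hp 0 u @ hp i ?R" using u(1) pu by (simp add: hp_append)
    then have "set (hp i ?R) \<subseteq> set (hp 0 w)" by simp
    moreover have "\<not> (i < x \<and> x < i + k)" if "x \<in> set (hp 0 w)" for x
      using that i(3) n unfolding h_def by (auto simp: in_set_conv_nth)
    ultimately show "\<forall>x\<in>set (hp i ?R). \<not> (i < x \<and> x < i + k)" by blast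
  qed simp
  then obtain A v0 where A: "?R = map Push A @ v0" "sum_list A = k" by blast
  have eq: "(u @ map Push A) @ v0 = y @ ?r" using u(1) A(1) y(1) by simp
  \<comment> \<open>If pop \<open>q\<close> began before the end of \<open>u @ map Push A\<close>,
    at most \<open>i + k\<close> elements would precede it, hence exactly \<open>i + k\<close>,
    against \<open>inner\<close>.\<close>
  have "\<exists>v. y = (u @ map Push A) @ v"
  proof -
    consider us where "u @ map Push A = y @ us" "us @ v0 = ?r" "us \<noteq> []" | us where "y = (u @ map Push A) @ us"
    proof -
      obtain us where "u @ map Push A = y @ us \<and> us @ v0 = ?r \<or> (u @ map Push A) @ us = y \<and> v0 = us @ ?r"
        using eq unfolding append_eq_append_conv2 by blast
      then show thesis using that(1)[of us] that(2)[of us] that(2)[of "[]"] by (cases us) auto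
    qed
    then show ?thesis
    proof cases
      case 1
      then obtain us' where "us = Pop b # us'" by (cases us) auto
      then have uy: "u @ map Push A = y @ Pop b # us'" using 1 by simp
      have "sum_list (pushes (u @ map Push A)) = i + k" using pu A(2) by simp
      moreover have "sum_list (pushes (u @ map Push A)) = sum_list (pushes y) + sum_list (pushes us')"
        unfolding uy by simp
      ultimately have "sum_list (pushes y) = i + k" using hq ik by linarith
      then show ?thesis using hq inner by simp
    qed blast
  qed
  then obtain v where v: "y = (u @ map Push A) @ v" by blast
  have v0: "v \<noteq> []"
  proof
    assume "v = []"
    then have "h q = i + k" using hq v pu A(2) by simp
    then show False using inner by simp
  qed
  \<comment> \<open>The node \<open>i + k - 1\<close> is on top both before and after
    \<open>v\<close>; \<open>nrun_uncover\<close> with empty \<open>X\<close> turns this into a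
    return to height 0.\<close>
  have "well_formed v"
  proof -
    obtain l where l: "ht 0 y = Some l" "ht l ?r = Some 0" using ht unfolding y(1) ht_append_Some by blast
    have b: "b \<le> l" using l(2) by (auto split: if_splits)
    let ?ns = "nrun 0 [] y"
    have lns: "length ?ns = l" using length_nrun[of "[]" y l 0] l(1) by simp
    have ne: "?ns \<noteq> []" using lns b b1 by auto
    have "npo 0 [] w = npo 0 [] y @ take b ?ns @ npo (0 + sum_list (pushes y)) (drop b ?ns) z0"
      unfolding y(1) npo_append by simp
    moreover have "length (npo 0 [] y) = q" using length_npo[of "[]" y l 0] l(1) py by simp
    ultimately have "npo 0 [] w ! q = hd ?ns"
      using ne b1 lns b by (auto simp: nth_append hd_conv_nth)
    then have top': "hd ?ns = i + k - 1" using npo_pn[OF wf] qn top unfolding h_def by simp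
    let ?u = "u @ map Push A" and ?i = "i + k - 1"
    obtain l1 where l1: "ht 0 ?u = Some l1" "ht l1 v = Some l" using l(1) unfolding v ht_append_Some[of 0 ?u] by blast
    let ?rest = "rev [i..<?i] @ nrun 0 [] u"
    have ru: "nrun 0 [] ?u = ?i # ?rest"
    proof -
      have "nrun 0 [] ?u = rev [i..<i + k] @ nrun 0 [] u" unfolding nrun_append nrun_map_Push using pu A(2) by simp
      moreover have "[i..<i + k] = [i..<?i] @ [?i]" using k by (cases k) auto
      ultimately show ?thesis by simp
    qed
    have lr: "Suc (length ?rest) = l1"
      using length_nrun[of "[]" ?u l1 0] l1(1) ru by simp
    have rs: "nrun (i + k) ([] @ ?i # ?rest) v = ?ns"
      unfolding v nrun_append[of 0 "[]" ?u] ru using pu A(2) by simp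
    have "?i \<notin> set (nrun 0 [] u)" using nrun_subset[of 0 "[]" u] pu k by auto
    then have "ht (length ([] :: nat list)) v = Some 0"
      by (intro nrun_uncover[where i = ?i and c = "i + k" and rest = ?rest and l = l])
        (use l1 lr rs ne top' k in auto)
    then show ?thesis by (simp add: well_formed_ht)
  qed
  moreover have "w = u @ map Push A @ v @ map Pop B @ z" using y(1) v B(1) by simp
  ultimately show ?thesis using v0 A(2) B(2) pu py v by (metis append.assoc)
qed

section \<open>Change of coordinates\<close>

text \<open>Moves the origin to \<open>c\<close>. For a cut \<open>c\<close> the subtraction never
  truncates.\<close>

definition shiftL :: "nat \<Rightarrow> (nat \<Rightarrow> nat) \<Rightarrow> nat \<Rightarrow> nat" where
  "shiftL c L j = L (c + j) - c"

text \<open>Conjugation by the reversal of \<open>{..<e}\<close>, extended by the identity. It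
  serves the pops, whose order along a chain is opposite to that of the pushes.\<close>

definition flip :: "nat \<Rightarrow> (nat \<Rightarrow> nat) \<Rightarrow> nat \<Rightarrow> nat" where
  "flip e L j = (if j < e then e - 1 - L (e - 1 - j) else j)"

lemma cut_shiftL: "is_cut L c \<Longrightarrow> is_cut (shiftL c L) k \<longleftrightarrow> is_cut L (c + k)"
proof
  assume c: "is_cut L c" and k: "is_cut (shiftL c L) k"
  show "is_cut L (c + k)"
    unfolding is_cut_def
  proof
    fix i
    show "L i < c + k \<longleftrightarrow> i < c + k"
      using cut_less[OF c, of i] cut_ge[OF c, of i] k[unfolded is_cut_def shiftL_def, rule_format, of "i - c"]
      by (cases "i < c") auto
  qed
next
  assume c: "is_cut L c" and k: "is_cut L (c + k)"
  show "is_cut (shiftL c L) k"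
    unfolding is_cut_def shiftL_def
  proof
    fix i
    show "L (c + i) - c < k \<longleftrightarrow> i < k"
      using cut_ge[OF c, of "c + i"] k[unfolded is_cut_def, rule_format, of "c + i"] by auto
  qed
qed

lemma layered_shiftL:
  assumes "layered L" "is_cut L c"
  shows "layered (shiftL c L)"
    "block (shiftL c L) x y \<Longrightarrow> block L (c + x) (c + y)"
proof -
  have blk: "block (shiftL c L) (x - c) (y - c)" if "block L x y" "c \<le> x" for x y
  proof -
    have "shiftL c L j = x - c + (y - c) - 1 - j" if "x - c \<le> j" "j < y - c" for j
      using blockD(4)[OF \<open>block L x y\<close>, of "c + j"] that \<open>c \<le> x\<close> unfolding shiftL_def by auto
    then show ?thesis
      using that blockD(1-3)[OF that(1)] cut_shiftL[OF assms(2), of "x - c"] cut_shiftL[OF assms(2), of "y - c"]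
      unfolding block_def by auto
  qed
  show l: "layered (shiftL c L)"
    unfolding layered_def
  proof
    fix i
    obtain x y where b: "x \<le> c + i" "c + i < y" "block L x y" using assms(1) by (rule layered_block)
    then have "c \<le> x" using block_cut[OF b(3) assms(2)] by auto
    then have "x - c \<le> i \<and> i < y - c \<and> block (shiftL c L) (x - c) (y - c)" using b blk by auto
    then show "\<exists>x y. x \<le> i \<and> i < y \<and> block (shiftL c L) x y" by blast
  qed
  assume xy: "block (shiftL c L) x y"
  obtain x' y' where b: "x' \<le> c + x" "c + x < y'" "block L x' y'" using assms(1) by (rule layered_block)
  then have cx: "c \<le> x'" using block_cut[OF b(3) assms(2)] by auto
  have "x = x' - c" "y = y' - c"
    using block_unique[OF xy blk[OF b(3) cx], of x] blockD(1)[OF xy] b cx by auto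
  then show "block L (c + x) (c + y)" using b cx by simp
qed

lemma cut_flip: "is_cut L e \<Longrightarrow> k \<le> e \<Longrightarrow> layered L \<Longrightarrow> is_cut L (e - k) \<Longrightarrow> is_cut (flip e L) k"
  unfolding is_cut_def[of "flip e L"]
proof
  fix i assume a: "is_cut L e" "k \<le> e" "is_cut L (e - k)"
  show "flip e L i < k \<longleftrightarrow> i < k"
  proof (cases "i < e")
    case True
    have "L (e - 1 - i) < e" using cut_less[OF a(1), of "e - 1 - i"] True by simp
    then show ?thesis
      using True a(2) a(3)[unfolded is_cut_def, rule_format, of "e - 1 - i"] unfolding flip_def by auto
  next
    case False
    then show ?thesis using a unfolding flip_def by auto
  qed
qed

lemma layered_flip:
  assumes "layered L" "is_cut L e"
  shows "layered (flip e L)"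
    "block (flip e L) x y \<Longrightarrow> y \<le> e \<Longrightarrow> block L (e - y) (e - x)"
proof -
  have ce: "is_cut (flip e L) e" using cut_flip[OF assms(2) _ assms(1), of e] by simp
  have cc: "is_cut (flip e L) (e - c)" if "is_cut L c" "c \<le> e" for c
    using cut_flip[OF assms(2) _ assms(1), of "e - c"] that by simp
  have blk: "block (flip e L) (e - y) (e - x)" if b: "block L x y" "y \<le> e" for x y
  proof -
    have xy: "x < y" using blockD(1)[OF b(1)] .
    have "flip e L j = e - y + (e - x) - 1 - j" if j: "e - y \<le> j" "j < e - x" for j
    proof -
      have "L (e - 1 - j) = x + y - 1 - (e - 1 - j)"
        using blockD(4)[OF b(1), of "e - 1 - j"] j b(2) xy by auto
      then show ?thesis using j b(2) xy unfolding flip_def by auto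
    qed
    then show ?thesis
      using cc[OF blockD(3)[OF b(1)] b(2)] cc[OF blockD(2)[OF b(1)]] xy b(2) unfolding block_def by auto
  qed
  show l: "layered (flip e L)"
    unfolding layered_def
  proof
    fix i
    show "\<exists>x y. x \<le> i \<and> i < y \<and> block (flip e L) x y"
    proof (cases "i < e")
      case True
      obtain x y where b: "x \<le> e - 1 - i" "e - 1 - i < y" "block L x y" using assms(1) by (rule layered_block)
      then have "y \<le> e" using block_cut[OF b(3) assms(2)] True by auto
      then have "e - y \<le> i \<and> i < e - x \<and> block (flip e L) (e - y) (e - x)" using b blk[OF b(3)] True by auto
      then show ?thesis by blast
    next
      case False
      have "is_cut (flip e L) c" if "e \<le> c" for c
        unfolding is_cut_def
      proof
        fix j
        show "flip e L j < c \<longleftrightarrow> j < c"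
          using cut_less[OF ce, of j] that by (cases "j < e") (auto simp: flip_def)
      qed
      then have "block (flip e L) i (Suc i)" using False unfolding block_def by (auto simp: flip_def)
      then show ?thesis by (metis lessI order_refl)
    qed
  qed
  assume xy: "block (flip e L) x y" "y \<le> e"
  have x: "x < y" using blockD(1)[OF xy(1)] .
  obtain x' y' where b: "x' \<le> e - 1 - x" "e - 1 - x < y'" "block L x' y'" using assms(1) by (rule layered_block)
  then have y'e: "y' \<le> e" using block_cut[OF b(3) assms(2)] x xy(2) by auto
  have "x = e - y'" "y = e - x'"
    using block_unique[OF xy(1) blk[OF b(3) y'e], of x] b x y'e xy(2) by auto
  then show "block L (e - y) (e - x)" using b blockD(1)[OF b(3)] y'e by simp
qed

lemma cut_flip_iff:
  assumes "layered L" "is_cut L e" "k \<le> e"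
  shows "is_cut (flip e L) k \<longleftrightarrow> is_cut L (e - k)"
proof
  assume k: "is_cut (flip e L) k"
  show "is_cut L (e - k)"
  proof (rule ccontr)
    assume "\<not> is_cut L (e - k)"
    then obtain x y where b: "x < e - k" "e - k < y" "block L x y" by (rule layered_not_cut[OF assms(1)])
    have "y \<le> e" using block_cut[OF b(3) assms(2)] b assms(3) by auto
    then have "L x = y - 1" "x < y" "x < e" using blockD(4)[OF b(3), of x] b by auto
    then have "flip e L (e - 1 - x) = e - y" using \<open>y \<le> e\<close> unfolding flip_def by auto
    then have "flip e L (e - 1 - x) < k" using b assms(3) \<open>y \<le> e\<close> by auto
    then have "e - 1 - x < k" using k unfolding is_cut_def by blast
    then show False using b by auto
  qed
qed (rule cut_flip[OF assms(2,3,1)])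

section \<open>Uniqueness\<close>

lemma (in shape) pn_peak:
  assumes "q < n" "q = 0 \<or> h (q - 1) < h q"
  shows "pn h q = h q - 1"
proof (cases q)
  case 0
  then have "0 < h 0" using above assms by auto
  then show ?thesis using 0 by (simp add: hd_rev)
next
  case (Suc q')
  then have "h q' < h q" using assms by auto
  then show ?thesis using Suc by (simp add: hd_rev)
qed

text \<open>Nodes popped in one run decrease, so the node pushed last can only be popped at its
  start.\<close>

lemma (in shape) peak_if_pn:
  assumes "q < n" "pn h q = h q - 1"
  shows "q = 0 \<or> h (q - 1) < h q"
proof (rule ccontr)
  assume "\<not> ?thesis"
  then have q: "0 < q" "h (q - 1) = h q" using mono[of "q - 1" q] assms by auto
  then have "pn h q < pn h (q - 1)" using pn_decreasing[of "q - 1" q] assms by auto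
  moreover have "pn h (q - 1) < h q" using pn_less[of "q - 1"] q assms by auto
  ultimately show False using assms by auto
qed

text \<open>The shape is visible in the permutation: its left-to-right maxima, read from the bottom,
  are the peaks.\<close>
lemma shape_from_perm:
  assumes wf: "well_formed w" and red: "reduced w" and q: "q < push_total w"
  shows "Max (nth (rev (produced_perm w)) ` {..q}) = hp 0 w ! q"
proof (rule Max_eqI)
  define h where "h = nth (hp 0 w)"
  interpret shape h "push_total w" unfolding h_def by (rule shape_word[OF wf])
  let ?n = "push_total w" and ?P = "lay (pushes w)" and ?Q = "lay (pops w)"
  have n: "?n = sum_list (pops w)" "?n = sum_list (pushes w)"
    using wf ht_total[of 0 w 0] by (auto simp: well_formed_ht push_total_eq)
  have cut: "is_cut ?P (h e)" if "e < ?n" for e using cut_hp[of e w] that n unfolding h_def by simp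
  show "y \<le> hp 0 w ! q" if "y \<in> nth (rev (produced_perm w)) ` {..q}" for y
  proof -
    obtain e where e: "e \<le> q" "y = rev (produced_perm w) ! e" using \<open>y \<in> _\<close> by auto
    let ?e = "?Q e"
    have en: "e < ?n" "?e < ?n" using e q lay_less[of e "pops w"] n by auto
    have "y = Suc (?P (pn h ?e))"
      using produced_perm_nth(1)[OF wf en(2)] layered_invol[OF layered_lay, of "pops w" e] e(2) unfolding h_def by simp
    moreover have "?P (pn h ?e) < h ?e" using cut_less[OF cut[OF en(2)] pn_less[OF en(2)]] .
    moreover have "h ?e = h e" using hp_lay_pops[of e w] en n unfolding h_def by simp
    ultimately show ?thesis using mono[OF e(1) q] unfolding h_def by simp
  qed
  \<comment> \<open>The first unit pop at the height of \<open>q\<close>. It is a peak, hence fixed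
    by the pop involution, and its node is fixed by the push involution, so the maximum is attained
    there.\<close>
  define p where "p = (LEAST p. h p = h q)"
  have hp: "h p = h q" unfolding p_def by (rule LeastI[of _ q]) simp
  have pq: "p \<le> q" unfolding p_def by (rule Least_le) simp
  have pk: "p = 0 \<or> h (p - 1) < h p"
  proof (rule ccontr)
    assume a: "\<not> ?thesis"
    then have "h (p - 1) = h q" using mono[of "p - 1" p] hp pq q by auto
    then have "p \<le> p - 1" unfolding p_def by (rule Least_le)
    then show False using a by auto
  qed
  have pn: "p < ?n" using pq q by simp
  have pk': "p = 0 \<or> hp 0 w ! (p - 1) < hp 0 w ! p" using pk unfolding h_def .
  have "?Q p = p" "?P (h p - 1) = h p - 1"
    using peak(5)[OF wf red _ pk'] peak(2)[OF wf red _ pk'] pn n unfolding h_def by auto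
  then have "rev (produced_perm w) ! p = Suc (h p - 1)"
    using produced_perm_nth(1)[OF wf pn] pn_peak[OF pn pk] unfolding h_def by simp
  then have "rev (produced_perm w) ! p = hp 0 w ! q" using hp above[OF pn] unfolding h_def by simp
  then show "hp 0 w ! q \<in> nth (rev (produced_perm w)) ` {..q}" using pq by force
qed simp

lemma equivalent_same_shape:
  assumes "well_formed w" "reduced w" "well_formed w'" "reduced w'" "equivalent w w'"
  shows "hp 0 w = hp 0 w'"
proof (rule nth_equalityI)
  have n: "push_total w = sum_list (pops w)" "push_total w' = sum_list (pops w')"
    using assms ht_total[of 0 w 0] ht_total[of 0 w' 0] by (auto simp: well_formed_ht push_total_eq)
  then show "length (hp 0 w) = length (hp 0 w')" using assms(5) by (simp add: equivalent_def)
  fix q assume "q < length (hp 0 w)"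
  then show "hp 0 w ! q = hp 0 w' ! q"
    using shape_from_perm[OF assms(1,2), of q] shape_from_perm[OF assms(3,4), of q] n assms(5)
    by (simp add: equivalent_def)
qed

text \<open>The compositions supply the sizes, and \<open>hp\<close> tells whether a push or a pop
  comes next.\<close>

lemma word_eq:
  "pushes w = pushes w' \<Longrightarrow> pops w = pops w' \<Longrightarrow> hp c w = hp c w' \<Longrightarrow>
   \<forall>x\<in>set w. 1 \<le> op_size x \<Longrightarrow> \<forall>x\<in>set w'. 1 \<le> op_size x \<Longrightarrow> w = w'"
proof (induction w arbitrary: w' c)
  case Nil
  then show ?case by (cases w' rule: pushes.cases) auto
next
  case (Cons x w)
  have clash: False if "hp (c + a) v = replicate b c @ ys" "1 \<le> a" "1 \<le> b" for a b v ys
  proof -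
    have "c \<in> set (hp (c + a) v)" using that by (cases b) auto
    then show False using hp_bounds[of c "c + a" v] that by auto
  qed
  show ?case
  proof (cases w')
    case Nil
    then show ?thesis using Cons.prems by (cases x) auto
  next
    case (Cons x' v)
    show ?thesis
    proof (cases x; cases x')
      fix a a' assume "x = Push a" "x' = Push a'"
      then show ?thesis using Cons.prems Cons Cons.IH[of v "c + a"] by auto
    next
      fix a a' assume "x = Push a" "x' = Pop a'"
      then show ?thesis using Cons.prems Cons clash[of a w a' "hp c v"] by auto
    next
      fix a a' assume "x = Pop a" "x' = Push a'"
      then show ?thesis using Cons.prems Cons clash[of a' v a "hp c w"] by auto
    next
      fix a a' assume "x = Pop a" "x' = Pop a'"
      then show ?thesis using Cons.prems Cons Cons.IH[of v c] by auto
    qed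
  qed
qed

lemma lay_middle: "sum_list A = c \<Longrightarrow> j < sum_list B \<Longrightarrow> lay (A @ B @ C) (c + j) = c + lay B j"
  by (auto simp: lay_append)

text \<open>A segment of the chain between common cuts becomes a nested factor whose compositions
  have the restrictions of \<open>A\<close> and \<open>B\<close> as involutions. Were the nested
  word empty, the top of the segment would be a peak, a part of size 1 on both sides, and
  \<open>y - 1\<close> a common cut; \<open>inner\<close> excludes this.\<close>

lemma segment_factor:
  assumes wf: "well_formed w" and red: "reduced w" and h: "h = nth (hp 0 w)" and n: "n = push_total w"
    and i0: "is_cut (lay (pushes w)) i0" and q0: "is_cut (lay (pops w)) (Suc q0)" "q0 < n"
    and good: "\<forall>j<m. j \<le> q0 \<and> (\<forall>q<n. \<not> (i0 < h q \<and> h q \<le> i0 + j)) \<and> h (q0 - j) = h q0 \<and> pn h (q0 - j) = i0 + j"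
    and A: "A = shiftL i0 (lay (pushes w))" and B: "B = flip (Suc q0) (lay (pops w))"
    and xy: "x < y" "y \<le> m" "is_cut A x" "is_cut A y" "is_cut B x" "is_cut B y"
    and inner: "\<not> (is_cut A (y - 1) \<and> is_cut B (y - 1))"
  shows "\<exists>u A1 v B1 z. w = u @ map Push A1 @ v @ map Pop B1 @ z \<and> v \<noteq> [] \<and> well_formed v \<and>
    sum_list A1 = y - x \<and> sum_list B1 = y - x \<and>
    (\<forall>j<y - x. lay A1 j = A (x + j) - x) \<and> (\<forall>j<y - x. y - x - 1 - lay B1 (y - x - 1 - j) = B (x + j) - x)"
proof -
  interpret shape h n unfolding h n by (rule shape_word[OF wf])
  let ?P = "lay (pushes w)" and ?Q = "lay (pops w)" and ?k = "y - x"
  define q1 where "q1 = Suc q0 - y"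
  have nn: "n = sum_list (pops w)" "n = sum_list (pushes w)"
    using wf ht_total[of 0 w 0] unfolding n by (auto simp: well_formed_ht push_total_eq)
  have gy: "y - 1 \<le> q0" "\<And>q. q < n \<Longrightarrow> \<not> (i0 < h q \<and> h q \<le> i0 + (y - 1))" "pn h (q0 - (y - 1)) = i0 + (y - 1)"
    using good[rule_format, of "y - 1"] xy by auto
  have qq: "q0 - (y - 1) = q1" "q1 + y = Suc q0" using xy gy(1) unfolding q1_def by auto
  have qn: "q1 < n" using q0(2) qq(2) xy by linarith
  have cP: "is_cut ?P (i0 + c)" if "is_cut A c" for c using that cut_shiftL[OF i0] A by blast
  have cQ: "is_cut ?Q (Suc q0 - c)" if "is_cut B c" "c \<le> Suc q0" for c
    using that cut_flip_iff[OF layered_lay q0(1)] B by blast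
  have cP': "is_cut A c" if "is_cut ?P (i0 + c)" for c using that cut_shiftL[OF i0] A by blast
  have cQ': "is_cut B c" if "is_cut ?Q (Suc q0 - c)" "c \<le> Suc q0" for c
    using that cut_flip_iff[OF layered_lay q0(1)] B by blast
  have hj: "h (q1 + j) = h q0" if "j < y" for j
  proof -
    have "q1 + j = q0 - (y - 1 - j)" using that qq(2) by linarith
    then show ?thesis using good[rule_format, of "y - 1 - j"] that xy by simp
  qed
  have "\<exists>u A v B z. w = u @ map Push A @ v @ map Pop B @ z \<and> v \<noteq> [] \<and> well_formed v \<and>
    sum_list A = ?k \<and> sum_list B = ?k \<and> sum_list (pushes u) = i0 + x \<and> sum_list (pops (u @ map Push A @ v)) = q1"
  proof (rule nested_factor[OF wf])
    show "0 < ?k" using xy by simp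
    show "is_cut ?Q q1" using cQ[OF xy(6)] qq(2) unfolding q1_def by simp
    have "q1 + ?k = Suc q0 - x" "x \<le> Suc q0" using xy qq(2) by linarith+
    then show "is_cut ?Q (q1 + ?k)" using cQ[OF xy(5)] by simp
    show "q1 + ?k \<le> push_total w" using xy qq(2) q0(2) n by linarith
    show "hp 0 w ! (q1 + j) = hp 0 w ! q1" if "j < ?k" for j
      using hj[of j] hj[of 0] that xy unfolding h by auto
    show "is_cut ?P (i0 + x)" using cP xy by simp
    have "i0 + x + ?k = i0 + y" using xy by simp
    then show "is_cut ?P (i0 + x + ?k)" using cP[OF xy(4)] by simp
    show "\<not> (i0 + x < hp 0 w ! q \<and> hp 0 w ! q < i0 + x + ?k)" if "q < push_total w" for q
      using gy(2)[of q] that xy unfolding h n by auto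
    have "pn h q1 = i0 + x + ?k - 1" using gy(3) xy unfolding qq(1) by simp
    then show "pn (nth (hp 0 w)) q1 = i0 + x + ?k - 1" unfolding h .
    show "hp 0 w ! q1 \<noteq> i0 + x + ?k"
    proof
      assume "hp 0 w ! q1 = i0 + x + ?k"
      then have hq: "h q1 = i0 + y" using xy unfolding h by simp
      then have "pn h q1 = h q1 - 1" using gy(3) xy unfolding qq(1) by simp
      from peak_if_pn[OF qn this] have pk: "q1 = 0 \<or> hp 0 w ! (q1 - 1) < hp 0 w ! q1" unfolding h .
      have qp: "q1 < sum_list (pops w)" using qn nn by simp
      have "is_cut ?P (h q1 - 1)" "is_cut ?Q (Suc q1)"
        using peak(1)[OF wf red qp pk] peak(4)[OF wf red qp pk] unfolding h by auto
      moreover have "h q1 - 1 = i0 + (y - 1)" "Suc q1 = Suc q0 - (y - 1)" "y - 1 \<le> Suc q0" using hq xy qq(2) by linarith+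
      ultimately show False using inner cP' cQ' by simp
    qed
  qed
  then obtain u A1 v B1 z where w: "w = u @ map Push A1 @ v @ map Pop B1 @ z" "v \<noteq> []" "well_formed v"
    "sum_list A1 = ?k" "sum_list B1 = ?k" "sum_list (pushes u) = i0 + x" "sum_list (pops (u @ map Push A1 @ v)) = q1"
    by blast
  have a: "lay A1 j = A (x + j) - x" if "j < ?k" for j
  proof -
    have "pushes w = pushes u @ A1 @ (pushes v @ pushes z)" using w(1) by simp
    then have "?P (i0 + x + j) = i0 + x + lay A1 j" using w(4,6) that by (simp add: lay_append)
    then show ?thesis unfolding A shiftL_def by (simp add: add.assoc)
  qed
  have b: "?k - 1 - lay B1 (?k - 1 - j) = B (x + j) - x" if "j < ?k" for j
  proof -
    have "pops w = pops (u @ map Push A1 @ v) @ B1 @ pops z" using w(1) by simp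
    moreover have "lay (pops (u @ map Push A1 @ v) @ B1 @ pops z) (q1 + (?k - 1 - j)) = q1 + lay B1 (?k - 1 - j)"
      by (rule lay_middle[OF w(7)]) (use w(5) that in linarith)
    ultimately have "?Q (q1 + (?k - 1 - j)) = q1 + lay B1 (?k - 1 - j)" by metis
    moreover have "q1 + (?k - 1 - j) = q0 - (x + j)" using that qq(2) by linarith
    moreover have "x + j < Suc q0" using that qq(2) by linarith
    ultimately have "B (x + j) = q0 - (q1 + lay B1 (?k - 1 - j))"
      unfolding B flip_def by simp
    moreover have "q0 = q1 + (y - 1)" using qq(2) xy(1) by linarith
    ultimately have "B (x + j) = y - 1 - lay B1 (?k - 1 - j)" by (metis diff_diff_left diff_add_inverse)
    then show ?thesis by simp
  qed
  show ?thesis using w(1-5) a b by blast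
qed

lemma pushes_alphabet: "set w \<subseteq> op_alphabet s t \<Longrightarrow> set (pushes w) \<subseteq> {1..s}"
  by (induction w rule: pushes.induct) (auto simp: op_alphabet_def)

lemma pops_alphabet: "set w \<subseteq> op_alphabet s t \<Longrightarrow> set (pops w) \<subseteq> {1..t}"
  by (induction w rule: pops.induct) (auto simp: op_alphabet_def)

text \<open>The stack is read in opposite directions by the two moves, whence the index
  \<open>k - 1 - lay B j\<close>; it matches the effect of \<open>flip\<close>.\<close>

lemma nth_rev_blk_blk:
  assumes "sum_list A = k" "sum_list B = k" "j < k"
  shows "rev (blk B (blk A [0..<k])) ! j = lay A (k - 1 - lay B j)"
proof -
  have l: "length (blk A [0..<k]) = sum_list B" using length_blk[of "[0..<k]" A] assms by simp
  have jb: "lay B j < k" using lay_less[of j B] assms by simp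
  have "rev (blk B (blk A [0..<k])) ! j = blk A [0..<k] ! lay B j"
    using nth_rev_blk[OF l] assms by simp
  also have "\<dots> = rev (blk A [0..<k]) ! (k - 1 - lay B j)"
    using jb l assms by (simp add: rev_nth)
  also have "\<dots> = [0..<k] ! lay A (k - 1 - lay B j)"
    by (rule nth_rev_blk) (use assms jb in auto)
  also have "\<dots> = lay A (k - 1 - lay B j)"
    using lay_less[of "k - 1 - lay B j" A] assms jb by auto
  finally show ?thesis .
qed

lemma hd_lay: "A \<noteq> [] \<Longrightarrow> \<forall>a\<in>set A. 1 \<le> a \<Longrightarrow> hd A = Suc (lay A 0)"
  by (cases A) auto

lemma singleton_if_lay:
  assumes "\<forall>a\<in>set A. 1 \<le> a" "sum_list A = k" "0 < k" "lay A 0 = k - 1"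
  shows "A = [k]"
proof (cases A)
  case (Cons a A')
  have "a = k" using assms hd_lay[of A] Cons by auto
  then have "sum_list A' = 0" using Cons assms by simp
  then show ?thesis using Cons assms(1) \<open>a = k\<close> by (cases A') auto
qed (use assms in auto)

text \<open>Moving \<open>k\<close> elements twice as one block keeps their order, and so does
  moving them twice one by one, which begins with a smaller push.\<close>

lemma bad_singleton:
  assumes "2 \<le> k" "k \<le> s" "1 \<le> t"
  shows "bad s t [k] [k]"
proof -
  have "blk (replicate k 1) (blk (replicate k 1) [0..<k]) = [0..<k]"
    using blk_ones[of "[0..<k]" k] blk_ones[of "rev [0..<k]" k] by simp
  moreover have "blk [k] (blk [k] [0..<k]) = [0..<k]" by simp
  moreover have "replicate k (1::nat) \<noteq> []" "hd (replicate k (1::nat)) < k" using assms by (auto simp: hd_replicate)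
  moreover have "set (replicate k 1) \<subseteq> {1..s}" "set (replicate k 1) \<subseteq> {1..t}" using assms by auto
  moreover have "sum_list (replicate k 1) = k" by (simp add: sum_list_replicate)
  ultimately have "\<exists>A' B'. A' \<noteq> [] \<and> set A' \<subseteq> {1..s} \<and> set B' \<subseteq> {1..t} \<and> hd A' < hd [k] \<and>
        sum_list A' = sum_list [k] \<and> sum_list B' = sum_list [k] \<and>
        blk [k] (blk [k] [0..<sum_list [k]]) = blk B' (blk A' [0..<sum_list [k]])"
    using assms by (intro exI[of _ "replicate k 1"]) (simp del: blk.simps)
  then show ?thesis unfolding bad_def using assms by auto
qed

text \<open>Two irreducible words for the same permutation have the same shape.  At the first node carrying
  different elements, the unary chain above that node is factored in two ways into layered involutions;
  the bounded common cut turns one of the two factorisations into a forbidden factor.\<close>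
theorem irreducible_unique:
  assumes st: "1 \<le> s" "1 \<le> t"
    and w: "well_formed w" "reduced w" "set w \<subseteq> op_alphabet s t" "irreducible_word s t w"
    and w': "well_formed w'" "reduced w'" "set w' \<subseteq> op_alphabet s t" "irreducible_word s t w'"
    and e: "equivalent w w'"
  shows "w = w'"
proof -
  define h where "h = nth (hp 0 w)"
  define n where "n = push_total w"
  define LP LQ LP' LQ' where "LP = lay (pushes w)" and "LQ = lay (pops w)"
    and "LP' = lay (pushes w')" and "LQ' = lay (pops w')"
  have hpe: "hp 0 w = hp 0 w'" using equivalent_same_shape[OF w(1,2) w'(1,2) e] .
  have h': "h = nth (hp 0 w')" unfolding h_def hpe ..
  have n': "n = push_total w'" using e unfolding n_def equivalent_def by simp
  interpret shape h n unfolding h_def n_def by (rule shape_word[OF w(1)])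
  have nn: "n = sum_list (pops w)" "n = sum_list (pushes w)" "n = sum_list (pops w')" "n = sum_list (pushes w')"
    using w(1) w'(1) ht_total[of 0 w 0] ht_total[of 0 w' 0] n_def n'
    by (auto simp: well_formed_ht push_total_eq)
  have lay: "layered LP" "layered LP'" "layered LQ" "layered LQ'"
    unfolding LP_def LP'_def LQ_def LQ'_def by simp_all
  note inv = layered_invol[OF lay(1)] layered_invol[OF lay(2)] layered_invol[OF lay(3)] layered_invol[OF lay(4)]
  have lt: "LP i < n" "LP' i < n" "LQ i < n" "LQ' i < n" if "i < n" for i
    using that lay_less[of i "pushes w"] lay_less[of i "pushes w'"] lay_less[of i "pops w"] lay_less[of i "pops w'"] nn
    unfolding LP_def LP'_def LQ_def LQ'_def by simp_all
  have cutP: "is_cut LP (h q)" "is_cut LP' (h q)" if "q < n" for q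
    using cut_hp[of q w] cut_hp[of q w'] that nn unfolding LP_def LP'_def h_def hpe by simp_all
  have hQ: "h (LQ q) = h q" "h (LQ' q) = h q" if "q < n" for q
    using hp_lay_pops[of q w] hp_lay_pops[of q w'] that nn unfolding LQ_def LQ'_def h_def hpe by simp_all
  \<comment> \<open>Equality of the permutations in node coordinates: the two pop involutions move
    pop times just as the two push involutions move the nodes popped.\<close>
  have rel: "pn h (LQ' (LQ q)) = LP' (LP (pn h q))" if q: "q < n" for q
  proof -
    let ?q = "LQ' (LQ q)"
    have q': "?q < n" using lt q by simp
    have "rev (produced_perm w) ! LQ q = Suc (LP (pn h q))"
      using produced_perm_nth(1)[OF w(1)] q unfolding n_def LQ_def LP_def h_def by simp
    moreover have "rev (produced_perm w') ! LQ' ?q = Suc (LP' (pn h ?q))"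
      using produced_perm_nth(1)[OF w'(1)] q' unfolding n' LQ'_def LP'_def h' by simp
    ultimately have "LP (pn h q) = LP' (pn h ?q)" using e inv(4) by (simp add: equivalent_def)
    then show ?thesis using inv(2) by metis
  qed
  have pos: "\<forall>x\<in>set w. 1 \<le> op_size x" "\<forall>x\<in>set w'. 1 \<le> op_size x"
    using w(1) w'(1) ht_ops_pos by (auto simp: well_formed_ht)
  have posP: "\<forall>a\<in>set (pushes w). 1 \<le> a" "\<forall>a\<in>set (pushes w'). 1 \<le> a"
      "\<forall>a\<in>set (pops w). 1 \<le> a" "\<forall>a\<in>set (pops w'). 1 \<le> a"
    using pushes_alphabet[OF w(3)] pushes_alphabet[OF w'(3)] pops_alphabet[OF w(3)] pops_alphabet[OF w'(3)] by auto
  show ?thesis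
  proof (cases "\<forall>i<n. LP i = LP' i")
    case True
    then have p: "pushes w = pushes w'"
      using lay_inject[OF posP(1,2)] nn unfolding LP_def LP'_def by simp
    have "LQ q = LQ' q" if q: "q < n" for q
    proof -
      have "LP' (LP (pn h q)) = pn h q" using True pn_less_n[OF q] inv(2) by simp
      then have "LQ' (LQ q) = q" using rel[OF q] pn_inj[of "LQ' (LQ q)" q] lt q by simp
      then show ?thesis using inv(4) by metis
    qed
    then have "pops w = pops w'"
      using lay_inject[OF posP(3,4)] nn unfolding LQ_def LQ'_def by simp
    then show ?thesis using word_eq[OF p _ hpe pos] by blast
  next
    case False
    \<comment> \<open>Being the first disagreement, \<open>i0\<close> is a cut of both push
      involutions; it becomes the bottom of the chain.\<close>
    define i0 where "i0 = (LEAST i. LP i \<noteq> LP' i)"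
    have ne0: "LP i0 \<noteq> LP' i0" using LeastI_ex[of "\<lambda>i. LP i \<noteq> LP' i"] False unfolding i0_def by blast
    have ag0: "LP i = LP' i" if "i < i0" for i using not_less_Least[of i "\<lambda>i. LP i \<noteq> LP' i"] that unfolding i0_def by blast
    have i0n: "i0 < n"
    proof -
      obtain i where "i < n" "LP i \<noteq> LP' i" using False by blast
      then show ?thesis using Least_le[of "\<lambda>i. LP i \<noteq> LP' i" i] unfolding i0_def by simp
    qed
    have ci0: "is_cut LP i0" "is_cut LP' i0"
      using first_disagreement_cut[OF lay(1,2) ag0 ne0] first_disagreement_cut[OF lay(2,1) ag0[symmetric] ne0[symmetric]]
      by auto
    have phi0: "LP' (LP i0) \<noteq> i0" using ne0 inv(2) by metis
    obtain q0 where q0: "q0 < n" "pn h q0 = i0" using pn_surj[OF i0n] by blast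
    have cq0: "is_cut LQ (Suc q0) \<and> is_cut LQ' (Suc q0)"
    proof -
      \<comment> \<open>The end of the run of pops that contains \<open>q0\<close>. Later pops of
        this run remove smaller nodes, on which the words agree, so read backwards from
        \<open>d\<close> the pop involutions first disagree at \<open>q0\<close>.\<close>
      define d where "d = (LEAST d. d = n \<or> q0 < d \<and> d < n \<and> h q0 < h d)"
      have d: "d = n \<or> q0 < d \<and> d < n \<and> h q0 < h d" unfolding d_def by (rule LeastI[of _ n]) simp
      have dn: "d \<le> n" "q0 < d" using d q0 by auto
      have hd: "i < d \<longleftrightarrow> h i \<le> h q0" if "i < n" for i
      proof
        assume "i < d"
        show "h i \<le> h q0"
        proof (rule ccontr)
          assume a: "\<not> h i \<le> h q0"
          then have "q0 < i" using mono[of i q0] q0 by force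
          then have "d \<le> i" unfolding d_def by (intro Least_le) (use a that in auto)
          then show False using \<open>i < d\<close> by simp
        qed
      next
        assume "h i \<le> h q0"
        show "i < d"
        proof (rule ccontr)
          assume "\<not> i < d"
          then show False using d mono[of d i] that \<open>h i \<le> h q0\<close> by auto
        qed
      qed
      have nQ: "is_cut LQ n" "is_cut LQ' n"
        using lay_cut[of "pops w" "[]"] lay_cut[of "pops w'" "[]"] nn unfolding LQ_def LQ'_def by simp_all
      have cd: "is_cut L d" if "is_cut L n" "\<And>q. q < n \<Longrightarrow> h (L q) = h q" "\<And>q. q < n \<Longrightarrow> L q < n" for L
        unfolding is_cut_def
      proof
        fix i
        show "L i < d \<longleftrightarrow> i < d"
          using hd[of i] hd[of "L i"] that(2,3)[of i] cut_ge[OF that(1), of i] dn by (cases "i < n") auto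
      qed
      have cd': "is_cut LQ d" "is_cut LQ' d" using cd nQ hQ lt by blast+
      have fl: "layered (flip d LQ)" "layered (flip d LQ')" using layered_flip(1) lay cd' by blast+
      have ag: "flip d LQ j = flip d LQ' j" if j: "j < d - 1 - q0" for j
      proof -
        let ?q = "d - 1 - j"
        have q: "q0 < ?q" "?q < d" "?q < n" using j dn by auto
        have "h ?q = h q0" using hd[OF q(3)] mono[of q0 ?q] q by auto
        then have "pn h ?q < i0" using pn_decreasing[of q0 ?q] q q0 by simp
        then have "LP' (LP (pn h ?q)) = pn h ?q" using ag0 inv(2) by metis
        then have "LQ' (LQ ?q) = ?q" using rel[OF q(3)] pn_inj[of "LQ' (LQ ?q)" ?q] lt q by simp
        then have "LQ ?q = LQ' ?q" using inv(4) by metis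
        then show ?thesis unfolding flip_def by simp
      qed
      have nf: "flip d LQ (d - 1 - q0) \<noteq> flip d LQ' (d - 1 - q0)"
      proof -
        have "LQ q0 \<noteq> LQ' q0"
        proof
          assume "LQ q0 = LQ' q0"
          then have "LQ' (LQ q0) = q0" using inv(4) by metis
          then show False using rel[OF q0(1)] q0(2) phi0 by simp
        qed
        moreover have "LQ q0 < d" "LQ' q0 < d" using cut_less cd' dn by blast+
        ultimately show ?thesis unfolding flip_def using dn by auto
      qed
      have "is_cut (flip d LQ) (d - 1 - q0)" "is_cut (flip d LQ') (d - 1 - q0)"
        using first_disagreement_cut[OF fl ag nf]
          first_disagreement_cut[OF fl(2,1) ag[symmetric] nf[symmetric]] by auto
      moreover have "d - (d - 1 - q0) = Suc q0" "d - 1 - q0 \<le> d" using dn by auto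
      ultimately show ?thesis using cut_flip_iff lay cd' by metis
    qed
    \<comment> \<open>The chain above \<open>i0\<close>: nodes that share with \<open>i0\<close>
      both the run of pushes and the run of pops. The bound \<open>j \<le> q0\<close> guarantees
      that it ends.\<close>
    define good where "good j \<longleftrightarrow> j \<le> q0 \<and> (\<forall>q<n. \<not> (i0 < h q \<and> h q \<le> i0 + j)) \<and>
      h (q0 - j) = h q0 \<and> pn h (q0 - j) = i0 + j" for j
    define m where "m = (LEAST m. \<not> good m)"
    have goodm: "good j" if "j < m" for j using not_less_Least[of j "\<lambda>m. \<not> good m"] that unfolding m_def by blast
    have bm: "\<not> good m" unfolding m_def by (rule LeastI[of _ "Suc q0"]) (simp add: good_def)
    have good0: "good 0" using q0 unfolding good_def by auto
    have m0: "0 < m" using bm good0 by (cases m) auto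
    \<comment> \<open>A node above \<open>i0\<close> that shares both runs with it lies in the
      chain, because all nodes between them share these runs too.\<close>
    have seg: "i - i0 < m \<and> q = q0 - (i - i0)"
      if i: "i0 \<le> i" "\<forall>q<n. \<not> (i0 < h q \<and> h q \<le> i)" and q: "q < n" "pn h q = i" "h q = h q0" for i q
    proof -
      have q0q: "q0 = q + (i - i0)" using pn_chain[OF i(2,1) q0 q(1,2)] q(3) by simp
      have "good j" if j: "j \<le> i - i0" for j
      proof -
        define l where "l = i - i0 - j"
        have ql: "q0 - j = q + l" "l \<le> i - i0" "i - l = i0 + j" using q0q j i(1) unfolding l_def by auto
        have qn: "q + l < n" using ql q0 by linarith
        have "h q \<le> h (q + l)" "h (q + l) \<le> h q0" using mono[of q "q + l"] mono[of "q + l" q0] ql q0 qn by auto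
        then have hl: "h (q + l) = h q" using q(3) by simp
        have "pn h (q + l) = i0 + j"
          using pn_run[OF qn hl] st_chain[OF i(2,1) q(1,2) ql(2)] ql(3) by simp
        moreover have "\<forall>q<n. \<not> (i0 < h q \<and> h q \<le> i0 + j)"
        proof (intro allI impI notI)
          fix p assume "p < n" "i0 < h p \<and> h p \<le> i0 + j"
          then show False using i(2)[rule_format, of p] j i(1) by auto
        qed
        ultimately show ?thesis unfolding good_def using ql hl q(3) q0q j by auto
      qed
      then have "i - i0 < m" using bm by (meson not_le)
      then show ?thesis using q0q by auto
    qed
    \<comment> \<open>Coordinate \<open>j\<close> stands for node \<open>i0 + j\<close> on the push
      side and for pop \<open>q0 - j\<close> on the pop side.\<close>
    define A A' B B' where "A = shiftL i0 LP" and "A' = shiftL i0 LP'"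
      and "B = flip (Suc q0) LQ" and "B' = flip (Suc q0) LQ'"
    have layA: "layered A" "layered A'" "layered B" "layered B'"
      unfolding A_def A'_def B_def B'_def using layered_shiftL(1) layered_flip(1) lay ci0 cq0 by blast+
    have AA: "A' (A j) = LP' (LP (i0 + j)) - i0" for j
      using cut_ge[OF ci0(1), of "i0 + j"] unfolding A_def A'_def shiftL_def by simp
    have BB: "B' (B j) = q0 - LQ' (LQ (q0 - j))" if "j \<le> q0" for j
    proof -
      have "LQ (q0 - j) < Suc q0" using cut_less[of LQ "Suc q0"] cq0 by simp
      then show ?thesis using that unfolding B_def B'_def flip_def by simp
    qed
    \<comment> \<open>Pop heights are cuts of the push involutions, and the pop involutions preserve
      heights. The products therefore stay within both runs, \<open>seg\<close> keeps them in the
      chain, and \<open>rel\<close> matches the coordinates.\<close>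
    have step: "A' (A j) < m \<and> A' (A j) = B' (B j)" if j: "j < m" for j
    proof -
      have g: "j \<le> q0" "\<forall>q<n. \<not> (i0 < h q \<and> h q \<le> i0 + j)" "h (q0 - j) = h q0" "pn h (q0 - j) = i0 + j"
        using goodm[OF j] unfolding good_def by auto
      let ?i = "LP' (LP (i0 + j))" and ?q = "LQ' (LQ (q0 - j))"
      have qn: "q0 - j < n" using q0 by simp
      have i: "i0 \<le> ?i" using cut_ge[OF ci0(2) cut_ge[OF ci0(1)]] by simp
      have no: "\<forall>q<n. \<not> (i0 < h q \<and> h q \<le> ?i)"
      proof (intro allI impI)
        fix q assume q: "q < n"
        have "?i < h q" if "i0 + j < h q" using cut_less[OF cutP(2)[OF q] cut_less[OF cutP(1)[OF q] that]] .
        then show "\<not> (i0 < h q \<and> h q \<le> ?i)" using g(2) q by (meson not_le)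
      qed
      have "?q < n" "pn h ?q = ?i" "h ?q = h q0"
        using lt qn rel[OF qn] g(3,4) hQ by auto
      then have "?i - i0 < m \<and> ?q = q0 - (?i - i0)" by (rule seg[OF i no])
      moreover have "?i - i0 \<le> q0" using calculation goodm unfolding good_def by blast
      ultimately show ?thesis using AA BB[OF g(1)] by auto
    qed
    have good_all: "\<forall>j<m. j \<le> q0 \<and> (\<forall>q<n. \<not> (i0 < h q \<and> h q \<le> i0 + j)) \<and>
        h (q0 - j) = h q0 \<and> pn h (q0 - j) = i0 + j"
      using goodm unfolding good_def by blast
    note factor = segment_factor[OF w(1,2) h_def n_def ci0(1)[unfolded LP_def] conjunct1[OF cq0, unfolded LQ_def] q0(1)
        good_all A_def[unfolded LP_def] B_def[unfolded LQ_def]]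
    note factor' = segment_factor[OF w'(1,2) h' n' ci0(2)[unfolded LP'_def] conjunct2[OF cq0, unfolded LQ'_def] q0(1)
        good_all A'_def[unfolded LP'_def] B'_def[unfolded LQ'_def]]
    \<comment> \<open>A block common to the pushes and pops of one word is a single part
      \<open>y - x\<close> on both sides, which is forbidden by
      \<open>bad_singleton\<close>.\<close>
    have noc: "y \<le> Suc x"
      if irr: "irreducible_word s t v" and al: "set v \<subseteq> op_alphabet s t"
        and fac: "\<And>x y. x < y \<Longrightarrow> y \<le> m \<Longrightarrow> is_cut C x \<Longrightarrow> is_cut C y \<Longrightarrow> is_cut D x \<Longrightarrow> is_cut D y \<Longrightarrow>
          \<not> (is_cut C (y - 1) \<and> is_cut D (y - 1)) \<Longrightarrow>
          \<exists>u A1 v1 B1 z. v = u @ map Push A1 @ v1 @ map Pop B1 @ z \<and> v1 \<noteq> [] \<and> well_formed v1 \<and>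
            sum_list A1 = y - x \<and> sum_list B1 = y - x \<and>
            (\<forall>j<y - x. lay A1 j = C (x + j) - x) \<and> (\<forall>j<y - x. y - x - 1 - lay B1 (y - x - 1 - j) = D (x + j) - x)"
        and b: "block C x y" "block D x y" and ym: "y \<le> m" for v C D x y
    proof (rule ccontr)
      assume xy: "\<not> y \<le> Suc x"
      have "\<not> is_cut C (y - 1)" using block_cut[OF b(1), of "y - 1"] xy by auto
      then obtain u A1 v1 B1 z where f: "v = u @ map Push A1 @ v1 @ map Pop B1 @ z" "v1 \<noteq> []" "well_formed v1"
            "sum_list A1 = y - x" "sum_list B1 = y - x"
            "\<forall>j<y - x. lay A1 j = C (x + j) - x" "\<forall>j<y - x. y - x - 1 - lay B1 (y - x - 1 - j) = D (x + j) - x"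
        using fac[OF blockD(1)[OF b(1)] ym blockD(2,3)[OF b(1)] blockD(2,3)[OF b(2)]] by blast
      have pos1: "\<forall>a\<in>set A1. 1 \<le> a" "\<forall>a\<in>set B1. 1 \<le> a" "\<forall>a\<in>set A1. a \<le> s"
        using pushes_alphabet[OF al] pops_alphabet[OF al] f(1) by auto
      have "lay A1 0 = y - x - 1"
        using f(6) xy blockD(4)[OF b(1), of x] by auto
      then have A1: "A1 = [y - x]" using singleton_if_lay[OF pos1(1) f(4)] xy by auto
      have "lay B1 0 < y - x" using lay_less[of 0 B1] f(5) xy by auto
      moreover have "y - x - 1 - lay B1 0 = D (y - 1) - x" using f(7)[rule_format, of "y - x - 1"] xy by auto
      moreover have "D (y - 1) = x" using blockD(4)[OF b(2), of "y - 1"] xy by auto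
      ultimately have "lay B1 0 = y - x - 1" by auto
      then have B1: "B1 = [y - x]" using singleton_if_lay[OF pos1(2) f(5)] xy by auto
      have "bad s t A1 B1" unfolding A1 B1 by (rule bad_singleton) (use xy A1 pos1 st in auto)
      then show False using irr f(1-3) unfolding irreducible_word_def by blast
    qed
    have stepA: "A' (A j) < m" and stepB: "A' (A j) = B' (B j)" if "j < m" for j
      using step[OF that] by blast+
    interpret lines A A' B B' m
    proof (rule lines.intro[OF layA stepA stepB])
      show "y \<le> Suc x" if "block A x y" "block B x y" "y \<le> m" for x y
        by (rule noc[OF w(4,3) factor that])
      show "y \<le> Suc x" if "block A' x y" "block B' x y" "y \<le> m" for x y
        by (rule noc[OF w'(4,3) factor' that])
    qed
    have ne: "A' (A 0) \<noteq> 0" using AA[of 0] phi0 cut_ge[OF ci0(2) cut_ge[OF ci0(1)], of i0] by auto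
    let ?S = "max s t"
    have S1: "1 \<le> ?S" using st by simp
    have sz: "\<forall>a\<in>set (pushes w). a \<le> ?S" "\<forall>a\<in>set (pushes w'). a \<le> ?S"
        "\<forall>a\<in>set (pops w). a \<le> ?S" "\<forall>a\<in>set (pops w'). a \<le> ?S"
      using pushes_alphabet[OF w(3)] pushes_alphabet[OF w'(3)] pops_alphabet[OF w(3)] pops_alphabet[OF w'(3)]
      by (auto simp: le_max_iff_disj)
    have bA: "y \<le> x + ?S" if "block (shiftL i0 L) x y" "L = lay D" "is_cut L i0" "\<forall>a\<in>set D. a \<le> ?S" for x y L D
      using lay_block_size[of D "i0 + x" "i0 + y" ?S] layered_shiftL(2)[of L i0 x y] that S1 by simp
    have bB: "y \<le> x + ?S" if b: "block (flip (Suc q0) L) x y" "L = lay D" "is_cut L (Suc q0)" "\<forall>a\<in>set D. a \<le> ?S" for x y L D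
    proof (cases "y \<le> Suc q0")
      case True
      then have "block (lay D) (Suc q0 - y) (Suc q0 - x)" using layered_flip(2)[of L "Suc q0" x y] b by simp
      from lay_block_size[OF this b(4) S1] show ?thesis using True blockD(1)[OF b(1)] by auto
    next
      case False
      \<comment> \<open>From \<open>Suc q0\<close> on the flipped map is the identity, so a block
        ending beyond it is a singleton.\<close>
      have "is_cut (flip (Suc q0) L) c" if "Suc q0 \<le> c" for c
        unfolding is_cut_def
      proof
        fix j
        show "flip (Suc q0) L j < c \<longleftrightarrow> j < c" using that by (cases "j < Suc q0") (auto simp: flip_def)
      qed
      then have "is_cut (flip (Suc q0) L) (y - 1)" using False by auto
      then have "y - 1 \<le> x" using block_cut[OF b(1), of "y - 1"] False by auto
      then show ?thesis using S1 by auto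
    qed
    obtain k where k: "0 < k" "k \<le> m" "k \<le> 2 * ?S" "is_cut A k" "is_cut A' k" "is_cut B k" "is_cut B' k"
      and low: "\<And>c. 0 < c \<Longrightarrow> c < k \<Longrightarrow> \<not> (is_cut A c \<and> is_cut B c)"
        "\<And>c. 0 < c \<Longrightarrow> c < k \<Longrightarrow> \<not> (is_cut A' c \<and> is_cut B' c)"
    proof (rule common_cut[OF m0 ne, of ?S])
      show "y \<le> x + ?S" if "block A x y" for x y by (rule bA[OF that[unfolded A_def] LP_def ci0(1) sz(1)])
      show "y \<le> x + ?S" if "block A' x y" for x y by (rule bA[OF that[unfolded A'_def] LP'_def ci0(2) sz(2)])
      show "y \<le> x + ?S" if "block B x y" for x y by (rule bB[OF that[unfolded B_def] LQ_def conjunct1[OF cq0] sz(3)])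
      show "y \<le> x + ?S" if "block B' x y" for x y by (rule bB[OF that[unfolded B'_def] LQ'_def conjunct2[OF cq0] sz(4)])
    qed blast
    have k1: "k \<noteq> 1"
    proof
      assume "k = 1"
      then have "A 0 = 0" "A' 0 = 0" using cut_less[OF k(4), of 0] cut_less[OF k(5), of 0] by auto
      then show False using ne by simp
    qed
    \<comment> \<open>By minimality of \<open>k\<close> the positive number \<open>k - 1\<close> is
      not a common cut, as \<open>segment_factor\<close> demands.\<close>
    then have k2: "0 < k - 1" "k - 1 < k" using k(1) by auto
    obtain u A1 v B1 z where f: "w = u @ map Push A1 @ v @ map Pop B1 @ z" "v \<noteq> []" "well_formed v"
        "sum_list A1 = k" "sum_list B1 = k" "\<forall>j<k. lay A1 j = A j" "\<forall>j<k. k - 1 - lay B1 (k - 1 - j) = B j"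
      using factor[OF k(1,2) cut_0 k(4) cut_0 k(6) low(1)[OF k2]] by auto
    obtain u' A1' v' B1' z' where f': "w' = u' @ map Push A1' @ v' @ map Pop B1' @ z'" "v' \<noteq> []" "well_formed v'"
        "sum_list A1' = k" "sum_list B1' = k" "\<forall>j<k. lay A1' j = A' j" "\<forall>j<k. k - 1 - lay B1' (k - 1 - j) = B' j"
      using factor'[OF k(1,2) cut_0 k(5) cut_0 k(7) low(2)[OF k2]] by auto
    have set1: "set A1 \<subseteq> {1..s}" "set B1 \<subseteq> {1..t}" "set A1' \<subseteq> {1..s}" "set B1' \<subseteq> {1..t}"
      using pushes_alphabet[OF w(3)] pushes_alphabet[OF w'(3)] pops_alphabet[OF w(3)] pops_alphabet[OF w'(3)] f(1) f'(1)
      by auto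
    have ne1: "A1 \<noteq> []" "A1' \<noteq> []" using f(4) f'(4) k(1) by (metis less_irrefl sum_list.Nil)+
    have p1: "\<forall>a\<in>set A1. 1 \<le> a" "\<forall>a\<in>set A1'. 1 \<le> a" "\<forall>a\<in>set B1. 1 \<le> a" "\<forall>a\<in>set B1'. 1 \<le> a" using set1 by auto
    have perm: "blk B1 (blk A1 [0..<k]) = blk B1' (blk A1' [0..<k])"
    proof -
      have "rev (blk B1 (blk A1 [0..<k])) = rev (blk B1' (blk A1' [0..<k]))"
      proof (rule nth_equalityI)
        have len: "length (blk B1 (blk A1 [0..<k])) = k" "length (blk B1' (blk A1' [0..<k])) = k"
          using length_blk[of "[0..<k]" A1] length_blk[of "blk A1 [0..<k]" B1]
            length_blk[of "[0..<k]" A1'] length_blk[of "blk A1' [0..<k]" B1'] f(4,5) f'(4,5) by auto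
        then show "length (rev (blk B1 (blk A1 [0..<k]))) = length (rev (blk B1' (blk A1' [0..<k])))" by simp
        fix j assume "j < length (rev (blk B1 (blk A1 [0..<k])))"
        then have j: "j < k" using len by simp
        define i where "i = k - 1 - j"
        have i: "i < k" "j = k - 1 - i" using j unfolding i_def by auto
        have Bk: "B i < k" "B' i < k" using cut_less k i by blast+
        have L: "rev (blk B1 (blk A1 [0..<k])) ! j = A (B i)"
          using nth_rev_blk_blk[OF f(4,5) j] f(6,7) i Bk by simp
        have R: "rev (blk B1' (blk A1' [0..<k])) ! j = A' (B' i)"
          using nth_rev_blk_blk[OF f'(4,5) j] f'(6,7) i Bk by simp
        have "A' (A (B i)) = B' (B (B i))" using eq[of "B i"] Bk k(2) by simp
        then have "A' (A (B i)) = B' i" using layered_invol[OF layA(3)] by simp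
        then have "A (B i) = A' (B' i)" using layered_invol[OF layA(2)] by metis
        then show "rev (blk B1 (blk A1 [0..<k])) ! j = rev (blk B1' (blk A1' [0..<k])) ! j" using L R by simp
      qed
      then show ?thesis by simp
    qed
    have hdA: "hd A1 = Suc (A 0)" "hd A1' = Suc (A' 0)"
      using hd_lay[OF ne1(1) p1(1)] hd_lay[OF ne1(2) p1(2)] f(6) f'(6) k(1) by auto
    have "A 0 \<noteq> A' 0" using ne layered_invol[OF layA(2)] by metis
    \<comment> \<open>The word with the larger first part contains a forbidden factor, for which the
      pair of the other word serves as replacement.\<close>
    then consider "hd A1 < hd A1'" | "hd A1' < hd A1" using hdA by linarith
    then show ?thesis
    proof cases
      case 1
      have "bad s t A1' B1'"
        unfolding bad_def f'(4)
        using 1 ne1 p1 set1 f(4,5) f'(5) k(3) perm by (intro conjI exI[of _ A1] exI[of _ B1]) auto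
      then show ?thesis using w'(4) f'(1-3) unfolding irreducible_word_def by blast
    next
      case 2
      have "bad s t A1 B1"
        unfolding bad_def f(4)
        using 2 ne1 p1 set1 f(5) f'(4,5) k(3) perm by (intro conjI exI[of _ A1'] exI[of _ B1']) auto
      then show ?thesis using w(4) f(1-3) unfolding irreducible_word_def by blast
    qed
  qed
qed

section \<open>Pushdown automata over countable types\<close>

inductive gstep :: "('q \<Rightarrow> 'a option \<Rightarrow> 'g \<Rightarrow> ('q \<times> 'g list) option) \<Rightarrow>
    'q \<times> 'a list \<times> 'g list \<Rightarrow> 'q \<times> 'a list \<times> 'g list \<Rightarrow> bool" for d where
  gread: "d q (Some a) Z = Some (p, \<beta>) \<Longrightarrow> gstep d (q, a # w, Z # \<gamma>) (p, w, \<beta> @ \<gamma>)"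
| geps: "d q None Z = Some (p, \<beta>) \<Longrightarrow> gstep d (q, w, Z # \<gamma>) (p, w, \<beta> @ \<gamma>)"

text \<open>Transports an automaton over countable types to one over numbers; the guard keeps
  transitions to codes of members of \<open>Q\<close> and \<open>G\<close>.\<close>

definition enc_dpda :: "'q::countable set \<Rightarrow> 'g::countable set \<Rightarrow> 'q \<Rightarrow> 'g \<Rightarrow> 'q set \<Rightarrow>
    ('q \<Rightarrow> 'a option \<Rightarrow> 'g \<Rightarrow> ('q \<times> 'g list) option) \<Rightarrow> 'a dpda" where
  "enc_dpda Q G q0 z0 F d = \<lparr>states = to_nat ` Q, stack_syms = to_nat ` G, init_state = to_nat q0,
     init_stack = to_nat z0, final_states = to_nat ` F,
     delta = (\<lambda>n x z. if n \<in> to_nat ` Q \<and> z \<in> to_nat ` G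
       then map_option (\<lambda>(p, \<beta>). (to_nat p, map to_nat \<beta>)) (d (from_nat n) x (from_nat z)) else None)\<rparr>"

lemma delta_enc:
  "delta (enc_dpda Q G q0 z0 F d) n x z = (if n \<in> to_nat ` Q \<and> z \<in> to_nat ` G
     then map_option (\<lambda>(p, \<beta>). (to_nat p, map to_nat \<beta>)) (d (from_nat n) x (from_nat z)) else None)"
  by (simp add: enc_dpda_def)

lemma is_dpda_enc:
  assumes "finite A" "finite Q" "finite G" "q0 \<in> Q" "z0 \<in> G" "F \<subseteq> Q"
    and cl: "\<And>q x Z p \<beta>. d q x Z = Some (p, \<beta>) \<Longrightarrow> p \<in> Q \<and> set \<beta> \<subseteq> G \<and> (\<forall>a. x = Some a \<longrightarrow> a \<in> A)"
    and det: "\<And>q Z a. d q None Z \<noteq> None \<Longrightarrow> d q (Some a) Z = None"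
  shows "is_dpda A (enc_dpda Q G q0 z0 F d)"
proof -
  let ?M = "enc_dpda Q G q0 z0 F d"
  have "q \<in> to_nat ` Q \<and> Z \<in> to_nat ` G \<and> p \<in> to_nat ` Q \<and> set \<gamma> \<subseteq> to_nat ` G \<and> (\<forall>a. x = Some a \<longrightarrow> a \<in> A)"
    if "delta ?M q x Z = Some (p, \<gamma>)" for q x Z p \<gamma>
  proof -
    have g: "q \<in> to_nat ` Q" "Z \<in> to_nat ` G"
      using that unfolding delta_enc by (meson option.distinct(1))+
    then have "map_option (\<lambda>(p, \<beta>). (to_nat p, map to_nat \<beta>)) (d (from_nat q) x (from_nat Z)) = Some (p, \<gamma>)"
      using that unfolding delta_enc by presburger
    then obtain p' \<beta> where "d (from_nat q) x (from_nat Z) = Some (p', \<beta>)" "p = to_nat p'" "\<gamma> = map to_nat \<beta>"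
      unfolding map_option_eq_Some by force
    then have "p' \<in> Q \<and> set \<beta> \<subseteq> G \<and> (\<forall>a. x = Some a \<longrightarrow> a \<in> A)" "p = to_nat p'" "set \<gamma> = to_nat ` set \<beta>"
      using cl by auto
    then show ?thesis using g by blast
  qed
  then have c1: "\<forall>q x Z p \<gamma>. delta ?M q x Z = Some (p, \<gamma>) \<longrightarrow>
      q \<in> to_nat ` Q \<and> Z \<in> to_nat ` G \<and> p \<in> to_nat ` Q \<and> set \<gamma> \<subseteq> to_nat ` G \<and> (\<forall>a. x = Some a \<longrightarrow> a \<in> A)"
    by blast
  have "delta ?M q (Some a) Z = None"
    if "delta ?M q None Z \<noteq> None" for q Z a
  proof -
    have "d (from_nat q) None (from_nat Z) \<noteq> None"
      using that unfolding delta_enc by (metis option.simps(8))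
    then have "d (from_nat q) (Some a) (from_nat Z) = None" by (rule det)
    then show ?thesis unfolding delta_enc by simp
  qed
  then have c2: "\<forall>q Z. delta ?M q None Z \<noteq> None \<longrightarrow>
      (\<forall>a. delta ?M q (Some a) Z = None)"
    by blast
  have sel: "states ?M = to_nat ` Q" "stack_syms ?M = to_nat ` G"
    "init_state ?M = to_nat q0" "init_stack ?M = to_nat z0"
    "final_states ?M = to_nat ` F"
    by (simp_all add: enc_dpda_def)
  have fin: "finite (to_nat ` Q)" "finite (to_nat ` G)" "to_nat q0 \<in> to_nat ` Q" "to_nat z0 \<in> to_nat ` G"
    "to_nat ` F \<subseteq> to_nat ` Q" using assms(2-6) by auto
  show ?thesis unfolding is_dpda_def sel by (intro conjI assms(1) fin c1 c2)
qed

text \<open>Injectivity of \<open>to_nat\<close> makes the encoding a bisimulation: a step from an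
  encoded configuration always comes from a step of the original.\<close>

lemma dpda_lang_enc:
  fixes d :: "'q::countable \<Rightarrow> 'a option \<Rightarrow> 'g::countable \<Rightarrow> ('q \<times> 'g list) option"
  assumes cl: "\<And>q x Z p \<beta>. d q x Z = Some (p, \<beta>) \<Longrightarrow> q \<in> Q \<and> Z \<in> G"
  shows "dpda_lang (enc_dpda Q G q0 z0 F d) =
    {w. \<exists>q \<gamma>. (gstep d)\<^sup>*\<^sup>* (q0, w, [z0]) (q, [], \<gamma>) \<and> q \<in> F}"
proof -
  let ?M = "enc_dpda Q G q0 z0 F d"
  define f where "f = (\<lambda>(q :: 'q, w :: 'a list, \<gamma> :: 'g list). (to_nat q, w, map to_nat \<gamma>))"
  have delta: "delta ?M (to_nat q) x (to_nat Z) = map_option (\<lambda>(p, \<beta>). (to_nat p, map to_nat \<beta>)) (d q x Z)" for q x Z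
    using cl[of q x Z] unfolding delta_enc by (cases "d q x Z") auto
  have fwd: "dpda_step ?M (f c) (f c')" if "gstep d c c'" for c c'
    using that
  proof cases
    case (gread q a Z p \<beta> w \<gamma>)
    then show ?thesis using dpda_step.read[of ?M "to_nat q" a "to_nat Z" "to_nat p" "map to_nat \<beta>" w "map to_nat \<gamma>"]
      by (simp add: f_def delta)
  next
    case (geps q Z p \<beta> w \<gamma>)
    then show ?thesis using dpda_step.eps[of ?M "to_nat q" "to_nat Z" "to_nat p" "map to_nat \<beta>" w "map to_nat \<gamma>"]
      by (simp add: f_def delta)
  qed
  have bwd: "\<exists>c'. gstep d c c' \<and> c2 = f c'" if "dpda_step ?M (f c) c2" for c c2
  proof -
    obtain q w \<gamma> where c: "c = (q, w, \<gamma>)" by (cases c) auto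
    show ?thesis using that
    proof cases
      case (read q' a Z' p' \<beta>' w' \<gamma>')
      then obtain Z \<gamma>0 where z: "\<gamma> = Z # \<gamma>0" "Z' = to_nat Z" "\<gamma>' = map to_nat \<gamma>0" "q' = to_nat q" "w = a # w'"
        unfolding c f_def by (auto simp: map_eq_Cons_conv)
      then obtain p \<beta> where "d q (Some a) Z = Some (p, \<beta>)" "p' = to_nat p" "\<beta>' = map to_nat \<beta>"
        using read delta by auto
      then show ?thesis using gstep.gread[of d q a Z p \<beta> w' \<gamma>0] z read c
        by (intro exI[of _ "(p, w', \<beta> @ \<gamma>0)"]) (simp add: f_def)
    next
      case (eps q' Z' p' \<beta>' w' \<gamma>')
      then obtain Z \<gamma>0 where z: "\<gamma> = Z # \<gamma>0" "Z' = to_nat Z" "\<gamma>' = map to_nat \<gamma>0" "q' = to_nat q" "w = w'"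
        unfolding c f_def by (auto simp: map_eq_Cons_conv)
      then obtain p \<beta> where "d q None Z = Some (p, \<beta>)" "p' = to_nat p" "\<beta>' = map to_nat \<beta>"
        using eps delta by auto
      then show ?thesis using gstep.geps[of d q Z p \<beta> w' \<gamma>0] z eps c
        by (intro exI[of _ "(p, w', \<beta> @ \<gamma>0)"]) (simp add: f_def)
    qed
  qed
  have fwds: "(dpda_step ?M)\<^sup>*\<^sup>* (f c) (f c')" if "(gstep d)\<^sup>*\<^sup>* c c'" for c c'
    using that
  proof (induction rule: rtranclp_induct)
    case (step y z)
    then show ?case using fwd[of y z] by (meson rtranclp.rtrancl_into_rtrancl)
  qed simp
  have bwds: "\<exists>c'. (gstep d)\<^sup>*\<^sup>* c c' \<and> c2 = f c'" if "(dpda_step ?M)\<^sup>*\<^sup>* (f c) c2" for c c2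
    using that
  proof (induction rule: rtranclp_induct)
    case (step y z)
    then obtain c' where c': "(gstep d)\<^sup>*\<^sup>* c c'" "y = f c'" by blast
    then obtain c3 where "gstep d c' c3" "z = f c3" using bwd step by blast
    then have "(gstep d)\<^sup>*\<^sup>* c c3" using c'(1) by (meson rtranclp.rtrancl_into_rtrancl)
    then show ?case using \<open>z = f c3\<close> by blast
  qed blast
  have init: "(init_state ?M, w, [init_stack ?M]) = f (q0, w, [z0])" for w
    by (simp add: enc_dpda_def f_def)
  have fin: "final_states ?M = to_nat ` F" by (simp add: enc_dpda_def)
  show ?thesis
  proof (intro set_eqI iffI)
    fix w assume "w \<in> dpda_lang ?M"
    then obtain q \<gamma> where q: "(dpda_step ?M)\<^sup>*\<^sup>* (f (q0, w, [z0])) (q, [], \<gamma>)" "q \<in> to_nat ` F"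
      unfolding dpda_lang_def init fin by blast
    then obtain c' where c': "(gstep d)\<^sup>*\<^sup>* (q0, w, [z0]) c'" "(q, [], \<gamma>) = f c'" using bwds by blast
    obtain q' w' \<gamma>' where "c' = (q', w', \<gamma>')" by (cases c') auto
    then have "c' = (q', [], \<gamma>')" "q = to_nat q'" using c'(2) by (auto simp: f_def)
    then show "w \<in> {w. \<exists>q \<gamma>. (gstep d)\<^sup>*\<^sup>* (q0, w, [z0]) (q, [], \<gamma>) \<and> q \<in> F}"
      using c'(1) q(2) by auto
  next
    fix w assume "w \<in> {w. \<exists>q \<gamma>. (gstep d)\<^sup>*\<^sup>* (q0, w, [z0]) (q, [], \<gamma>) \<and> q \<in> F}"
    then obtain q \<gamma> where q: "(gstep d)\<^sup>*\<^sup>* (q0, w, [z0]) (q, [], \<gamma>)" "q \<in> F" by blast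
    have "f (q, [], \<gamma>) = (to_nat q, [], map to_nat \<gamma>)" by (simp add: f_def)
    then have "(dpda_step ?M)\<^sup>*\<^sup>* (f (q0, w, [z0])) (to_nat q, [], map to_nat \<gamma>)" using fwds[OF q(1)] by simp
    then show "w \<in> dpda_lang ?M"
      unfolding dpda_lang_def init fin using q(2) by blast
  qed
qed

section \<open>Recognising irreducible words\<close>

text \<open>The working stack with every topmost element of a pushed block labelled by the prefix that
  ends with its push.\<close>
fun prun :: "op list \<Rightarrow> op list option list \<Rightarrow> op list \<Rightarrow> op list option list" where
  "prun y ps [] = ps"
| "prun y ps (Push a # w) = prun (y @ [Push a]) (Some (y @ [Push a]) # replicate (a - 1) None @ ps) w"
| "prun y ps (Pop b # w) = prun (y @ [Pop b]) (drop b ps) w"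

definition pst :: "op list \<Rightarrow> op list option list" where
  "pst w = prun [] [] w"

lemma prun_append: "prun y ps (u @ v) = prun (y @ u) (prun y ps u) v"
  by (induction y ps u rule: prun.induct) auto

lemma pst_Nil [simp]: "pst [] = []"
  by (simp add: pst_def)

lemma pst_Push [simp]: "pst (y @ [Push a]) = Some (y @ [Push a]) # replicate (a - 1) None @ pst y"
  by (simp add: pst_def prun_append)

lemma pst_Pop [simp]: "pst (y @ [Pop b]) = drop b (pst y)"
  by (simp add: pst_def prun_append)

lemma pst_Push_nth:
  assumes "1 \<le> a"
  shows "length (pst (y @ [Push a])) = a + length (pst y)" "pst (y @ [Push a]) ! (a + k) = pst y ! k"
proof -
  let ?xs = "Some (y @ [Push a]) # replicate (a - 1) None"
  have p: "pst (y @ [Push a]) = ?xs @ pst y" and l: "length ?xs = a" using assms by simp_all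
  show "length (pst (y @ [Push a])) = a + length (pst y)" unfolding p length_append l ..
  show "pst (y @ [Push a]) ! (a + k) = pst y ! k"
    unfolding p using nth_append_length_plus[of ?xs "pst y" k] unfolding l .
qed

lemma length_pst: "ht 0 y = Some l \<Longrightarrow> length (pst y) = l"
proof (induction y arbitrary: l rule: rev_induct)
  case (snoc x y)
  then show ?case by (cases x) (auto simp: ht_append_Some split: if_splits)
qed simp

text \<open>As long as a label is on the stack, everything after its push has stayed above it, so
  the rest of the word is legal from height 0.\<close>

lemma pst_prefix:
  "ht 0 y = Some l \<Longrightarrow> k < length (pst y) \<Longrightarrow> pst y ! k = Some u \<Longrightarrow> \<exists>v. y = u @ v \<and> ht 0 v = Some k"
proof (induction y arbitrary: l k rule: rev_induct)
  case (snoc x y)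
  obtain l' where l': "ht 0 y = Some l'" "ht l' [x] = Some l" using snoc(2) unfolding ht_append_Some by blast
  show ?case
  proof (cases x)
    case (Push a)
    have a: "1 \<le> a" using l' Push by (simp split: if_splits)
    show ?thesis
    proof (cases "k < a")
      case True
      have "k = 0"
      proof (rule ccontr)
        assume "k \<noteq> 0"
        then obtain k' where "k = Suc k'" "k' < a - 1" using True by (cases k) auto
        then show False using snoc(4) Push by (simp add: nth_append)
      qed
      then have "u = y @ [Push a]" using snoc(4) Push by simp
      then show ?thesis using Push \<open>k = 0\<close> by (intro exI[of _ "[]"]) simp
    next
      case False
      define k' where "k' = k - a"
      have k: "k = a + k'" using False k'_def by simp
      then have "k' < length (pst y)" using snoc(3) pst_Push_nth(1)[OF a, of y] unfolding Push by linarith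
      moreover have "pst (y @ [Push a]) ! (a + k') = Some u" using snoc(4) unfolding Push k .
      then have "pst y ! k' = Some u" unfolding pst_Push_nth(2)[OF a] .
      ultimately obtain v where "y = u @ v" "ht 0 v = Some k'" using snoc(1)[OF l'(1)] by blast
      then have "y @ [x] = u @ (v @ [Push a]) \<and> ht 0 (v @ [Push a]) = Some k"
        using Push a k by (simp add: ht_append_Some add.commute)
      then show ?thesis by blast
    qed
  next
    case (Pop b)
    have b: "1 \<le> b" using l' Pop by (simp split: if_splits)
    have "b + k < length (pst y)" "pst y ! (b + k) = Some u"
      using snoc(3,4) Pop by auto
    then obtain v where "y = u @ v" "ht 0 v = Some (b + k)" using snoc(1)[OF l'(1)] by blast
    then have "y @ [x] = u @ (v @ [Pop b]) \<and> ht 0 (v @ [Pop b]) = Some k"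
      using Pop b by (simp add: ht_append_Some)
    then show ?thesis by blast
  qed
qed simp

lemma pst_nested:
  "ht 0 v = Some k \<Longrightarrow> k < length (pst ((u @ [Push a]) @ v)) \<and> pst ((u @ [Push a]) @ v) ! k = Some (u @ [Push a])"
proof (induction v arbitrary: k rule: rev_induct)
  case (snoc x v)
  obtain k' where k': "ht 0 v = Some k'" "ht k' [x] = Some k" using snoc(2) unfolding ht_append_Some by blast
  define Y where "Y = (u @ [Push a]) @ v"
  have IH: "k' < length (pst Y)" "pst Y ! k' = Some (u @ [Push a])" using snoc(1)[OF k'(1)] unfolding Y_def by auto
  have ap: "(u @ [Push a]) @ v @ [x] = Y @ [x]" unfolding Y_def by simp
  show ?case
  proof (cases x)
    case (Push c)
    then have "1 \<le> c" "k = c + k'" using k' by (auto split: if_splits)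
    then show ?thesis using IH pst_Push_nth[of c Y] unfolding ap unfolding Push by (simp del: pst_Push)
  next
    case (Pop c)
    then have "c \<le> k'" "k = k' - c" using k' by (auto split: if_splits)
    then show ?thesis using IH unfolding ap unfolding Pop pst_Pop by auto
  qed
qed simp

fun leadpush :: "op list \<Rightarrow> nat list" where
  "leadpush (Push a # w) = a # leadpush w"
| "leadpush _ = []"

text \<open>Sizes of the trailing pushes, most recent first.\<close>
definition tp :: "op list \<Rightarrow> nat list" where
  "tp y = leadpush (rev y)"

lemma tp_simps [simp]: "tp [] = []" "tp (y @ [Push a]) = a # tp y" "tp (y @ [Pop b]) = []"
  by (simp_all add: tp_def)

lemma tp_append: "tp (u @ map Push A) = rev A @ tp u"
proof (induction A rule: rev_induct)
  case (snoc a A)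
  have "tp (u @ map Push (A @ [a])) = tp ((u @ map Push A) @ [Push a])" by simp
  also have "\<dots> = a # tp (u @ map Push A)" by (rule tp_simps(2))
  finally show ?case using snoc by simp
qed simp

lemma tp_prefix: "tp y = X @ Y \<Longrightarrow> \<exists>u. y = u @ map Push (rev X)"
proof (induction y arbitrary: X rule: rev_induct)
  case (snoc x y)
  show ?case
  proof (cases X)
    case (Cons a X')
    then have x: "x = Push a" "tp y = X' @ Y" using snoc(2) by (cases x; simp)+
    then obtain u where "y = u @ map Push (rev X')" using snoc(1) by blast
    then show ?thesis using x Cons by auto
  qed simp
qed simp

lemma set_tp: "set (tp y) \<subseteq> set (pushes y)"
proof (induction y rule: rev_induct)
  case (snoc x y)
  then show ?case by (cases x) auto
qed simp

text \<open>The finite trace of a label. An element inside a block gets the empty record, since no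
  push ends with it on top.\<close>

definition absS :: "nat \<Rightarrow> op list option \<Rightarrow> nat list" where
  "absS N e = (case e of None \<Rightarrow> [] | Some u \<Rightarrow> take N (tp u))"

definition ends_pop :: "op list \<Rightarrow> bool" where
  "ends_pop y \<longleftrightarrow> (\<exists>y0 b. y = y0 @ [Pop b])"

definition ends_push :: "op list \<Rightarrow> bool" where
  "ends_push y \<longleftrightarrow> (\<exists>y0 a. y = y0 @ [Push a])"

lemma ends_simps [simp]:
  "ends_pop (y @ [Pop b])" "\<not> ends_pop (y @ [Push a])" "\<not> ends_pop []"
  "ends_push (y @ [Push a])" "\<not> ends_push (y @ [Pop b])" "\<not> ends_push []"
  by (auto simp: ends_pop_def ends_push_def)

lemma ends_cases: "y = [] \<or> ends_pop y \<or> ends_push y"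
proof (cases y rule: rev_cases)
  case (snoc y0 x)
  then show ?thesis by (cases x) auto
qed simp

text \<open>What the top symbol records.  Directly after a push nothing is recorded, because the nested
  word of a forbidden factor is nonempty.\<close>
definition top_hist :: "nat \<Rightarrow> op list \<Rightarrow> nat list" where
  "top_hist N y = (if ends_pop y \<and> pst y \<noteq> [] then absS N (hd (pst y)) else [])"

fun leadpop :: "nat \<Rightarrow> op list \<Rightarrow> (nat list \<times> nat) list" where
  "leadpop N (Pop b # w) = (top_hist N (rev w), b) # leadpop N w"
| "leadpop N _ = []"

text \<open>The trailing pops, most recent first, each with the record on top of the stack before it.\<close>
definition tr :: "nat \<Rightarrow> op list \<Rightarrow> (nat list \<times> nat) list" where
  "tr N y = leadpop N (rev y)"

lemma tr_simps [simp]: "tr N [] = []" "tr N (y @ [Push a]) = []"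
  "tr N (y @ [Pop b]) = (top_hist N y, b) # tr N y"
  by (simp_all add: tr_def)

lemma tr_split:
  "length B = Suc j \<Longrightarrow> Suc j \<le> length (tr N (y @ map Pop B)) \<and>
    rev (map snd (take (Suc j) (tr N (y @ map Pop B)))) = B \<and> fst (tr N (y @ map Pop B) ! j) = top_hist N y"
proof (induction B arbitrary: j rule: rev_induct)
  case (snoc b B)
  have e: "tr N (y @ map Pop (B @ [b])) = (top_hist N (y @ map Pop B), b) # tr N (y @ map Pop B)"
    using tr_simps(3)[of N "y @ map Pop B" b] by (simp del: tr_simps)
  show ?case
  proof (cases j)
    case 0
    then show ?thesis using snoc(2) e by simp
  next
    case (Suc j')
    then show ?thesis using snoc e by simp
  qed
qed simp

lemma tr_exists: "j < length (tr N y) \<Longrightarrow> \<exists>y1 B. y = y1 @ map Pop B \<and> length B = Suc j"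
proof (induction y arbitrary: j rule: rev_induct)
  case (snoc x y)
  show ?case
  proof (cases x)
    case (Pop b)
    show ?thesis
    proof (cases j)
      case 0
      then show ?thesis using Pop by (intro exI[of _ y] exI[of _ "[b]"]) simp
    next
      case (Suc j')
      then have "j' < length (tr N y)" using snoc(2) Pop by simp
      then obtain y1 B where "y = y1 @ map Pop B" "length B = Suc j'" using snoc(1) by blast
      then show ?thesis using Pop Suc by (intro exI[of _ y1] exI[of _ "B @ [b]"]) simp
    qed
  qed (use snoc in simp)
qed simp

text \<open>The last \<open>Suc j\<close> pops are the candidate for \<open>B\<close>, and
  \<open>R ! j\<close> holds the record seen before them. Its initial segments, turned back into
  reading order, are the candidates for \<open>A\<close>.\<close>

definition chk :: "nat \<Rightarrow> nat \<Rightarrow> (nat list \<times> nat) list \<Rightarrow> bool" where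
  "chk s t R \<longleftrightarrow> (\<forall>j<length R. \<forall>l. \<not> bad s t (rev (take l (fst (R ! j)))) (rev (map snd (take (Suc j) R))))"

definition has_bad_end :: "nat \<Rightarrow> nat \<Rightarrow> op list \<Rightarrow> bool" where
  "has_bad_end s t y \<longleftrightarrow> (\<exists>u A v B. y = u @ map Push A @ v @ map Pop B \<and> v \<noteq> [] \<and> well_formed v \<and> bad s t A B)"

lemma length_le_sum: "\<forall>a\<in>set A. (1::nat) \<le> a \<Longrightarrow> length A \<le> sum_list A"
  by (induction A) auto

lemma bad_lengths:
  assumes "bad s t A B"
  shows "A \<noteq> []" "B \<noteq> []" "length A \<le> 2 * max s t" "length B \<le> 2 * max s t"
proof -
  have b: "A \<noteq> []" "\<forall>a\<in>set A. 1 \<le> a" "\<forall>b\<in>set B. 1 \<le> b" "sum_list B = sum_list A" "sum_list A \<le> 2 * max s t"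
    using assms unfolding bad_def by blast+
  show "A \<noteq> []" by fact
  have "0 < length A" using b(1) by simp
  then have "0 < sum_list A" using length_le_sum[OF b(2)] by linarith
  then show "B \<noteq> []" using b(4) by (metis less_irrefl sum_list.Nil)
  show "length A \<le> 2 * max s t" "length B \<le> 2 * max s t"
    using length_le_sum[OF b(2)] length_le_sum[OF b(3)] b(4,5) by linarith+
qed

text \<open>Truncation to \<open>N\<close> loses nothing: the parts of a forbidden pair are positive
  with sum at most \<open>N\<close>, so both lists have at most \<open>N\<close> entries.\<close>

lemma chk_iff:
  assumes N: "N = 2 * max s t" and ht: "ht 0 y = Some l" and y: "Y = y @ [Pop b]"
  shows "chk s t (take N (tr N Y)) \<longleftrightarrow> \<not> has_bad_end s t Y"
proof
  assume c: "chk s t (take N (tr N Y))"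
  show "\<not> has_bad_end s t Y"
  proof
    assume "has_bad_end s t Y"
    then obtain u A v B where f: "Y = u @ map Push A @ v @ map Pop B" "v \<noteq> []" "well_formed v" "bad s t A B"
      unfolding has_bad_end_def by blast
    note bl = bad_lengths[OF f(4)]
    obtain j where j: "length B = Suc j" using bl(2) by (cases B) auto
    have jN: "j < N" using bl(4) j N by simp
    let ?y1 = "u @ map Push A @ v"
    have Y: "Y = ?y1 @ map Pop B" using f(1) by simp
    have T: "Suc j \<le> length (tr N Y)" "rev (map snd (take (Suc j) (tr N Y))) = B" "fst (tr N Y ! j) = top_hist N ?y1"
      using tr_split[OF j, of N ?y1] unfolding Y by blast+
    obtain A0 a where A: "A = A0 @ [a]" using bl(1) by (cases A rule: rev_cases) auto
    have y1: "?y1 = ((u @ map Push A0) @ [Push a]) @ v" using A by simp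
    have "ht 0 v = Some 0" using f(3) by (simp add: well_formed_ht)
    from pst_nested[OF this, of "u @ map Push A0" a]
    have p: "pst ?y1 \<noteq> []" "hd (pst ?y1) = Some ((u @ map Push A0) @ [Push a])"
      unfolding y1[symmetric] by (auto simp: hd_conv_nth)
    obtain v' b' where "v = v' @ [Pop b']" using well_formed_last[OF f(3,2)] by blast
    then have "ends_pop ?y1" unfolding ends_pop_def by auto
    then have "top_hist N ?y1 = take N (tp ((u @ map Push A0) @ [Push a]))"
      unfolding top_hist_def absS_def using p by simp
    also have "(u @ map Push A0) @ [Push a] = u @ map Push A" using A by simp
    finally have "top_hist N ?y1 = take N (rev A @ tp u)" unfolding tp_append .
    then have "rev (take (length A) (top_hist N ?y1)) = A" using bl(3) N by (simp add: min_def)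
    moreover have "take N (tr N Y) ! j = tr N Y ! j" "take (Suc j) (take N (tr N Y)) = take (Suc j) (tr N Y)"
      "j < length (take N (tr N Y))"
      using jN T(1) by (auto simp: min_def)
    ultimately show False
      using c[unfolded chk_def, rule_format, of j "length A"] T(2,3) f(4) by simp
  qed
next
  assume nb: "\<not> has_bad_end s t Y"
  show "chk s t (take N (tr N Y))"
    unfolding chk_def
  proof (intro allI impI notI)
    fix j k assume j: "j < length (take N (tr N Y))"
      and bad: "bad s t (rev (take k (fst (take N (tr N Y) ! j)))) (rev (map snd (take (Suc j) (take N (tr N Y)))))"
    have jN: "j < N" "j < length (tr N Y)" using j by auto
    obtain y1 B where Y: "Y = y1 @ map Pop B" "length B = Suc j" using tr_exists[OF jN(2)] by blast
    have T: "rev (map snd (take (Suc j) (tr N Y))) = B" "fst (tr N Y ! j) = top_hist N y1"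
      using tr_split[OF Y(2), of N y1] unfolding Y(1) by blast+
    have e: "take N (tr N Y) ! j = tr N Y ! j" "take (Suc j) (take N (tr N Y)) = take (Suc j) (tr N Y)"
      using jN by (auto simp: min_def)
    define A where "A = rev (take k (top_hist N y1))"
    have bad': "bad s t A B" using bad unfolding e T A_def .
    then have th: "top_hist N y1 \<noteq> []" using bad_lengths(1)[OF bad'] unfolding A_def by auto
    then have ep: "ends_pop y1" "pst y1 \<noteq> []" "absS N (hd (pst y1)) \<noteq> []" "top_hist N y1 = absS N (hd (pst y1))"
      unfolding top_hist_def by (auto split: if_splits)
    then obtain u where u: "hd (pst y1) = Some u" "top_hist N y1 = take N (tp u)"
      unfolding absS_def by (cases "hd (pst y1)") auto
    obtain B0 where B0: "B = B0 @ [b]" "y = y1 @ map Pop B0"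
    proof -
      obtain B0 b' where "B = B0 @ [b']" using Y(2) by (cases B rule: rev_cases) auto
      then show thesis using that Y(1) y by auto
    qed
    obtain l1 where "ht 0 y1 = Some l1" using ht unfolding B0(2) ht_append_Some by blast
    moreover have "pst y1 ! 0 = Some u" "0 < length (pst y1)" using u(1) ep(2) by (auto simp: hd_conv_nth)
    ultimately obtain v where v: "y1 = u @ v" "ht 0 v = Some 0" using pst_prefix by blast
    have "tp u = take k (take N (tp u)) @ drop (min k N) (tp u)" by (simp add: min_def)
    then obtain u0 where u0: "u = u0 @ map Push (rev (take k (take N (tp u))))" using tp_prefix by blast
    then have u0': "u = u0 @ map Push A" unfolding A_def u(2) .
    \<comment> \<open>With \<open>v\<close> empty, \<open>u\<close> would end in a pop and leave no
      pushes on record.\<close>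
    have "v \<noteq> []"
    proof
      assume "v = []"
      then have "ends_pop u" using v ep by simp
      then have "tp u = []" unfolding ends_pop_def by auto
      then show False using th u by simp
    qed
    moreover have "Y = u0 @ map Push A @ v @ map Pop B" using Y(1) v(1) u0' by simp
    ultimately show False using nb bad' v(2) unfolding has_bad_end_def well_formed_ht by blast
  qed
qed

text \<open>The part of the language that can be checked on prefixes; acceptance adds only that the
  working stack is empty.\<close>

definition admissible :: "nat \<Rightarrow> nat \<Rightarrow> op list \<Rightarrow> bool" where
  "admissible s t y \<longleftrightarrow> ht 0 y \<noteq> None \<and> set y \<subseteq> op_alphabet s t \<and> reduced y \<and> irreducible_word s t y"

text \<open>A forbidden factor that is new after appending one operation must end with that
  operation.\<close>

lemma irreducible_snoc:
  "irreducible_word s t (y @ [x]) \<longleftrightarrow> irreducible_word s t y \<and> \<not> has_bad_end s t (y @ [x])"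
proof
  assume i: "irreducible_word s t (y @ [x])"
  have "irreducible_word s t y"
    unfolding irreducible_word_def
  proof (rule notI, elim exE conjE)
    fix u A v B z assume f: "y = u @ map Push A @ v @ map Pop B @ z" "v \<noteq> []" "well_formed v" "bad s t A B"
    then have "y @ [x] = u @ map Push A @ v @ map Pop B @ (z @ [x])" by simp
    then show False using i f unfolding irreducible_word_def by blast
  qed
  moreover have "\<not> has_bad_end s t (y @ [x])"
  proof
    assume "has_bad_end s t (y @ [x])"
    then obtain u A v B where f: "y @ [x] = u @ map Push A @ v @ map Pop B" "v \<noteq> []" "well_formed v" "bad s t A B"
      unfolding has_bad_end_def by blast
    then have "y @ [x] = u @ map Push A @ v @ map Pop B @ []" by simp
    then show False using i f(2-) unfolding irreducible_word_def by blast
  qed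
  ultimately show "irreducible_word s t y \<and> \<not> has_bad_end s t (y @ [x])" ..
next
  assume i: "irreducible_word s t y \<and> \<not> has_bad_end s t (y @ [x])"
  show "irreducible_word s t (y @ [x])"
    unfolding irreducible_word_def
  proof (rule notI, elim exE conjE)
    fix u A v B z assume f: "y @ [x] = u @ map Push A @ v @ map Pop B @ z" "v \<noteq> []" "well_formed v" "bad s t A B"
    show False
    proof (cases z rule: rev_cases)
      case Nil
      then show ?thesis using i f unfolding has_bad_end_def by auto
    next
      case (snoc z' x')
      then have "y = u @ map Push A @ v @ map Pop B @ z'" using f(1) by auto
      then show ?thesis using i f(2-) unfolding irreducible_word_def by blast
    qed
  qed
qed

lemma no_bad_end_Push: "\<not> has_bad_end s t (y @ [Push a])"
proof
  assume "has_bad_end s t (y @ [Push a])"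
  then obtain u A v B where f: "y @ [Push a] = u @ map Push A @ v @ map Pop B" "bad s t A B"
    unfolding has_bad_end_def by blast
  obtain B0 b where "B = B0 @ [b]" using bad_lengths(2)[OF f(2)] by (cases B rule: rev_cases) auto
  then show False using f(1) by simp
qed

lemma admissible_Nil: "admissible s t []"
  unfolding admissible_def
  by (auto simp: reduced_split irreducible_word_def)

lemma reduced_snoc_Push: "reduced (y @ [Push a]) \<longleftrightarrow> reduced y"
  unfolding reduced_append by (auto simp: reduced_split Cons_eq_append_conv)

lemma reduced_snoc_Pop: "reduced (y @ [Pop b]) \<longleftrightarrow> reduced y \<and> (\<forall>y0 a. y = y0 @ [Push a] \<longrightarrow> a = 1 \<and> b = 1)"
  unfolding reduced_append by (auto simp: reduced_split Cons_eq_append_conv)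

lemma admissible_Push: "admissible s t (y @ [Push a]) \<longleftrightarrow> admissible s t y \<and> Push a \<in> op_alphabet s t"
  unfolding admissible_def reduced_snoc_Push irreducible_snoc
  using no_bad_end_Push by (auto simp: ht_append op_alphabet_def split: option.splits bind_splits)

lemma admissible_Pop:
  assumes N: "N = 2 * max s t"
  shows "admissible s t (y @ [Pop b]) \<longleftrightarrow> admissible s t y \<and> Pop b \<in> op_alphabet s t \<and> b \<le> length (pst y) \<and>
    (\<forall>y0 a. y = y0 @ [Push a] \<longrightarrow> a = 1 \<and> b = 1) \<and> chk s t (take N (tr N (y @ [Pop b])))"
proof (cases "ht 0 y")
  case None
  then show ?thesis unfolding admissible_def by (simp add: ht_append)
next
  case (Some l)
  have "ht 0 (y @ [Pop b]) \<noteq> None \<longleftrightarrow> 1 \<le> b \<and> b \<le> length (pst y)"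
    using Some length_pst[OF Some] by (simp add: ht_append)
  then show ?thesis
    unfolding admissible_def reduced_snoc_Pop irreducible_snoc chk_iff[OF N Some refl]
    using Some by (auto simp: op_alphabet_def)
qed

section \<open>The pushdown automaton\<close>

text \<open>\<open>Up H\<close>: the last operation was a push, \<open>H\<close> are the recent pushes.  \<open>Dn c R\<close>: inside a run
  of pops with recent pops \<open>R\<close>, and \<open>c\<close> elements of the current block still have to be removed.
  \<open>Fin\<close>: the working stack is empty.  The bottom symbol is \<open>None\<close>.\<close>
datatype mst = Up "nat list" | Dn nat "(nat list \<times> nat) list" | Fin

instance mst :: countable
  by countable_datatype

definition push_move :: "nat \<Rightarrow> nat list \<Rightarrow> nat \<Rightarrow> nat list option \<Rightarrow> (mst \<times> nat list option list) option" where
  "push_move N H a Z = Some (Up (take N (a # H)), Some (take N (a # H)) # replicate (a - 1) (Some []) @ [Z])"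

text \<open>A pop after a push must complete the peak \<open>Push 1\<close>, \<open>Pop 1\<close>
  and needs no check, its record being empty. Any other pop is checked when it is read; its
  remaining elements are removed by epsilon moves, which get stuck on underflow. Uncovering the
  bottom symbol leads to the accepting state by an epsilon move.\<close>

fun raw :: "nat \<Rightarrow> nat \<Rightarrow> nat \<Rightarrow> mst \<Rightarrow> op option \<Rightarrow> nat list option \<Rightarrow> (mst \<times> nat list option list) option" where
  "raw N s t (Up H) (Some (Push a)) Z = push_move N H a Z"
| "raw N s t (Dn 0 R) (Some (Push a)) (Some X) = push_move N [] a (Some X)"
| "raw N s t Fin (Some (Push a)) None = push_move N [] a None"
| "raw N s t (Up H) (Some (Pop b)) (Some X) = (if take 1 H = [1] \<and> b = 1 then Some (Dn 0 [([], 1)], []) else None)"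
| "raw N s t (Dn 0 R) (Some (Pop b)) (Some X) =
    (if chk s t (take N ((X, b) # R)) then Some (Dn (b - 1) (take N ((X, b) # R)), []) else None)"
| "raw N s t (Dn (Suc c) R) None (Some X) = Some (Dn c R, [])"
| "raw N s t (Dn 0 R) None None = Some (Fin, [None])"
| "raw N s t _ _ _ = None"

locale machine =
  fixes s t N :: nat
  assumes s: "1 \<le> s" and t: "1 \<le> t" and N: "N = 2 * max s t"
begin

definition HL :: "nat list set" where
  "HL = {H. set H \<subseteq> {1..s} \<and> length H \<le> N}"

definition RL :: "(nat list \<times> nat) list set" where
  "RL = {R. set R \<subseteq> HL \<times> {1..t} \<and> length R \<le> N}"

definition Q :: "mst set" where
  "Q = Up ` HL \<union> (\<lambda>(c, R). Dn c R) ` ({..t} \<times> RL) \<union> {Fin}"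

definition G :: "nat list option set" where
  "G = insert None (Some ` HL)"

text \<open>The guard confines \<open>raw\<close>, which lives on infinite types, to finite sets of
  states, stack symbols and letters.\<close>

definition d :: "mst \<Rightarrow> op option \<Rightarrow> nat list option \<Rightarrow> (mst \<times> nat list option list) option" where
  "d q x Z = (if q \<in> Q \<and> Z \<in> G \<and> (\<forall>a. x = Some a \<longrightarrow> a \<in> op_alphabet s t) then raw N s t q x Z else None)"

lemma N2: "2 \<le> N"
  using s N by simp

lemma finite_HL: "finite HL"
  unfolding HL_def by (rule finite_lists_length_le) simp

lemma finite_Q: "finite Q"
proof -
  have "finite RL" unfolding RL_def by (rule finite_lists_length_le) (simp add: finite_HL)
  then show ?thesis unfolding Q_def using finite_HL by simp
qed

lemma finite_G: "finite G"
  unfolding G_def using finite_HL by simp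

lemma Q_simps [simp]: "Up H \<in> Q \<longleftrightarrow> H \<in> HL" "Dn c R \<in> Q \<longleftrightarrow> c \<le> t \<and> R \<in> RL" "Fin \<in> Q"
  unfolding Q_def by auto

lemma G_simps [simp]: "None \<in> G" "Some H \<in> G \<longleftrightarrow> H \<in> HL"
  unfolding G_def by auto

lemma HL_Nil [simp]: "[] \<in> HL"
  by (simp add: HL_def)

lemma HL_take: "set H \<subseteq> {1..s} \<Longrightarrow> take N H \<in> HL"
  unfolding HL_def using set_take_subset[of N H] by auto

lemma HL_Cons: "H \<in> HL \<Longrightarrow> 1 \<le> a \<Longrightarrow> a \<le> s \<Longrightarrow> take N (a # H) \<in> HL"
  by (rule HL_take) (auto simp: HL_def)

lemma RL_Cons: "R \<in> RL \<Longrightarrow> X \<in> HL \<Longrightarrow> 1 \<le> b \<Longrightarrow> b \<le> t \<Longrightarrow> take N ((X, b) # R) \<in> RL"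
  unfolding RL_def using set_take_subset[of N "(X, b) # R"] by fastforce

lemma Push_alphabet [simp]: "Push a \<in> op_alphabet s t \<longleftrightarrow> 1 \<le> a \<and> a \<le> s"
  by (auto simp: op_alphabet_def)

lemma Pop_alphabet [simp]: "Pop b \<in> op_alphabet s t \<longleftrightarrow> 1 \<le> b \<and> b \<le> t"
  by (auto simp: op_alphabet_def)

lemma push_move_closed:
  "push_move N H a Z = Some (p, \<beta>) \<Longrightarrow> H \<in> HL \<Longrightarrow> Z \<in> G \<Longrightarrow> 1 \<le> a \<Longrightarrow> a \<le> s \<Longrightarrow> p \<in> Q \<and> set \<beta> \<subseteq> G"
  unfolding push_move_def using HL_Cons[of H a] by (auto simp: set_replicate_conv_if split: if_splits)

lemma d_closed:
  assumes "d q x Z = Some (p, \<beta>)"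
  shows "q \<in> Q \<and> Z \<in> G \<and> p \<in> Q \<and> set \<beta> \<subseteq> G \<and> (\<forall>a. x = Some a \<longrightarrow> a \<in> op_alphabet s t)"
proof -
  have g: "q \<in> Q" "Z \<in> G" "\<And>a. x = Some a \<Longrightarrow> a \<in> op_alphabet s t" and r: "raw N s t q x Z = Some (p, \<beta>)"
    using assms unfolding d_def by (auto split: if_splits)
  have "p \<in> Q \<and> set \<beta> \<subseteq> G"
  proof (cases q)
    case (Up H)
    then obtain a where x: "x = Some a" using r by (cases x) auto
    show ?thesis
    proof (cases a)
      case (Push k)
      then show ?thesis using push_move_closed[of H k Z p \<beta>] Up x r g by auto
    next
      case (Pop b)
      then obtain X where "Z = Some X" using Up x r by (cases Z) auto
      then show ?thesis using Up x r Pop t N2 by (auto split: if_splits simp: RL_def)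
    qed
  next
    case (Dn c R)
    show ?thesis
    proof (cases c)
      case 0
      show ?thesis
      proof (cases Z)
        case None
        then show ?thesis using r Dn 0 by (cases x; cases "the x") auto
      next
        case (Some X)
        then obtain a where x: "x = Some a" using r Dn 0 by (cases x) auto
        show ?thesis
        proof (cases a)
          case (Push k)
          then show ?thesis using push_move_closed[of "[]" k Z p \<beta>] Dn 0 Some x r g by auto
        next
          case (Pop b)
          then show ?thesis using RL_Cons[of R X b] Dn 0 Some x r g by (auto split: if_splits)
        qed
      qed
    next
      case (Suc c')
      then show ?thesis using r Dn g by (cases x; cases "the x"; cases Z) auto
    qed
  next
    case Fin
    then obtain k where "x = Some (Push k)" "Z = None" using r by (cases x; cases "the x"; cases Z) auto
    then show ?thesis using push_move_closed[of "[]" k Z p \<beta>] Fin r g by auto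
  qed
  then show ?thesis using g by blast
qed

lemma d_det: "d q None Z \<noteq> None \<Longrightarrow> d q (Some a) Z = None"
  unfolding d_def
proof (cases q)
  case (Dn c R)
  assume "(if q \<in> Q \<and> Z \<in> G \<and> (\<forall>a. None = Some a \<longrightarrow> a \<in> op_alphabet s t) then raw N s t q None Z else None) \<noteq> None"
  then show "(if q \<in> Q \<and> Z \<in> G \<and> (\<forall>a'. Some a = Some a' \<longrightarrow> a' \<in> op_alphabet s t) then raw N s t q (Some a) Z else None) = None"
    using Dn by (cases c; cases Z; cases a) (auto split: if_splits)
qed auto

definition stk :: "op list option list \<Rightarrow> nat list option list" where
  "stk ps = map (Some \<circ> absS N) ps @ [None]"

lemma stk_G: "admissible s t y \<Longrightarrow> set (stk (drop k (pst y))) \<subseteq> G"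
proof -
  assume a: "admissible s t y"
  have "absS N e \<in> HL" if e: "e \<in> set (pst y)" for e
  proof (cases e)
    case (Some u)
    obtain l k where "ht 0 y = Some l" "k < length (pst y)" "pst y ! k = Some u"
      using a e Some unfolding admissible_def by (auto simp: in_set_conv_nth)
    then obtain v where "y = u @ v" using pst_prefix by blast
    then have "set u \<subseteq> op_alphabet s t" using a unfolding admissible_def by auto
    then have "set (tp u) \<subseteq> {1..s}" using set_tp[of u] pushes_alphabet by blast
    then show ?thesis using Some HL_take unfolding absS_def by simp
  qed (simp add: absS_def)
  then show ?thesis unfolding stk_def using set_drop_subset[of k "pst y"] by auto
qed

lemma tp_HL: "admissible s t y \<Longrightarrow> take N (tp y) \<in> HL"
  using set_tp[of y] pushes_alphabet[of y s t] by (intro HL_take) (auto simp: admissible_def)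

lemma top_hist_HL: "admissible s t y \<Longrightarrow> top_hist N y \<in> HL"
  using stk_G[of y 0] unfolding top_hist_def stk_def by (cases "pst y") auto

lemma tr_RL: "admissible s t y \<Longrightarrow> take N (tr N y) \<in> RL"
proof -
  have "set (tr N y) \<subseteq> HL \<times> {1..t}" if "admissible s t y" for y
    using that
  proof (induction y rule: rev_induct)
    case (snoc x y)
    show ?case
    proof (cases x)
      case (Pop b)
      then have "admissible s t y" "1 \<le> b" "b \<le> t" using snoc(2) admissible_Pop[OF N, of y b] by auto
      then show ?thesis using snoc(1) Pop top_hist_HL[of y] by auto
    qed simp
  qed simp
  then show "admissible s t y \<Longrightarrow> take N (tr N y) \<in> RL"
    unfolding RL_def using set_take_subset[of N "tr N y"] by fastforce
qed

lemma take_tr: "take N (tr N (y @ [Pop b])) = take N ((top_hist N y, b) # take N (tr N y))"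
  using N2 by (cases N) (auto simp: min_def)

lemma take_tp: "take N (tp (y @ [Push a])) = take N (a # take N (tp y))"
  using N2 by (cases N) (auto simp: min_def)

lemma stk_Push:
  "stk (pst (y @ [Push a])) = Some (take N (tp (y @ [Push a]))) # replicate (a - 1) (Some []) @ stk (pst y)"
  by (simp add: stk_def absS_def)

section \<open>Soundness: reachable configurations describe admissible prefixes\<close>

text \<open>What is known once the pop has been read; whether the stack is deep enough shows only
  during the epsilon moves.\<close>

definition pre :: "op list \<Rightarrow> nat \<Rightarrow> bool" where
  "pre y b \<longleftrightarrow> admissible s t y \<and> 1 \<le> b \<and> b \<le> t \<and> (\<forall>y0 a. y = y0 @ [Push a] \<longrightarrow> a = 1 \<and> b = 1) \<and>
    chk s t (take N (tr N (y @ [Pop b])))"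

lemma admissible_Pop_pre: "admissible s t (y @ [Pop b]) \<longleftrightarrow> pre y b \<and> b \<le> length (pst y)"
  unfolding admissible_Pop[OF N] pre_def by auto

text \<open>The invariant of a run: the consumed prefix determines state and stack. In
  \<open>dn\<close> the last pop is in progress and \<open>c\<close> elements remain to be
  removed.\<close>

inductive reach :: "op list \<Rightarrow> mst \<times> op list \<times> nat list option list \<Rightarrow> bool" where
  up: "admissible s t y \<Longrightarrow> ends_push y \<Longrightarrow> reach (y @ x) (Up (take N (tp y)), x, stk (pst y))"
| fin: "admissible s t y \<Longrightarrow> pst y = [] \<Longrightarrow> reach (y @ x) (Fin, x, [None])"
| dn: "pre y b \<Longrightarrow> c < b \<Longrightarrow> b - c \<le> length (pst y) \<Longrightarrow>
    reach (y @ Pop b # x) (Dn c (take N (tr N (y @ [Pop b]))), x, stk (drop (b - c) (pst y)))"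

lemma tp_empty: "\<not> ends_push y \<Longrightarrow> tp y = []"
  using ends_cases[of y] by (auto simp: ends_pop_def)

lemma pst_empty: "pst y = [] \<Longrightarrow> \<not> ends_push y"
  by (auto simp: ends_push_def)

lemma tr_after_push: "ends_push y \<Longrightarrow> tr N (y @ [Pop b]) = [([], b)]"
  by (auto simp: ends_push_def top_hist_def)

lemma chk_leaf: "chk s t [([], b)]"
  unfolding chk_def using bad_lengths(1) by fastforce

lemma reach_up_Push:
  assumes "admissible s t y" "1 \<le> a" "a \<le> s"
  shows "reach (y @ Push a # x) (Up (take N (a # take N (tp y))), x,
    Some (take N (a # take N (tp y))) # replicate (a - 1) (Some []) @ stk (pst y))"
proof -
  have "admissible s t (y @ [Push a])" using assms by (simp add: admissible_Push)
  from up[OF this, of x] show ?thesis unfolding stk_Push take_tp by simp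
qed

lemma stk_cases:
  obtains "ps = []" "stk ps = [None]" | e ps' where "ps = e # ps'" "stk ps = Some (absS N e) # stk ps'"
  by (cases ps) (auto simp: stk_def)

lemma reach_step:
  assumes "reach w c" "gstep d c c'"
  shows "reach w c'"
  using assms(1)
proof cases
  case (up y x)
  have ne: "pst y \<noteq> []" using up(4) pst_empty by blast
  then obtain e ps where e: "pst y = e # ps" "stk (pst y) = Some (absS N e) # stk ps"
    by (cases rule: stk_cases[of "pst y"]) auto
  show ?thesis using assms(2)
  proof cases
    case (gread q a Z p \<beta> w' \<gamma>)
    then have q: "q = Up (take N (tp y))" "x = a # w'" "Z = Some (absS N e)" "\<gamma> = stk ps" using up e by auto
    have al: "a \<in> op_alphabet s t" and r: "raw N s t q (Some a) Z = Some (p, \<beta>)"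
      using gread(3) unfolding d_def by (auto split: if_splits)
    show ?thesis
    proof (cases a)
      case (Push k)
      then have "p = Up (take N (k # take N (tp y)))"
        "\<beta> @ \<gamma> = Some (take N (k # take N (tp y))) # replicate (k - 1) (Some []) @ stk (pst y)"
        using r q e by (auto simp: push_move_def)
      then show ?thesis using reach_up_Push[OF up(3), of k w'] al Push up(1) q gread(2) by simp
    next
      case (Pop b)
      obtain y0 k where y0: "y = y0 @ [Push k]" using up(4) unfolding ends_push_def by blast
      have "take 1 (take N (tp y)) = [k]" using y0 N2 by (cases N) auto
      then have kb: "k = 1" "b = 1" and pb: "p = Dn 0 [([], 1)]" "\<beta> = []"
        using r q Pop by (auto split: if_splits)
      have tr: "take N (tr N (y @ [Pop 1])) = [([], 1)]" using tr_after_push[OF up(4)] N2 by simp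
      have "pre y 1" unfolding pre_def tr using up(3) t chk_leaf y0 kb by simp
      then have "reach (y @ Pop 1 # w') (Dn 0 (take N (tr N (y @ [Pop 1]))), w', stk (drop (1 - 0) (pst y)))"
        by (rule dn) (use e in auto)
      then show ?thesis using tr pb q e up(1) gread(2) Pop kb by simp
    qed
  next
    case (geps q Z p \<beta> w' \<gamma>)
    then have "q = Up (take N (tp y))" using up by simp
    then show ?thesis using geps(3) unfolding d_def by (auto split: if_splits)
  qed
next
  case (fin y x)
  have tp0: "tp y = []" using pst_empty[OF fin(4)] tp_empty by blast
  show ?thesis using assms(2)
  proof cases
    case (gread q a Z p \<beta> w' \<gamma>)
    then have q: "q = Fin" "x = a # w'" "Z = None" "\<gamma> = []" using fin by auto
    have al: "a \<in> op_alphabet s t" and r: "raw N s t q (Some a) Z = Some (p, \<beta>)"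
      using gread(3) unfolding d_def by (auto split: if_splits)
    show ?thesis
    proof (cases a)
      case (Push k)
      then have "p = Up (take N [k])" "\<beta> @ \<gamma> = Some (take N [k]) # replicate (k - 1) (Some []) @ [None]"
        using r q by (auto simp: push_move_def)
      then show ?thesis using reach_up_Push[OF fin(3), of k w'] al Push fin(1,4) q gread(2) tp0
        by (simp add: stk_def)
    next
      case (Pop b)
      then show ?thesis using r q by simp
    qed
  next
    case (geps q Z p \<beta> w' \<gamma>)
    then have "q = Fin" using fin by simp
    then show ?thesis using geps(3) unfolding d_def by (auto split: if_splits)
  qed
next
  case (dn y b c0 x)
  let ?R = "take N (tr N (y @ [Pop b]))" and ?ps = "drop (b - c0) (pst y)"
  show ?thesis
  proof (cases c0)
    case 0
    have adm: "admissible s t (y @ [Pop b])" using dn 0 unfolding admissible_Pop_pre by simp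
    have ps: "pst (y @ [Pop b]) = ?ps" using 0 by simp
    show ?thesis using assms(2)
    proof cases
      case (gread q a Z p \<beta> w' \<gamma>)
      then have q: "q = Dn 0 ?R" "x = a # w'" "Z # \<gamma> = stk ?ps" using dn 0 by auto
      have al: "a \<in> op_alphabet s t" and r: "raw N s t q (Some a) Z = Some (p, \<beta>)"
        using gread(3) unfolding d_def by (auto split: if_splits)
      have "Z \<noteq> None" using r q by (cases a; cases Z) auto
      then obtain e ps' where e: "?ps = e # ps'" "Z = Some (absS N e)" "\<gamma> = stk ps'"
        using q(3) by (cases rule: stk_cases[of ?ps]) auto
      show ?thesis
      proof (cases a)
        case (Push k)
        then have "p = Up (take N [k])"
          "\<beta> @ \<gamma> = Some (take N [k]) # replicate (k - 1) (Some []) @ stk (pst (y @ [Pop b]))"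
          using r q e ps by (auto simp: push_move_def)
        then show ?thesis using reach_up_Push[OF adm, of k w'] al Push dn(1) q gread(2) by simp
      next
        case (Pop b')
        have th: "top_hist N (y @ [Pop b]) = absS N e" unfolding top_hist_def ps using e by simp
        have tk: "take N (tr N ((y @ [Pop b]) @ [Pop b'])) = take N ((absS N e, b') # ?R)"
          unfolding take_tr[of "y @ [Pop b]"] th ..
        have pb: "chk s t (take N ((absS N e, b') # ?R))" "p = Dn (b' - 1) (take N ((absS N e, b') # ?R))" "\<beta> = []"
          using r q e Pop by (auto split: if_splits)
        have b': "1 \<le> b'" "b' \<le> t" using al Pop by auto
        have "pre (y @ [Pop b]) b'" unfolding pre_def tk using adm b' pb(1) by simp
        then have "reach ((y @ [Pop b]) @ Pop b' # w') (Dn (b' - 1) (take N (tr N ((y @ [Pop b]) @ [Pop b']))), w',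
            stk (drop (b' - (b' - 1)) (pst (y @ [Pop b]))))"
          by (rule reach.dn) (use b' e ps in auto)
        moreover have "b' - (b' - 1) = 1" using b' by simp
        ultimately show ?thesis unfolding tk ps using e pb dn(1) q gread(2) Pop by simp
      qed
    next
      case (geps q Z p \<beta> w' \<gamma>)
      then have q: "q = Dn 0 ?R" "x = w'" "Z # \<gamma> = stk ?ps" using dn 0 by auto
      have r: "raw N s t q None Z = Some (p, \<beta>)" using geps(3) unfolding d_def by (auto split: if_splits)
      then have Z: "Z = None" "p = Fin" "\<beta> = [None]" using q by (cases Z; simp)+
      then have "?ps = []" "\<gamma> = []" using q(3) by (cases rule: stk_cases[of ?ps]; simp)+
      then have "reach ((y @ [Pop b]) @ w') (Fin, w', [None])" using adm ps by (intro reach.fin) auto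
      then show ?thesis using dn(1) q Z \<open>\<gamma> = []\<close> geps(2) by simp
    qed
  next
    case (Suc c1)
    show ?thesis using assms(2)
    proof cases
      case (gread q a Z p \<beta> w' \<gamma>)
      then have "q = Dn (Suc c1) ?R" using dn Suc by auto
      then show ?thesis using gread(3) unfolding d_def by (cases a; cases Z; auto split: if_splits)
    next
      case (geps q Z p \<beta> w' \<gamma>)
      then have q: "q = Dn (Suc c1) ?R" "x = w'" "Z # \<gamma> = stk ?ps" using dn Suc by auto
      have r: "raw N s t q None Z = Some (p, \<beta>)" using geps(3) unfolding d_def by (auto split: if_splits)
      have "Z \<noteq> None" using r q by (cases Z) auto
      then obtain e ps' where e: "?ps = e # ps'" "Z = Some (absS N e)" "\<gamma> = stk ps'"
        using q(3) by (cases rule: stk_cases[of ?ps]) auto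
      have pb: "p = Dn c1 ?R" "\<beta> = []" using r q e by auto
      have bc: "b - c1 = Suc (b - c0)" using Suc dn(4) by simp
      have l: "b - c1 \<le> length (pst y)"
      proof -
        have "length ?ps = Suc (length ps')" using e(1) by simp
        then show ?thesis unfolding bc by simp
      qed
      have ps': "ps' = drop (b - c1) (pst y)" unfolding bc using e(1) by (metis drop_Suc list.sel(3) tl_drop)
      have "reach (y @ Pop b # w') (Dn c1 ?R, w', stk (drop (b - c1) (pst y)))"
        by (rule reach.dn) (use dn Suc l in auto)
      then show ?thesis using dn(1) q pb e ps' geps(2) by simp
    qed
  qed
qed

lemma reach_steps: "(gstep d)\<^sup>*\<^sup>* c c' \<Longrightarrow> reach w c \<Longrightarrow> reach w c'"
  by (induction rule: rtranclp_induct) (auto intro: reach_step)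

lemma accepted_admissible:
  assumes "(gstep d)\<^sup>*\<^sup>* (Fin, w, [None]) (Fin, [], \<gamma>)"
  shows "admissible s t w \<and> well_formed w"
proof -
  have "reach ([] @ w) (Fin, w, [None])" by (rule fin) (simp_all add: admissible_Nil)
  then have "reach w (Fin, [], \<gamma>)" using reach_steps[OF assms] by simp
  then show ?thesis
  proof cases
    case (fin y)
    then have "admissible s t w" "pst w = []" by auto
    then show ?thesis using length_pst[of w] unfolding admissible_def well_formed_ht by auto
  qed
qed

section \<open>Completeness: admissible well-formed words are accepted\<close>

lemma d_raw:
  "q \<in> Q \<Longrightarrow> Z \<in> G \<Longrightarrow> (\<And>a. x = Some a \<Longrightarrow> a \<in> op_alphabet s t) \<Longrightarrow> d q x Z = raw N s t q x Z"
  unfolding d_def by auto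

lemma eps_pops:
  "k \<le> length ps \<Longrightarrow> R \<in> RL \<Longrightarrow> k \<le> t \<Longrightarrow> set (stk ps) \<subseteq> G \<Longrightarrow>
   (gstep d)\<^sup>*\<^sup>* (Dn k R, x, stk ps) (Dn 0 R, x, stk (drop k ps))"
proof (induction k arbitrary: ps)
  case (Suc k)
  then obtain e ps' where e: "ps = e # ps'" "stk ps = Some (absS N e) # stk ps'"
    by (cases rule: stk_cases[of ps]) auto
  have "d (Dn (Suc k) R) None (Some (absS N e)) = Some (Dn k R, [])"
    using Suc.prems e by (subst d_raw) auto
  then have "gstep d (Dn (Suc k) R, x, Some (absS N e) # stk ps') (Dn k R, x, [] @ stk ps')" by (rule geps)
  moreover have "(gstep d)\<^sup>*\<^sup>* (Dn k R, x, stk ps') (Dn 0 R, x, stk (drop k ps'))"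
    by (rule Suc.IH) (use Suc.prems e in auto)
  ultimately show ?case using e by (simp add: converse_rtranclp_into_rtranclp)
qed simp

text \<open>The state reached before a possible epsilon move to \<open>Fin\<close>: after a nonempty
  word that empties the stack it is still a \<open>Dn\<close> state.\<close>

definition st_of :: "op list \<Rightarrow> mst" where
  "st_of y = (if ends_push y then Up (take N (tp y)) else if ends_pop y then Dn 0 (take N (tr N y)) else Fin)"

lemma admissible_run:
  "admissible s t y \<Longrightarrow> (gstep d)\<^sup>*\<^sup>* (Fin, y @ x, [None]) (st_of y, x, stk (pst y))"
proof (induction y arbitrary: x rule: rev_induct)
  case Nil
  then show ?case by (simp add: st_of_def stk_def)
next
  case (snoc z y)
  show ?case
  proof (cases z)
    case (Push a)
    have adm: "admissible s t y" "1 \<le> a" "a \<le> s" using snoc(2) unfolding Push admissible_Push by auto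
    have IH: "(gstep d)\<^sup>*\<^sup>* (Fin, (y @ [z]) @ x, [None]) (st_of y, Push a # x, stk (pst y))"
      using snoc(1)[OF adm(1), of "Push a # x"] Push by simp
    obtain Z \<gamma> where Z: "stk (pst y) = Z # \<gamma>" by (cases rule: stk_cases[of "pst y"]) auto
    have ZG: "Z \<in> G" using stk_G[OF adm(1), of 0] Z by simp
    have goal: "(st_of (y @ [z]), x, stk (pst (y @ [z]))) =
       (Up (take N (a # take N (tp y))), x, (Some (take N (a # take N (tp y))) # replicate (a - 1) (Some []) @ [Z]) @ \<gamma>)"
      unfolding Push stk_Push take_tp st_of_def using Z by (simp add: take_tp[symmetric] del: take_Cons)
    have step: "gstep d (q, Push a # x, stk (pst y)) (st_of (y @ [z]), x, stk (pst (y @ [z])))"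
      if "q \<in> Q" "raw N s t q (Some (Push a)) Z = push_move N (take N (tp y)) a Z" for q
    proof -
      have "d q (Some (Push a)) Z = Some (Up (take N (a # take N (tp y))),
          Some (take N (a # take N (tp y))) # replicate (a - 1) (Some []) @ [Z])"
        using d_raw[of q Z "Some (Push a)"] that ZG adm unfolding push_move_def by auto
      then show ?thesis unfolding goal Z by (rule gread)
    qed
    consider "ends_push y" | "ends_pop y" "pst y \<noteq> []" | "ends_pop y" "pst y = []" | "y = []"
      using ends_cases[of y] by blast
    then show ?thesis
    proof cases
      case 1
      then have "st_of y = Up (take N (tp y))" by (simp add: st_of_def)
      then have "gstep d (st_of y, Push a # x, stk (pst y)) (st_of (y @ [z]), x, stk (pst (y @ [z])))"
        using step[of "st_of y"] tp_HL[OF adm(1)] by simp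
      then show ?thesis using IH by (meson rtranclp.rtrancl_into_rtrancl)
    next
      case 2
      then have np: "\<not> ends_push y" by (auto simp: ends_pop_def)
      then have q: "st_of y = Dn 0 (take N (tr N y))" using 2 by (simp add: st_of_def)
      obtain X where "Z = Some X" using 2 Z by (cases rule: stk_cases[of "pst y"]) auto
      then have "gstep d (st_of y, Push a # x, stk (pst y)) (st_of (y @ [z]), x, stk (pst (y @ [z])))"
        using step[of "st_of y"] q tr_RL[OF adm(1)] tp_empty[OF np] by simp
      then show ?thesis using IH by (meson rtranclp.rtrancl_into_rtrancl)
    next
      case 3
      then have np: "\<not> ends_push y" by (auto simp: ends_pop_def)
      then have q: "st_of y = Dn 0 (take N (tr N y))" using 3 by (simp add: st_of_def)
      have s0: "stk (pst y) = [None]" using 3 by (simp add: stk_def)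
      \<comment> \<open>On an empty working stack the automaton must pass to \<open>Fin\<close>
        before it can read the push.\<close>
      have "d (Dn 0 (take N (tr N y))) None None = Some (Fin, [None])"
        using tr_RL[OF adm(1)] by (subst d_raw) auto
      then have "gstep d (Dn 0 (take N (tr N y)), Push a # x, None # []) (Fin, Push a # x, [None] @ [])" by (rule geps)
      then have e1: "gstep d (st_of y, Push a # x, stk (pst y)) (Fin, Push a # x, stk (pst y))"
        unfolding q s0 by simp
      have "gstep d (Fin, Push a # x, stk (pst y)) (st_of (y @ [z]), x, stk (pst (y @ [z])))"
        using step[of Fin] s0 Z tp_empty[OF np] by simp
      then show ?thesis using IH e1 by (meson rtranclp.rtrancl_into_rtrancl)
    next
      case 4
      then have "gstep d (st_of y, Push a # x, stk (pst y)) (st_of (y @ [z]), x, stk (pst (y @ [z])))"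
        using step[of Fin] Z by (simp add: st_of_def stk_def)
      then show ?thesis using IH by (meson rtranclp.rtrancl_into_rtrancl)
    qed
  next
    case (Pop b)
    have pre: "pre y b" and bl: "b \<le> length (pst y)" using snoc(2) unfolding Pop admissible_Pop_pre by auto
    then have adm: "admissible s t y" "1 \<le> b" "b \<le> t"
      and red: "\<And>y0 a. y = y0 @ [Push a] \<Longrightarrow> a = 1 \<and> b = 1"
      and ck: "chk s t (take N (tr N (y @ [Pop b])))" unfolding pre_def by blast+
    have IH: "(gstep d)\<^sup>*\<^sup>* (Fin, (y @ [z]) @ x, [None]) (st_of y, Pop b # x, stk (pst y))"
      using snoc(1)[OF adm(1), of "Pop b # x"] Pop by simp
    obtain e ps where e: "pst y = e # ps" "stk (pst y) = Some (absS N e) # stk ps"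
      using bl adm(2) by (cases rule: stk_cases[of "pst y"]) auto
    have SG: "set (stk (pst y)) \<subseteq> G" using stk_G[OF adm(1), of 0] by simp
    have eG: "Some (absS N e) \<in> G" "set (stk ps) \<subseteq> G" using SG e by auto
    let ?R = "take N (tr N (y @ [Pop b]))"
    have RL: "?R \<in> RL" using tr_RL[OF snoc(2)] Pop by simp
    have "d (st_of y) (Some (Pop b)) (Some (absS N e)) = Some (Dn (b - 1) ?R, [])"
    proof (cases "ends_push y")
      case True
      then obtain y0 a where y0: "y = y0 @ [Push a]" unfolding ends_push_def by blast
      then have ab: "a = 1" "b = 1" using red by auto
      have "take 1 (take N (tp y)) = [1]" using y0 ab N2 by (cases N) auto
      moreover have "?R = [([], 1)]" using tr_after_push[OF True, of b] ab N2 by simp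
      moreover have "st_of y = Up (take N (tp y))" using True by (simp add: st_of_def)
      ultimately show ?thesis using tp_HL[OF adm(1)] eG adm ab by (subst d_raw) auto
    next
      case False
      have "y \<noteq> []" using e by auto
      then have ep: "ends_pop y" using ends_cases[of y] False by blast
      then have "st_of y = Dn 0 (take N (tr N y))" using False by (simp add: st_of_def)
      moreover have "top_hist N y = absS N e" unfolding top_hist_def using ep e by simp
      then have "take N ((absS N e, b) # take N (tr N y)) = ?R" unfolding take_tr by simp
      ultimately show ?thesis using tr_RL[OF adm(1)] eG adm ck
        by (subst d_raw) (auto simp del: take_Cons tr_simps)
    qed
    then have "gstep d (st_of y, Pop b # x, Some (absS N e) # stk ps) (Dn (b - 1) ?R, x, [] @ stk ps)" by (rule gread)
    then have "gstep d (st_of y, Pop b # x, stk (pst y)) (Dn (b - 1) ?R, x, stk ps)" unfolding e(2) by simp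
    moreover have "(gstep d)\<^sup>*\<^sup>* (Dn (b - 1) ?R, x, stk ps) (Dn 0 ?R, x, stk (drop (b - 1) ps))"
      by (rule eps_pops) (use bl e RL adm eG in auto)
    moreover have "drop (b - 1) ps = pst (y @ [z])" using e adm(2) Pop by (cases b) auto
    moreover have "st_of (y @ [z]) = Dn 0 ?R" using Pop by (simp add: st_of_def del: tr_simps)
    ultimately show ?thesis using IH by (metis (no_types, lifting) rtranclp.rtrancl_into_rtrancl rtranclp_trans)
  qed
qed

lemma admissible_accepted:
  assumes "admissible s t w" "well_formed w"
  shows "\<exists>\<gamma>. (gstep d)\<^sup>*\<^sup>* (Fin, w, [None]) (Fin, [], \<gamma>)"
proof (cases "w = []")
  case False
  then obtain y0 b where "w = y0 @ [Pop b]" using well_formed_last[OF assms(2)] by blast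
  then have q: "st_of w = Dn 0 (take N (tr N w))" by (simp add: st_of_def)
  have "pst w = []" using length_pst[of w 0] assms(2) by (simp add: well_formed_ht)
  then have run: "(gstep d)\<^sup>*\<^sup>* (Fin, w, [None]) (Dn 0 (take N (tr N w)), [], [None])"
    using admissible_run[OF assms(1), of "[]"] q by (simp add: stk_def)
  have "d (Dn 0 (take N (tr N w))) None None = Some (Fin, [None])"
    using tr_RL[OF assms(1)] by (subst d_raw) auto
  then have "gstep d (Dn 0 (take N (tr N w)), [], None # []) (Fin, [], [None] @ [])" by (rule geps)
  then show ?thesis using run by (meson rtranclp.rtrancl_into_rtrancl)
qed auto

lemma recognised:
  "\<exists>M :: op dpda. is_dpda (op_alphabet s t) M \<and>
     dpda_lang M = {w. well_formed w \<and> set w \<subseteq> op_alphabet s t \<and> reduced w \<and> irreducible_word s t w}"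
proof (intro exI conjI)
  let ?M = "enc_dpda Q G Fin None {Fin} d"
  show "is_dpda (op_alphabet s t) ?M"
  proof (rule is_dpda_enc)
    have "op_alphabet s t = Push ` {1..s} \<union> Pop ` {1..t}" unfolding op_alphabet_def by auto
    then show "finite (op_alphabet s t)" by simp
  qed (use finite_Q finite_G d_closed d_det in auto)
  have "dpda_lang ?M = {w. \<exists>q \<gamma>. (gstep d)\<^sup>*\<^sup>* (Fin, w, [None]) (q, [], \<gamma>) \<and> q \<in> {Fin}}"
    by (rule dpda_lang_enc) (use d_closed in blast)
  also have "\<dots> = {w. admissible s t w \<and> well_formed w}"
    using accepted_admissible admissible_accepted by blast
  also have "\<dots> = {w. well_formed w \<and> set w \<subseteq> op_alphabet s t \<and> reduced w \<and> irreducible_word s t w}"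
    unfolding admissible_def well_formed_ht by auto
  finally show "dpda_lang ?M = \<dots>" .
qed

end

theorem mainTheorem14:
  fixes s t :: nat
  assumes "1 \<le> s" and "1 \<le> t"
  shows "\<exists>M :: op dpda. is_dpda (op_alphabet s t) M \<and>
           (\<forall>w\<in>dpda_lang M. well_formed w \<and> reduced w) \<and>
           (\<forall>\<alpha>. well_formed \<alpha> \<and> set \<alpha> \<subseteq> op_alphabet s t \<longrightarrow>
              (\<exists>!\<beta>. \<beta> \<in> dpda_lang M \<and> equivalent \<beta> \<alpha>))"
proof -
  interpret machine s t "2 * max s t" by unfold_locales (use assms in auto)
  obtain M :: "op dpda" where M: "is_dpda (op_alphabet s t) M"
    "dpda_lang M = {w. well_formed w \<and> set w \<subseteq> op_alphabet s t \<and> reduced w \<and> irreducible_word s t w}"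
    using recognised by blast
  have "\<exists>!\<beta>. \<beta> \<in> dpda_lang M \<and> equivalent \<beta> \<alpha>" if a: "well_formed \<alpha>" "set \<alpha> \<subseteq> op_alphabet s t" for \<alpha>
  proof (rule ex_ex1I)
    show "\<exists>\<beta>. \<beta> \<in> dpda_lang M \<and> equivalent \<beta> \<alpha>"
      using exists_irreducible[OF a] unfolding M(2) by blast
  next
    fix \<beta> \<beta>' assume "\<beta> \<in> dpda_lang M \<and> equivalent \<beta> \<alpha>" "\<beta>' \<in> dpda_lang M \<and> equivalent \<beta>' \<alpha>"
    then show "\<beta> = \<beta>'"
      using irreducible_unique[OF assms, of \<beta> \<beta>'] unfolding M(2) equivalent_def by auto
  qed
  moreover have "\<forall>w\<in>dpda_lang M. well_formed w \<and> reduced w" unfolding M(2) by blast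
  ultimately show ?thesis using M(1) by (intro exI[of _ M]) blast
qed

end
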